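(* Assume the setting described in the context. The function $\Gamma^*(z;\zeta):=\Gamma(\zeta;z)$ is a global fundamental solution of $\mathcal{H}^*=\sum_{j=1}^mX_j^2+\partial_t$, i.e. for every $z\in\mathbb{R}^{1+n}$, $\Gamma^*(z;\cdot)\in L^1_{\mathrm{loc}}(\mathbb{R}^{1+n})$ and $\int_{\mathbb{R}^{1+n}}\Gamma^*(z;\zeta)\,\mathcal{H}\varphi(\zeta)\,d\zeta=-\varphi(z)$ for every $\varphi\in C_0^\infty(\mathbb{R}^{1+n})$.
   Context: Let $X_1,\dots,X_m$ be smooth vector fields on $\mathbb{R}^n$, linearly independent in the vector space of smooth vector fields, satisfying: (H.1) there are reals $1=\sigma_1\le\dots\le\sigma_n$ such that, with $\delta_\lambda(x)=(\lambda^{\sigma_1}x_1,\dots,\lambda^{\sigma_n}x_n)$, $X_j(f\circ\delta_\lambda)=\lambda(X_jf)\circ\delta_\lambda$ for all $\lambda>0$, $f\in C^\infty(\mathbb{R}^n)$; (H.2) $\dim\{Y(0):Y\in\mathrm{Lie}\{X_1,\dots,X_m\}\}=n$. Let $N=\dim\mathrm{Lie}\{X_1,\dots,X_m\}$, assume $N>n$, $p=N-n$. Let $\mathcal{H}=\sum_jX_j^2-\partial_t$ on $\mathbb{R}^{1+n}$. Fix a homogeneous Carnot group $\mathbb{G}=(\mathbb{R}^N,\star)$ on $\mathbb{R}^N=\mathbb{R}^n_x\times\mathbb{R}^p_\xi$ with dilations $D_\lambda(x,\xi)=(\delta_\lambda(x),\delta^*_\lambda(\xi))$, $\delta^*_\lambda(\xi)=(\lambda^{\sigma^*_1}\xi_1,\dots,\lambda^{\sigma^*_p}\xi_p)$,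 and left-invariant $D_\lambda$-homogeneous of degree 1 vector fields $Z_1,\dots,Z_m$ Lie-generating its Lie algebra with $Z_i(f\circ\pi)(x,\xi)=(X_if)(x)$ for $f\in C^\infty(\mathbb{R}^n)$, $\pi(x,\xi)=x$ (such objects exist). Let $\gamma_{\mathbb{G}}$ be the unique fundamental solution of $\sum_jZ_j^2-\partial_t$ on $\mathbb{R}^{1+N}$ with pole at the origin vanishing at infinity, and $\Gamma(z;\zeta)=\Gamma(t,x;s,y)=\int_{\mathbb{R}^p}\gamma_{\mathbb{G}}(s-t,(x,0)^{-1}\star(y,\eta))\,d\eta$ for $z=(t,x)$, $\zeta=(s,y)$. *)

theory Defs
  imports "HOL-Analysis.Analysis"
begin

definition iter_deriv :: "'a::euclidean_space list \<Rightarrow> ('a \<Rightarrow> 'b::real_normed_vector) \<Rightarrow> ('a \<Rightarrow> 'b)" where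
  "iter_deriv vs f = foldr (\<lambda>v g. \<lambda>x. frechet_derivative g (at x) v) vs f"

definition smooth :: "('a::euclidean_space \<Rightarrow> 'b::real_normed_vector) \<Rightarrow> bool" where
  "smooth f \<longleftrightarrow> (\<forall>vs. set vs \<subseteq> Basis \<longrightarrow> (\<forall>x. iter_deriv vs f differentiable (at x)))"

text \<open>A vector field is identified with its coefficient map; it acts on functions as a
  first order differential operator.\<close>
definition vf_apply :: "('a::euclidean_space \<Rightarrow> 'a) \<Rightarrow> ('a \<Rightarrow> real) \<Rightarrow> ('a \<Rightarrow> real)" where
  "vf_apply V f = (\<lambda>x. frechet_derivative f (at x) (V x))"

text \<open>Commutator of vector fields: \<open>[V,W] f = V (W f) - W (V f)\<close>.\<close>
definition vf_bracket :: "('a::euclidean_space \<Rightarrow> 'a) \<Rightarrow> ('a \<Rightarrow> 'a) \<Rightarrow> ('a \<Rightarrow> 'a)" where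
  "vf_bracket V W = (\<lambda>x. frechet_derivative W (at x) (V x) - frechet_derivative V (at x) (W x))"

definition vf_div :: "('a::euclidean_space \<Rightarrow> 'a) \<Rightarrow> 'a \<Rightarrow> real" where
  "vf_div V x = (\<Sum>b\<in>Basis. frechet_derivative V (at x) b \<bullet> b)"

definition vf_adj :: "('a::euclidean_space \<Rightarrow> 'a) \<Rightarrow> ('a \<Rightarrow> real) \<Rightarrow> ('a \<Rightarrow> real)" where
  "vf_adj V f = (\<lambda>x. - vf_apply V f x - vf_div V x * f x)"

inductive_set lie_gen :: "('a::euclidean_space \<Rightarrow> 'a) set \<Rightarrow> ('a \<Rightarrow> 'a) set" for S where
  base: "V \<in> S \<Longrightarrow> V \<in> lie_gen S"
| add: "V \<in> lie_gen S \<Longrightarrow> W \<in> lie_gen S \<Longrightarrow> (\<lambda>x. V x + W x) \<in> lie_gen S"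
| scale: "V \<in> lie_gen S \<Longrightarrow> (\<lambda>x. c *\<^sub>R V x) \<in> lie_gen S"
| bracket: "V \<in> lie_gen S \<Longrightarrow> W \<in> lie_gen S \<Longrightarrow> vf_bracket V W \<in> lie_gen S"

definition vf_lin_indep :: "(nat \<Rightarrow> ('a::euclidean_space \<Rightarrow> 'a)) \<Rightarrow> nat \<Rightarrow> bool" where
  "vf_lin_indep V k \<longleftrightarrow>
     (\<forall>c::nat \<Rightarrow> real. (\<forall>x. (\<Sum>i<k. c i *\<^sub>R V i x) = 0) \<longrightarrow> (\<forall>i<k. c i = 0))"

definition vf_dim_eq :: "('a::euclidean_space \<Rightarrow> 'a) set \<Rightarrow> nat \<Rightarrow> bool" where
  "vf_dim_eq L N \<longleftrightarrow>
     (\<exists>Y. (\<forall>i<N. Y i \<in> L) \<and> vf_lin_indep Y N \<and>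
          (\<forall>V\<in>L. \<exists>c::nat \<Rightarrow> real. V = (\<lambda>x. \<Sum>i<N. c i *\<^sub>R Y i x)))"

definition dil :: "('i::finite \<Rightarrow> real) \<Rightarrow> real \<Rightarrow> real^'i \<Rightarrow> real^'i" where
  "dil \<sigma> r x = (\<chi> k. r powr \<sigma> k * x $ k)"

definition tvf :: "('a::euclidean_space \<Rightarrow> 'a) \<Rightarrow> (real \<times> 'a \<Rightarrow> real \<times> 'a)" where
  "tvf V = (\<lambda>(t, x). (0, V x))"

definition dt :: "(real \<times> 'a::euclidean_space \<Rightarrow> real) \<Rightarrow> (real \<times> 'a \<Rightarrow> real)" where
  "dt f = vf_apply (\<lambda>_. (1, 0)) f"

definition heat_op :: "(nat \<Rightarrow> ('a::euclidean_space \<Rightarrow> 'a)) \<Rightarrow> nat \<Rightarrow> (real \<times> 'a \<Rightarrow> real) \<Rightarrow> (real \<times> 'a \<Rightarrow> real)" where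
  "heat_op X m f = (\<lambda>w. (\<Sum>j<m. vf_apply (tvf (X j)) (vf_apply (tvf (X j)) f) w) - dt f w)"

definition heat_op_transp :: "(nat \<Rightarrow> ('a::euclidean_space \<Rightarrow> 'a)) \<Rightarrow> nat \<Rightarrow> (real \<times> 'a \<Rightarrow> real) \<Rightarrow> (real \<times> 'a \<Rightarrow> real)" where
  "heat_op_transp X m f = (\<lambda>w. (\<Sum>j<m. vf_adj (tvf (X j)) (vf_adj (tvf (X j)) f) w) + dt f w)"

definition test_fun :: "('a::euclidean_space \<Rightarrow> real) \<Rightarrow> bool" where
  "test_fun \<phi> \<longleftrightarrow> smooth \<phi> \<and> compact (closure {w. \<phi> w \<noteq> 0})"

definition loc_integrable :: "('a::euclidean_space \<Rightarrow> real) \<Rightarrow> bool" where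
  "loc_integrable f \<longleftrightarrow> (\<forall>K. compact K \<longrightarrow> set_integrable lborel K f)"

section \<open>The kernel \<open>\<Gamma>\<close> obtained by saturating the lifted heat kernel\<close>

definition Gamma_lift ::
  "((real^'n) \<times> (real^'p) \<Rightarrow> (real^'n) \<times> (real^'p) \<Rightarrow> (real^'n) \<times> (real^'p)) \<Rightarrow>
   ((real^'n) \<times> (real^'p) \<Rightarrow> (real^'n) \<times> (real^'p)) \<Rightarrow>
   (real \<times> ((real^'n) \<times> (real^'p)) \<Rightarrow> real) \<Rightarrow>
   real \<times> (real^'n) \<Rightarrow> real \<times> (real^'n) \<Rightarrow> real" where
  "Gamma_lift star ginv \<gamma> z \<zeta> =
     (case z of (t, x) \<Rightarrow> case \<zeta> of (s, y) \<Rightarrow>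
        (\<integral>\<eta>. \<gamma> (s - t, star (ginv (x, 0)) (y, \<eta>)) \<partial>lborel))"

end

theory Submission
  imports Defs "HOL-Computational_Algebra.Polynomial"
begin

text \<open>Write \<open>L = \<Sum> Z\<^sub>j\<^sup>2 - \<partial>\<^sub>t\<close>. The potential \<open>W(p) = \<integral> f(p * q\<^sup>-\<^sup>1) \<gamma>(q) dq\<close> of a test function \<open>f\<close> is smooth,
  vanishes at infinity and satisfies \<open>L W = - f\<close>, because \<open>Z\<^sub>j\<close> acting on \<open>p\<close> equals \<open>- Z\<^sub>j\<close> acting on \<open>q\<close>.
  Hence no hypoellipticity is needed: the classical maximum principle applies to \<open>W\<close>. With the barrier
  \<open>arctan t + pi / 2\<close> and duality it shows that \<open>\<gamma>\<close> is integrable on every strip \<open>\<bar>t\<bar> \<le> T\<close>; as a Liouville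
  theorem it gives \<open>W = - u\<close> for \<open>f = L u\<close>. Taking \<open>u = \<phi>(t, x) \<theta>(D\<^sub>r(x, \<xi>))\<close> with \<open>r\<close> tending to \<open>0\<close>, the
  convergence being dominated on a strip, removes the compact support in \<open>\<xi>\<close>. All left-invariant fields project
  to \<open>\<real>\<^sup>n\<close>, so by uniqueness for ODEs the first component of \<open>a * c\<close> depends on \<open>a\<close> only through its first
  component. Therefore \<open>(y, \<eta>) \<mapsto> (y, 0)\<^sup>-\<^sup>1 * (x, \<eta>)\<close> is a bijection; it preserves volume since
  Jacobians of maps commuting with the dilations are constant, and substituting it gives the claim.\<close>

subsection \<open>Smooth functions\<close>

text \<open>The obstacle is how little is known of \<open>\<gamma>\<close>: it is locally
  integrable, tends to 0 at infinity and solves its equation against test functions. No sign and no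
  rate of decay are given, so even the convergence of the fibre integral has to be won. The maximum
  principle bounds the integral of \<open>g * \<gamma>\<close> for every test function
  \<open>g\<close> with values in [-1, 1], by a constant that depends on the time support of
  \<open>g\<close> alone; letting \<open>g\<close> approach the sign of \<open>\<gamma>\<close> then
  controls \<open>|\<gamma>|\<close>. The quotient \<open>p * q\<^sup>-\<^sup>1\<close> keeps the
  pole of \<open>\<gamma>\<close> fixed and puts every derivative on the smooth factor. The price is
  an asymmetry: left-invariant fields do not pass through right translations, so the identity for
  \<open>f = L u\<close> is no integration by parts, and this is where the Liouville theorem enters.
  The base point \<open>y\<close> is integrated because of the test function and
  \<open>\<eta>\<close> because of the kernel; together they fill the group. It is therefore this
  joint map, not a map of single fibres, whose volume distortion matters. The group law is not given
  by a formula, so its structure has to be read off from the generating fields.\<close>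

abbreviation fderiv :: "('a::real_normed_vector \<Rightarrow> 'b::real_normed_vector) \<Rightarrow> 'a \<Rightarrow> 'a \<Rightarrow> 'b" where
  "fderiv f x \<equiv> frechet_derivative f (at x)"

text \<open>\<open>ndiff n\<close> means n times differentiable. Counting orders permits induction
  on n, one partial derivative being removed per step; facts on \<open>smooth\<close> follow by
  quantifying over n.\<close>

primrec ndiff :: "nat \<Rightarrow> ('a::euclidean_space \<Rightarrow> 'b::real_normed_vector) \<Rightarrow> bool" where
  "ndiff 0 f \<longleftrightarrow> True"
| "ndiff (Suc n) f \<longleftrightarrow> (\<forall>x. f differentiable (at x)) \<and>
     (\<forall>b\<in>Basis. ndiff n (\<lambda>x. fderiv f x b))"

declare ndiff.simps(2) [simp del]

lemma iter_deriv_append: "iter_deriv (vs @ ws) f = iter_deriv vs (iter_deriv ws f)"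
  by (simp add: iter_deriv_def)

lemma iter_deriv_single: "iter_deriv [v] f = (\<lambda>x. fderiv f x v)"
  by (simp add: iter_deriv_def)

text \<open>\<open>iter_deriv\<close> applies the last direction of the list first, and
  \<open>ndiff\<close> starts with a derivative of \<open>f\<close> itself; hence the list is split
  at its end.\<close>

lemma ndiff_iff_iter_deriv:
  "ndiff n f \<longleftrightarrow> (\<forall>vs. set vs \<subseteq> Basis \<and> length vs < n \<longrightarrow> (\<forall>x. iter_deriv vs f differentiable (at x)))"
proof (induction n arbitrary: f)
  case 0 then show ?case by simp
next
  case (Suc n)
  show ?case
  proof
    assume L: "ndiff (Suc n) f"
    note L = L[unfolded ndiff.simps]
    show "\<forall>vs. set vs \<subseteq> Basis \<and> length vs < Suc n \<longrightarrow> (\<forall>x. iter_deriv vs f differentiable (at x))"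
    proof (intro allI impI)
      fix vs :: "'a list" and x assume vs: "set vs \<subseteq> Basis \<and> length vs < Suc n"
      show "iter_deriv vs f differentiable at x"
      proof (cases vs rule: rev_cases)
        case Nil then show ?thesis using L by (simp add: iter_deriv_def)
      next
        case (snoc ws v)
        with vs L have "ndiff n (iter_deriv [v] f)" by (simp add: iter_deriv_single)
        then show ?thesis using snoc vs Suc.IH by (simp add: iter_deriv_append)
      qed
    qed
  next
    assume R: "\<forall>vs. set vs \<subseteq> Basis \<and> length vs < Suc n \<longrightarrow> (\<forall>x. iter_deriv vs f differentiable (at x))"
    have "\<forall>x. f differentiable at x" using R[rule_format, of "[]"] by (simp add: iter_deriv_def)
    moreover have "ndiff n (\<lambda>x. fderiv f x b)" if b: "b \<in> Basis" for b
      unfolding Suc.IH iter_deriv_single[symmetric] iter_deriv_append[symmetric] using R b by auto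
    ultimately show "ndiff (Suc n) f" by (simp add: ndiff.simps)
  qed
qed

lemma smooth_iff_ndiff: "smooth f \<longleftrightarrow> (\<forall>n. ndiff n f)"
  unfolding smooth_def ndiff_iff_iter_deriv by blast

lemma smooth_imp_differentiable: "smooth f \<Longrightarrow> f differentiable (at x)"
  unfolding smooth_iff_ndiff using ndiff.simps(2)[of 0 f] by blast

lemma smooth_has_derivative: "smooth f \<Longrightarrow> (f has_derivative fderiv f x) (at x)"
  using frechet_derivative_works smooth_imp_differentiable by blast

text \<open>For families closed under partial differentiation, such as \<open>flat_exp\<close> and
  integrals with a parameter, this replaces formulas for higher derivatives.\<close>

lemma smooth_coinduct:
  assumes "P f" and "\<And>f. P f \<Longrightarrow> (\<forall>x. f differentiable (at x)) \<and>
     (\<forall>b\<in>Basis. P (\<lambda>x. fderiv f x b))"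
  shows "smooth f"
proof -
  have "P f \<Longrightarrow> ndiff n f" for n f
    by (induction n arbitrary: f) (use assms(2) in \<open>auto simp: ndiff.simps\<close>)
  then show ?thesis using assms(1) by (simp add: smooth_iff_ndiff)
qed

lemma smooth_imp_continuous_on: "smooth f \<Longrightarrow> continuous_on S f"
  by (intro continuous_at_imp_continuous_on ballI differentiable_imp_continuous_within
      smooth_imp_differentiable)

lemma smooth_isCont: "smooth f \<Longrightarrow> isCont f x"
  by (intro differentiable_imp_continuous_within smooth_imp_differentiable)

lemma smooth_borel_measurable:
  fixes f :: "'a::euclidean_space \<Rightarrow> 'b::euclidean_space"
  shows "smooth f \<Longrightarrow> f \<in> borel_measurable borel"
  by (intro borel_measurable_continuous_onI smooth_imp_continuous_on)

lemma ndiff_Suc_D: "ndiff (Suc n) f \<Longrightarrow> ndiff n f"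
  by (simp add: ndiff_iff_iter_deriv)

lemma ndiff_differentiable: "ndiff (Suc n) f \<Longrightarrow> f differentiable (at x)"
  by (simp add: ndiff.simps)

lemma ndiff_partial: "ndiff (Suc n) f \<Longrightarrow> b \<in> Basis \<Longrightarrow> ndiff n (\<lambda>x. fderiv f x b)"
  by (simp add: ndiff.simps)

lemma ndiff_has_derivative: "ndiff (Suc n) f \<Longrightarrow> (f has_derivative fderiv f x) (at x)"
  using frechet_derivative_works ndiff_differentiable by blast

lemma linear_frechet_derivative: "smooth f \<Longrightarrow> linear (fderiv f x)"
  by (rule has_derivative_linear[OF smooth_has_derivative])

lemma smooth_partial: "smooth f \<Longrightarrow> b \<in> Basis \<Longrightarrow> smooth (\<lambda>x. fderiv f x b)"
  unfolding smooth_iff_ndiff using ndiff_partial by blast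

lemma ndiff_SucI:
  assumes "\<And>x. (f has_derivative f' x) (at x)" and "\<And>b. b \<in> Basis \<Longrightarrow> ndiff n (\<lambda>x. f' x b)"
  shows "ndiff (Suc n) f"
proof -
  have "fderiv f x = f' x" for x 
    using frechet_derivative_at[OF assms(1)] by simp
  moreover have "f differentiable (at x)" for x using assms(1) by (rule differentiableI)
  ultimately show ?thesis using assms(2) by (simp add: ndiff.simps)
qed

lemma ndiff_const: "ndiff n (\<lambda>x. c)"
proof (induction n arbitrary: c)
  case (Suc n) show ?case by (rule ndiff_SucI[where f' = "\<lambda>_ _. 0"]) (auto simp: Suc)
qed simp

lemma ndiff_add: "ndiff n f \<Longrightarrow> ndiff n g \<Longrightarrow> ndiff n (\<lambda>x. f x + g x)"
proof (induction n arbitrary: f g)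
  case (Suc n) show ?case
    by (rule ndiff_SucI[OF has_derivative_add[OF Suc.prems[THEN ndiff_has_derivative]]])
      (intro Suc.IH ndiff_partial Suc.prems)
qed simp

lemma ndiff_sum: "(\<And>i. i \<in> I \<Longrightarrow> ndiff n (f i)) \<Longrightarrow> ndiff n (\<lambda>x. \<Sum>i\<in>I. f i x)"
  by (induction I rule: infinite_finite_induct) (auto intro: ndiff_const ndiff_add)

lemma ndiff_bounded_linear:
  assumes h: "bounded_linear h" shows "ndiff n f \<Longrightarrow> ndiff n (\<lambda>x. h (f x))"
proof (induction n arbitrary: f)
  case (Suc n) show ?case
    by (rule ndiff_SucI[OF bounded_linear.has_derivative[OF h Suc.prems[THEN ndiff_has_derivative]]])
      (intro Suc.IH ndiff_partial Suc.prems)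
qed simp

lemma ndiff_linear: "bounded_linear h \<Longrightarrow> ndiff n h"
  using ndiff_SucI[of h "\<lambda>_. h"] bounded_linear_imp_has_derivative ndiff_const
  by (metis ndiff_Suc_D)

lemma ndiff_bilinear:
  assumes h: "bounded_bilinear h"
  shows "ndiff n f \<Longrightarrow> ndiff n g \<Longrightarrow> ndiff n (\<lambda>x. h (f x) (g x))"
proof (induction n arbitrary: f g)
  case (Suc n) show ?case
    by (rule ndiff_SucI[OF bounded_bilinear.FDERIV[OF h Suc.prems[THEN ndiff_has_derivative]]])
      (intro ndiff_add Suc.IH ndiff_partial Suc.prems ndiff_Suc_D[OF Suc.prems(1)] ndiff_Suc_D[OF Suc.prems(2)])
qed simp

lemma linear_basis_expansion:
  fixes f :: "'a::euclidean_space \<Rightarrow> 'b::real_vector"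
  assumes "linear f" shows "f v = (\<Sum>b\<in>Basis. (v \<bullet> b) *\<^sub>R f b)"
proof -
  have "f v = f (\<Sum>b\<in>Basis. (v \<bullet> b) *\<^sub>R b)" by (simp add: euclidean_representation)
  then show ?thesis by (simp add: linear_sum[OF assms] linear_scale[OF assms])
qed

text \<open>The chain rule is expanded over the basis, so a partial derivative of the composition is
  a sum of products of a partial of \<open>g\<close> with a partial of \<open>f\<close> composed
  with \<open>g\<close>. The induction hypothesis, general in \<open>f\<close>, covers the
  latter.\<close>

lemma ndiff_compose:
  fixes f :: "'b::euclidean_space \<Rightarrow> 'c::real_normed_vector" and g :: "'a::euclidean_space \<Rightarrow> 'b"
  shows "ndiff n f \<Longrightarrow> ndiff n g \<Longrightarrow> ndiff n (\<lambda>x. f (g x))"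
proof (induction n arbitrary: f)
  case (Suc n)
  have d: "((\<lambda>x. f (g x)) has_derivative (\<lambda>v. \<Sum>b\<in>Basis. (fderiv g x v \<bullet> b) *\<^sub>R
      fderiv f (g x) b)) (at x)" for x
  proof -
    have "((\<lambda>x. f (g x)) has_derivative (\<lambda>v. fderiv f (g x) (fderiv g x v))) (at x)"
      using diff_chain_at[OF ndiff_has_derivative[OF Suc.prems(2)] ndiff_has_derivative[OF Suc.prems(1)]]
      by (simp add: o_def)
    moreover have "(\<lambda>v. fderiv f (g x) (fderiv g x v)) =
        (\<lambda>v. \<Sum>b\<in>Basis. (fderiv g x v \<bullet> b) *\<^sub>R fderiv f (g x) b)"
      by (intro ext linear_basis_expansion[OF has_derivative_linear[OF ndiff_has_derivative[OF Suc.prems(1)]]])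
    ultimately show ?thesis by (simp only:)
  qed
  have "ndiff n (\<lambda>x. (fderiv g x c \<bullet> b) *\<^sub>R fderiv f (g x) b)"
    if "b \<in> Basis" "c \<in> Basis" for b c
  proof (rule ndiff_bilinear[OF bounded_bilinear_scaleR])
    show "ndiff n (\<lambda>x. fderiv g x c \<bullet> b)"
      by (rule ndiff_bounded_linear[OF bounded_linear_inner_left ndiff_partial[OF Suc.prems(2) that(2)]])
    show "ndiff n (\<lambda>x. fderiv f (g x) b)"
      by (rule Suc.IH[OF ndiff_partial[OF Suc.prems(1) that(1)] ndiff_Suc_D[OF Suc.prems(2)]])
  qed
  then show ?case
    by (intro ndiff_SucI[OF d] ndiff_sum)
qed simp

lemma smooth_const [intro]: "smooth (\<lambda>x. c)"
  and smooth_add [intro]: "smooth f \<Longrightarrow> smooth g \<Longrightarrow> smooth (\<lambda>x. f x + g x)"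
  and smooth_sum: "(\<And>i. i \<in> I \<Longrightarrow> smooth (F i)) \<Longrightarrow> smooth (\<lambda>x. \<Sum>i\<in>I. F i x)"
  and smooth_bounded_linear: "bounded_linear h \<Longrightarrow> smooth f \<Longrightarrow> smooth (\<lambda>x. h (f x))"
  and smooth_linear: "bounded_linear k \<Longrightarrow> smooth k"
  and smooth_bilinear: "bounded_bilinear p \<Longrightarrow> smooth f \<Longrightarrow> smooth g' \<Longrightarrow> smooth (\<lambda>x. p (f x) (g' x))"
  and smooth_compose: "smooth q \<Longrightarrow> smooth r \<Longrightarrow> smooth (\<lambda>x. q (r x))"
  by (auto simp: smooth_iff_ndiff intro: ndiff_const ndiff_add ndiff_sum ndiff_bounded_linear ndiff_linear
      ndiff_bilinear ndiff_compose)

lemma smooth_id [intro]: "smooth (\<lambda>x. x)"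
  by (rule smooth_linear) (rule bounded_linear_ident)

lemma smooth_mult [intro]: "smooth f \<Longrightarrow> smooth g \<Longrightarrow> smooth (\<lambda>x. f x * g x :: real)"
  by (rule smooth_bilinear[OF bounded_bilinear_mult])

lemma smooth_uminus [intro]: "smooth f \<Longrightarrow> smooth (\<lambda>x. - f x)"
  by (rule smooth_bounded_linear[OF bounded_linear_minus[OF bounded_linear_ident]])

lemma smooth_diff [intro]: "smooth f \<Longrightarrow> smooth g \<Longrightarrow> smooth (\<lambda>x. f x - g x)"
  using smooth_add[OF _ smooth_uminus, of f g] by simp

lemma smooth_fst [intro]: "smooth f \<Longrightarrow> smooth (\<lambda>x. fst (f x))"
  and smooth_snd [intro]: "smooth f \<Longrightarrow> smooth (\<lambda>x. snd (f x))"
  by (rule smooth_bounded_linear[OF bounded_linear_fst], assumption)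
     (rule smooth_bounded_linear[OF bounded_linear_snd], assumption)

lemma smooth_inner_left [intro]: "smooth f \<Longrightarrow> smooth (\<lambda>x. f x \<bullet> v)"
  by (rule smooth_bounded_linear[OF bounded_linear_inner_left])

lemma smooth_scaleR [intro]: "smooth f \<Longrightarrow> smooth g \<Longrightarrow> smooth (\<lambda>x. f x *\<^sub>R g x)"
  by (rule smooth_bilinear[OF bounded_bilinear_scaleR])

lemma smooth_inner [intro]: "smooth f \<Longrightarrow> smooth g \<Longrightarrow> smooth (\<lambda>x. f x \<bullet> g x)"
  by (rule smooth_bilinear[OF bounded_bilinear_inner])

lemma smooth_Pair [intro]:
  fixes f :: "'a::euclidean_space \<Rightarrow> 'b::euclidean_space" and g :: "'a \<Rightarrow> 'c::euclidean_space"
  assumes "smooth f" "smooth g" shows "smooth (\<lambda>x. (f x, g x))"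
proof -
  have "bounded_linear (\<lambda>y::'b. (y, 0::'c))" "bounded_linear (\<lambda>y::'c. (0::'b, y))"
    by (auto intro!: bounded_linear_Pair bounded_linear_ident bounded_linear_zero)
  then have "smooth (\<lambda>x. (f x, 0) + (0, g x))"
    using assms by (intro smooth_add) (auto dest: smooth_bounded_linear)
  then show ?thesis by simp
qed

lemma smooth_frechet_derivative [intro]:
  assumes "smooth f" "smooth V" shows "smooth (\<lambda>x. fderiv f x (V x))"
proof -
  have "(\<lambda>x. fderiv f x (V x)) =
      (\<lambda>x. \<Sum>b\<in>Basis. (V x \<bullet> b) *\<^sub>R fderiv f x b)"
    by (intro ext linear_basis_expansion linear_frechet_derivative[OF assms(1)])
  then show ?thesis
    using assms by (auto intro!: smooth_sum smooth_scaleR smooth_partial)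
qed

lemma smooth_vf_apply [intro]: "smooth V \<Longrightarrow> smooth f \<Longrightarrow> smooth (vf_apply V f)"
  unfolding vf_apply_def by (rule smooth_frechet_derivative)

lemma frechet_derivative_compose':
  assumes "smooth f" "(g has_derivative g') (at x)"
  shows "fderiv (\<lambda>x. f (g x)) x v = fderiv f (g x) (g' v)"
proof -
  have "((\<lambda>x. f (g x)) has_derivative (\<lambda>v. fderiv f (g x) (g' v))) (at x)"
    using diff_chain_at[OF assms(2) smooth_has_derivative[OF assms(1)]] by (simp only: o_def)
  from fun_cong[OF frechet_derivative_at[OF this]] show ?thesis by (rule sym)
qed

section \<open>Symmetry of second derivatives\<close>

lemma smooth_line_derivative:
  fixes g :: "'a::euclidean_space \<Rightarrow> real"
  assumes g: "smooth g"
  shows "((\<lambda>s. g (a + s *\<^sub>R u)) has_real_derivative fderiv g (a + s *\<^sub>R u) u) (at s)"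
proof -
  have "((\<lambda>s. a + s *\<^sub>R u) has_vector_derivative u) (at s)"
    by (auto intro!: derivative_eq_intros)
  then have "((\<lambda>s. g (a + s *\<^sub>R u)) has_vector_derivative fderiv g (a + s *\<^sub>R u) u) (at s)"
    using vector_derivative_diff_chain_within[of "\<lambda>s. a + s *\<^sub>R u" u s UNIV g]
      smooth_has_derivative[OF g] by (auto simp: o_def intro: has_derivative_at_withinI)
  then show ?thesis by (simp add: has_real_derivative_iff_has_vector_derivative)
qed

text \<open>The second difference is a difference of first differences, so the mean value theorem is
  used along \<open>v\<close> and then along \<open>w\<close>.\<close>

lemma double_difference_mvt:
  fixes f :: "'a::euclidean_space \<Rightarrow> real"
  assumes f: "smooth f" and h: "h > 0"
  shows "\<exists>\<xi> \<eta>. 0 < \<xi> \<and> \<xi> < h \<and> 0 < \<eta> \<and> \<eta> < h \<and>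
    f (x + h *\<^sub>R v + h *\<^sub>R w) - f (x + h *\<^sub>R v) - f (x + h *\<^sub>R w) + f x =
    h * h * fderiv (\<lambda>y. fderiv f y v) (x + \<xi> *\<^sub>R v + \<eta> *\<^sub>R w) w"
proof -
  let ?fv = "\<lambda>y. fderiv f y v"
  have fv: "smooth ?fv" using f by auto
  have "\<exists>\<xi>. 0 < \<xi> \<and> \<xi> < h \<and>
     (f ((x + h *\<^sub>R w) + h *\<^sub>R v) - f (x + h *\<^sub>R v)) - (f ((x + h *\<^sub>R w) + 0 *\<^sub>R v) - f (x + 0 *\<^sub>R v)) =
     (h - 0) * (?fv ((x + h *\<^sub>R w) + \<xi> *\<^sub>R v) - ?fv (x + \<xi> *\<^sub>R v))"
    by (rule MVT2[OF h]) (intro DERIV_diff smooth_line_derivative f)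
  then obtain \<xi> where \<xi>: "0 < \<xi>" "\<xi> < h" and
    1: "(f ((x + h *\<^sub>R w) + h *\<^sub>R v) - f (x + h *\<^sub>R v)) - (f ((x + h *\<^sub>R w) + 0 *\<^sub>R v) - f (x + 0 *\<^sub>R v)) =
     (h - 0) * (?fv ((x + h *\<^sub>R w) + \<xi> *\<^sub>R v) - ?fv (x + \<xi> *\<^sub>R v))" by blast
  have "\<exists>\<eta>. 0 < \<eta> \<and> \<eta> < h \<and> ?fv ((x + \<xi> *\<^sub>R v) + h *\<^sub>R w) - ?fv ((x + \<xi> *\<^sub>R v) + 0 *\<^sub>R w) =
      (h - 0) * fderiv ?fv ((x + \<xi> *\<^sub>R v) + \<eta> *\<^sub>R w) w"
    by (rule MVT2[OF h]) (intro smooth_line_derivative fv)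
  then obtain \<eta> where \<eta>: "0 < \<eta>" "\<eta> < h" and
    2: "?fv ((x + \<xi> *\<^sub>R v) + h *\<^sub>R w) - ?fv (x + \<xi> *\<^sub>R v) =
      h * fderiv ?fv ((x + \<xi> *\<^sub>R v) + \<eta> *\<^sub>R w) w" by auto
  have 3: "x + h *\<^sub>R w + \<xi> *\<^sub>R v = x + \<xi> *\<^sub>R v + h *\<^sub>R w" "x + h *\<^sub>R w + h *\<^sub>R v = x + h *\<^sub>R v + h *\<^sub>R w" by simp_all
  show ?thesis
    using \<xi> \<eta> 1[unfolded 3] 2 by (intro exI[of _ \<xi>] exI[of _ \<eta>]) (simp add: algebra_simps)
qed

text \<open>Exchanging \<open>v\<close> and \<open>w\<close> leaves the second difference unchanged.
  Hence the two mixed derivatives take a common value at points arbitrarily near \<open>x\<close>,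
  and continuity carries this to \<open>x\<close>.\<close>

lemma second_derivative_symmetric:
  fixes f :: "'a::euclidean_space \<Rightarrow> real"
  assumes f: "smooth f"
  shows "fderiv (\<lambda>x. fderiv f x v) x w =
         fderiv (\<lambda>x. fderiv f x w) x v"
    (is "?A x = ?B x")
proof (rule ccontr)
  assume ne: "?A x \<noteq> ?B x"
  define e where "e = \<bar>?A x - ?B x\<bar> / 2"
  have e: "e > 0" using ne by (simp add: e_def)
  have cont: "isCont ?A x" "isCont ?B x"
    by (rule smooth_isCont, intro smooth_frechet_derivative smooth_const f)+
  obtain d1 where d1: "d1 > 0" "\<And>y. dist y x < d1 \<Longrightarrow> dist (?A y) (?A x) < e"
    using cont(1) e unfolding continuous_at_eps_delta by blast
  obtain d2 where d2: "d2 > 0" "\<And>y. dist y x < d2 \<Longrightarrow> dist (?B y) (?B x) < e"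
    using cont(2) e unfolding continuous_at_eps_delta by blast
  \<comment> \<open>So small that all intermediate points lie within both radii; the added 1 keeps
    the denominator positive when both directions vanish.\<close>
  define h where "h = min d1 d2 / (norm v + norm w + 1)"
  have pos: "norm v + norm w + 1 > 0" by (simp add: add_nonneg_pos)
  have h: "h > 0" using d1 d2 pos by (auto simp: h_def intro!: divide_pos_pos)
  have small: "norm (s *\<^sub>R v + t *\<^sub>R w) < min d1 d2" if "0 < s" "s < h" "0 < t" "t < h" for s t
  proof -
    have "norm (s *\<^sub>R v + t *\<^sub>R w) \<le> s * norm v + t * norm w"
      using norm_triangle_ineq[of "s *\<^sub>R v" "t *\<^sub>R w"] that by simp
    also have "\<dots> \<le> h * norm v + h * norm w"
      using that by (intro add_mono mult_right_mono) auto
    also have "\<dots> < h * (norm v + norm w + 1)" using h by (simp add: algebra_simps)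
    also have "\<dots> = min d1 d2" using pos by (simp add: h_def)
    finally show ?thesis .
  qed
  obtain s t where st: "0 < s" "s < h" "0 < t" "t < h" and 1:
    "f (x + h *\<^sub>R v + h *\<^sub>R w) - f (x + h *\<^sub>R v) - f (x + h *\<^sub>R w) + f x = h * h * ?A (x + s *\<^sub>R v + t *\<^sub>R w)"
    using double_difference_mvt[OF f h, of x v w] by blast
  obtain s' t' where st': "0 < s'" "s' < h" "0 < t'" "t' < h" and 2:
    "f (x + h *\<^sub>R w + h *\<^sub>R v) - f (x + h *\<^sub>R w) - f (x + h *\<^sub>R v) + f x = h * h * ?B (x + s' *\<^sub>R w + t' *\<^sub>R v)"
    using double_difference_mvt[OF f h, of x w v] by blast
  have swap: "x + h *\<^sub>R v + h *\<^sub>R w = x + h *\<^sub>R w + h *\<^sub>R v" by simp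
  have "h * h * ?A (x + s *\<^sub>R v + t *\<^sub>R w) = h * h * ?B (x + s' *\<^sub>R w + t' *\<^sub>R v)"
    using 1[unfolded swap] 2 by linarith
  then have eq: "?A (x + s *\<^sub>R v + t *\<^sub>R w) = ?B (x + s' *\<^sub>R w + t' *\<^sub>R v)" using h by simp
  have "dist (x + s *\<^sub>R v + t *\<^sub>R w) x < d1"
    using small[OF st] by (simp add: dist_norm add.assoc)
  then have a: "dist (?A (x + s *\<^sub>R v + t *\<^sub>R w)) (?A x) < e" by (rule d1)
  have "dist (x + s' *\<^sub>R w + t' *\<^sub>R v) x < d2"
    using small[OF st'(3,4,1,2)] by (simp add: dist_norm add.assoc add.commute)
  then have "dist (?B (x + s' *\<^sub>R w + t' *\<^sub>R v)) (?B x) < e" by (rule d2)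
  with a eq have "\<bar>?A x - ?B x\<bar> < 2 * e" by (simp add: dist_real_def)
  then show False by (simp add: e_def)
qed

subsection \<open>Bump functions and test functions\<close>

text \<open>The derivative of \<open>p(1/x) exp(-1/x)\<close> is
  \<open>(1/x)^2 (p - p')(1/x) exp(-1/x)\<close>: the polynomial parameter closes the family under
  differentiation.\<close>

definition flat_exp :: "real poly \<Rightarrow> real \<Rightarrow> real" where
  "flat_exp p x = (if x > 0 then poly p (1 / x) * exp (- (1 / x)) else 0)"

lemma poly_div_exp_tendsto_0: "((\<lambda>y::real. poly p y * exp (- y)) \<longlongrightarrow> 0) at_top"
proof -
  have "((\<lambda>y::real. \<Sum>i\<le>degree p. coeff p i * (y ^ i / exp y)) \<longlongrightarrow> (\<Sum>i\<le>degree p. coeff p i * 0)) at_top"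
    by (intro tendsto_sum tendsto_mult tendsto_const tendsto_power_div_exp_0)
  then show ?thesis
    by (simp add: poly_altdef sum_distrib_right sum_divide_distrib exp_minus divide_inverse mult.assoc)
qed

lemma flat_exp_has_derivative:
  "(flat_exp p has_real_derivative flat_exp (monom 1 2 * (p - pderiv p)) x) (at x)"
proof -
  consider "x > 0" | "x < 0" | "x = 0" by linarith
  then show ?thesis
  proof cases
    case 1
    have "((\<lambda>x. poly p (1 / x) * exp (- (1 / x))) has_real_derivative
        flat_exp (monom 1 2 * (p - pderiv p)) x) (at x)"
      using 1 by (auto intro!: derivative_eq_intros DERIV_chain'[OF _ poly_DERIV]
          simp: flat_exp_def poly_monom field_simps power2_eq_square)
    then show ?thesis
      by (rule has_field_derivative_transform_within_open[where S = "{0<..}"])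
        (use 1 in \<open>auto simp: flat_exp_def\<close>)
  next
    case 2
    have "((\<lambda>x. 0) has_real_derivative flat_exp (monom 1 2 * (p - pderiv p)) x) (at x)"
      using 2 by (simp add: flat_exp_def)
    then show ?thesis
      by (rule has_field_derivative_transform_within_open[where S = "{..<0}"])
        (use 2 in \<open>auto simp: flat_exp_def\<close>)
  next
    case 3
    \<comment> \<open>Division by the increment \<open>h\<close> multiplies the polynomial in
      \<open>1/h\<close> by its variable, which gives \<open>pCons 0 p\<close>; the exponential
      still wins.\<close>
    have "((\<lambda>y::real. poly (pCons 0 p) y * exp (- y)) \<longlongrightarrow> 0) at_top"
      by (rule poly_div_exp_tendsto_0)
    then have "((\<lambda>x::real. poly (pCons 0 p) (inverse x) * exp (- inverse x)) \<longlongrightarrow> 0) (at_right 0)"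
      by (rule filterlim_compose[OF _ filterlim_inverse_at_top_right])
    then have "((\<lambda>h. flat_exp p h / h) \<longlongrightarrow> 0) (at_right 0)"
      by (rule Lim_transform_eventually)
        (auto simp: eventually_at_right_field flat_exp_def field_simps intro!: exI[of _ 1])
    moreover have "((\<lambda>h. flat_exp p h / h) \<longlongrightarrow> 0) (at_left 0)"
      by (rule Lim_transform_eventually[OF tendsto_const])
        (auto simp: eventually_at_left_field flat_exp_def intro!: exI[of _ "-1"])
    ultimately have "((\<lambda>h. flat_exp p h / h) \<longlongrightarrow> 0) (at 0)"
      by (simp add: filterlim_split_at)
    then show ?thesis using 3 by (simp add: DERIV_def flat_exp_def)
  qed
qed

lemma smooth_flat_exp: "smooth (flat_exp p)"
proof (rule smooth_coinduct[of "\<lambda>f. \<exists>p. f = flat_exp p"])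
  fix f :: "real \<Rightarrow> real" assume "\<exists>p. f = flat_exp p"
  then obtain p where f: "f = flat_exp p" by blast
  have d: "(f has_derivative (\<lambda>v. flat_exp (monom 1 2 * (p - pderiv p)) x * v)) (at x)" for x
    using flat_exp_has_derivative[of p x] by (simp add: f has_field_derivative_def)
  have "(\<lambda>x. fderiv f x 1) = flat_exp (monom 1 2 * (p - pderiv p))"
    by (rule ext, subst frechet_derivative_at[OF d, symmetric]) simp
  then show "(\<forall>x. f differentiable at x) \<and> (\<forall>b\<in>Basis. \<exists>p. (\<lambda>x. fderiv f x b) = flat_exp p)"
    using d by (auto intro: differentiableI)
qed auto

text \<open>The factor \<open>exp 1\<close> normalises the value at the origin to 1; the squared
  norm keeps the function smooth there.\<close>

definition cutoff :: "'a::euclidean_space \<Rightarrow> real" where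
  "cutoff u = flat_exp 1 (1 - u \<bullet> u) * exp 1"

lemma smooth_cutoff: "smooth (cutoff :: 'a::euclidean_space \<Rightarrow> real)"
  unfolding cutoff_def[abs_def]
  by (intro smooth_mult smooth_const smooth_compose[OF smooth_flat_exp] smooth_diff smooth_inner smooth_id)

lemma cutoff_0 [simp]: "cutoff 0 = 1"
  by (simp add: cutoff_def flat_exp_def exp_minus)

lemma cutoff_nonneg: "0 \<le> cutoff u"
  by (simp add: cutoff_def flat_exp_def)

lemma cutoff_le_1: "cutoff u \<le> 1"
proof (cases "u \<bullet> u < 1")
  case True
  then have "1 \<le> 1 / (1 - u \<bullet> u)" by (simp add: field_simps)
  then show ?thesis using True by (simp add: cutoff_def flat_exp_def exp_add[symmetric])
qed (simp add: cutoff_def flat_exp_def)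

lemma cutoff_pos: "norm u < 1 \<Longrightarrow> 0 < cutoff u"
  by (simp add: cutoff_def flat_exp_def power2_norm_eq_inner[symmetric] abs_square_less_1)

lemma cutoff_eq_0: "1 \<le> norm u \<Longrightarrow> cutoff u = 0"
  by (simp add: cutoff_def flat_exp_def power2_norm_eq_inner[symmetric] not_less one_le_power)

lemma test_fun_iff:
  "test_fun \<phi> \<longleftrightarrow> smooth \<phi> \<and> (\<exists>K. compact K \<and> (\<forall>x. x \<notin> K \<longrightarrow> \<phi> x = 0))"
proof
  assume "test_fun \<phi>" then show "smooth \<phi> \<and> (\<exists>K. compact K \<and> (\<forall>x. x \<notin> K \<longrightarrow> \<phi> x = 0))"
    unfolding test_fun_def using closure_subset[of "{w. \<phi> w \<noteq> 0}"]
    by (intro conjI exI[of _ "closure {w. \<phi> w \<noteq> 0}"]) blast+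
next
  assume R: "smooth \<phi> \<and> (\<exists>K. compact K \<and> (\<forall>x. x \<notin> K \<longrightarrow> \<phi> x = 0))"
  then obtain K where K: "compact K" "{w. \<phi> w \<noteq> 0} \<subseteq> K" by blast
  then have "compact (closure {w. \<phi> w \<noteq> 0})"
    using bounded_subset compact_closure compact_imp_bounded by blast
  with R show "test_fun \<phi>" by (simp add: test_fun_def)
qed

lemma test_fun_cutoff: "test_fun cutoff"
  unfolding test_fun_iff
  by (intro conjI smooth_cutoff exI[of _ "cball 0 1"]) (auto intro: cutoff_eq_0)

lemma test_fun_smooth: "test_fun \<phi> \<Longrightarrow> smooth \<phi>"
  by (simp add: test_fun_def)

lemma test_fun_bounded:
  assumes "test_fun \<phi>" obtains C where "C > 0" "\<And>x. \<bar>\<phi> x\<bar> \<le> C"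
proof -
  obtain K where K: "compact K" "\<And>x. x \<notin> K \<Longrightarrow> \<phi> x = 0" using assms test_fun_iff by metis
  have "compact (\<phi> ` K)"
    by (intro compact_continuous_image K smooth_imp_continuous_on test_fun_smooth assms)
  then obtain C where "C > 0" "\<And>x. x \<in> K \<Longrightarrow> \<bar>\<phi> x\<bar> \<le> C"
    using bounded_pos[of "\<phi> ` K"] compact_imp_bounded by auto
  then show ?thesis using that[of C] K(2) by (metis abs_zero less_imp_le)
qed

lemma test_fun_mult_smooth: "test_fun \<phi> \<Longrightarrow> smooth g \<Longrightarrow> test_fun (\<lambda>x. \<phi> x * g x)"
  unfolding test_fun_iff by (auto intro!: smooth_mult)

lemma test_fun_add: "test_fun \<phi> \<Longrightarrow> test_fun g \<Longrightarrow> test_fun (\<lambda>x. \<phi> x + g x)"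
  unfolding test_fun_iff by (auto intro!: smooth_add) (metis Un_iff add.right_neutral compact_Un)

lemma test_fun_uminus: "test_fun \<phi> \<Longrightarrow> test_fun (\<lambda>x. - \<phi> x)"
  using test_fun_mult_smooth[OF _ smooth_const, of \<phi> "-1"] by simp

lemma test_fun_diff: "test_fun \<phi> \<Longrightarrow> test_fun g \<Longrightarrow> test_fun (\<lambda>x. \<phi> x - g x)"
  using test_fun_add[OF _ test_fun_uminus, of \<phi> g] by simp

lemma test_fun_zero: "test_fun (\<lambda>x. 0)"
  unfolding test_fun_iff by (auto intro: exI[of _ "{}"])

lemma test_fun_sum: "(\<And>i. i \<in> I \<Longrightarrow> test_fun (F i)) \<Longrightarrow> test_fun (\<lambda>x. \<Sum>i\<in>I. F i x)"
  by (induction I rule: infinite_finite_induct) (auto intro: test_fun_zero test_fun_add)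

lemma frechet_derivative_zero_outside:
  assumes "compact K" "\<And>x. x \<notin> K \<Longrightarrow> f x = 0" "x \<notin> K"
  shows "fderiv f x v = 0"
proof -
  have "((\<lambda>x. 0) has_derivative (\<lambda>v. 0)) (at x)" by simp
  then have "(f has_derivative (\<lambda>v. 0)) (at x)"
    by (rule has_derivative_transform_within_open[where s = "- K"])
      (use assms in \<open>auto intro: compact_imp_closed\<close>)
  from frechet_derivative_at[OF this] show ?thesis by metis
qed

lemma test_fun_vf_apply:
  assumes "test_fun \<phi>" "smooth V" shows "test_fun (vf_apply V \<phi>)"
proof -
  obtain K where K: "compact K" "\<And>x. x \<notin> K \<Longrightarrow> \<phi> x = 0" using assms test_fun_iff by metis
  have "vf_apply V \<phi> x = 0" if "x \<notin> K" for x
    unfolding vf_apply_def by (rule frechet_derivative_zero_outside[OF K that])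
  then show ?thesis unfolding test_fun_iff
    using K(1) smooth_vf_apply[OF assms(2) test_fun_smooth[OF assms(1)]] by blast
qed

section \<open>Local integrability and duality with test functions\<close>

lemma smooth_real_polynomial_function: "real_polynomial_function p \<Longrightarrow> smooth p"
  by (induction rule: real_polynomial_function.induct) (auto intro: smooth_linear)

text \<open>The restrictions to balls are measurable and converge pointwise.\<close>

lemma loc_integrable_borel_measurable:
  fixes g :: "'a::euclidean_space \<Rightarrow> real"
  assumes "loc_integrable g" shows "g \<in> borel_measurable borel"
proof -
  have "(\<lambda>x. indicat_real (cball 0 (real n)) x *\<^sub>R g x) \<in> borel_measurable borel" for n
  proof -
    have "integrable lborel (\<lambda>x. indicat_real (cball 0 (real n)) x *\<^sub>R g x)"
      using assms compact_cball unfolding loc_integrable_def set_integrable_def by blast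
    from borel_measurable_integrable[OF this] show ?thesis by simp
  qed
  moreover have "(\<lambda>n. indicat_real (cball 0 (real n)) x *\<^sub>R g x) \<longlonglongrightarrow> g x" for x
  proof (rule tendsto_eventually)
    obtain N where N: "norm x \<le> real N" using real_arch_simple by blast
    show "\<forall>\<^sub>F n in sequentially. indicat_real (cball 0 (real n)) x *\<^sub>R g x = g x"
    proof (rule eventually_sequentiallyI)
      fix n assume "N \<le> n"
      then have "real N \<le> real n" by (rule of_nat_mono)
      with N have "x \<in> cball 0 (real n)" by simp
      then show "indicat_real (cball 0 (real n)) x *\<^sub>R g x = g x" by (simp only: indicator_simps scaleR_one)
    qed
  qed
  ultimately show ?thesis
    using borel_measurable_LIMSEQ_real[of borel "\<lambda>n x. indicat_real (cball 0 (real n)) x *\<^sub>R g x" g] by blast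
qed

lemma loc_integrable_mult_bounded:
  fixes g :: "'a::euclidean_space \<Rightarrow> real"
  assumes g: "loc_integrable g" and K: "compact K" and f: "f \<in> borel_measurable borel"
    and "\<And>x. \<bar>f x\<bar> \<le> C * indicator K x"
  shows "integrable lborel (\<lambda>x. f x * g x)"
proof (rule Bochner_Integration.integrable_bound)
  show "integrable lborel (\<lambda>x. C * (indicator K x *\<^sub>R g x))"
    using g K unfolding loc_integrable_def set_integrable_def by (intro integrable_mult_right) blast
  show "(\<lambda>x. f x * g x) \<in> borel_measurable lborel"
    using f loc_integrable_borel_measurable[OF g] by simp
  have "\<bar>f x * g x\<bar> \<le> \<bar>C * (indicator K x * g x)\<bar>" for x
  proof -
    have "\<bar>f x\<bar> * \<bar>g x\<bar> \<le> \<bar>C * indicator K x\<bar> * \<bar>g x\<bar>"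
      by (rule mult_right_mono[OF order_trans[OF assms(4) abs_ge_self] abs_ge_zero])
    then show ?thesis by (simp add: abs_mult mult.assoc)
  qed
  then show "AE x in lborel. norm (f x * g x) \<le> norm (C * (indicator K x *\<^sub>R g x))" by simp
qed

lemma test_fun_mult_integrable:
  assumes "test_fun f" "loc_integrable g" shows "integrable lborel (\<lambda>x. f x * g x)"
proof -
  obtain K where K: "compact K" "\<And>x. x \<notin> K \<Longrightarrow> f x = 0" using assms test_fun_iff by metis
  obtain C where C: "C > 0" "\<And>x. \<bar>f x\<bar> \<le> C" using test_fun_bounded[OF assms(1)] by blast
  show ?thesis
    by (rule loc_integrable_mult_bounded[OF assms(2) K(1), of _ C])
      (use K C in \<open>auto simp: indicator_def intro: smooth_borel_measurable test_fun_smooth assms\<close>)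
qed

text \<open>Stone-Weierstrass supplies test functions approximating \<open>\<theta> * sgn g\<close> almost everywhere.\<close>

lemma integral_abs_le_by_duality:
  fixes g \<theta> :: "'a::euclidean_space \<Rightarrow> real"
  assumes g: "loc_integrable g" and \<theta>: "test_fun \<theta>" "\<And>x. 0 \<le> \<theta> x"
    and bound: "\<And>f. test_fun f \<Longrightarrow> (\<And>x. \<bar>f x\<bar> \<le> \<theta> x) \<Longrightarrow> (\<integral>x. f x * g x \<partial>lborel) \<le> C"
  shows "(\<integral>x. \<theta> x * \<bar>g x\<bar> \<partial>lborel) \<le> C"
proof -
  obtain K where K: "compact K" "\<And>x. x \<notin> K \<Longrightarrow> \<theta> x = 0" using \<theta> test_fun_iff by metis
  have gm [measurable]: "g \<in> borel_measurable borel" using g by (rule loc_integrable_borel_measurable)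
  have "(\<lambda>x. sgn (g x)) \<in> borel_measurable lebesgue"
    by (rule measurable_completion) simp
  then have "(\<lambda>x. sgn (g x)) measurable_on UNIV"
    by (rule lebesgue_measurable_imp_measurable_on_real) simp
  then obtain N h where N: "negligible N" and h: "\<And>n. continuous_on UNIV (h n)"
    and lim: "\<And>x. x \<notin> N \<Longrightarrow> (\<lambda>n. h n x) \<longlonglongrightarrow> sgn (g x)"
    unfolding measurable_on_def by auto
  \<comment> \<open>Clamping to [-1, 1] preserves the limit, because \<open>sgn\<close> has its
    values there, and it bounds the approximating polynomials.\<close>
  define k where "k n x = max (-1) (min 1 (h n x))" for n x
  have k: "continuous_on K (k n)" for n
    unfolding k_def by (intro continuous_intros continuous_on_subset[OF h[of n]]) simp_all
  have k1: "\<bar>k n x\<bar> \<le> 1" for n x by (auto simp: k_def)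
  have klim: "(\<lambda>n. k n x) \<longlonglongrightarrow> sgn (g x)" if "x \<notin> N" for x
  proof -
    have "(\<lambda>n. max (-1) (min 1 (h n x))) \<longlonglongrightarrow> max (-1) (min 1 (sgn (g x)))"
      by (intro tendsto_intros lim that)
    moreover have "max (-1) (min 1 (sgn (g x))) = sgn (g x)" by (simp add: sgn_if)
    ultimately show ?thesis by (simp only: k_def)
  qed
  have "\<exists>q. real_polynomial_function q \<and> (\<forall>x\<in>K. \<bar>k n x - q x\<bar> < 1 / (real n + 1))" for n
    by (rule Stone_Weierstrass_real_polynomial_function[OF K(1) k[of n], of "1 / (real n + 1)"]) auto
  then obtain q where q: "\<And>n. real_polynomial_function (q n)"
    and qk: "\<And>n x. x \<in> K \<Longrightarrow> \<bar>k n x - q n x\<bar> < 1 / (real n + 1)" by metis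
  \<comment> \<open>On \<open>K\<close> the polynomial is at most
    \<open>1 + 1/(n+1) = (n+2)/(n+1)\<close> in absolute value. The factor is the reciprocal of this
    bound: it yields \<open>|f n x| \<le> \<theta> x\<close> exactly and tends to 1.\<close>
  define f where "f n x = \<theta> x * (q n x * ((real n + 1) / (real n + 2)))" for n x
  have f_test: "test_fun (f n)" for n
    unfolding f_def by (intro test_fun_mult_smooth \<theta> smooth_mult smooth_const smooth_real_polynomial_function q)
  have f_le: "\<bar>f n x\<bar> \<le> \<theta> x" for n x
  proof (cases "x \<in> K")
    case True
    have "\<bar>q n x\<bar> \<le> 1 + 1 / (real n + 1)" using qk[OF True, of n] k1[of n x] by linarith
    also have "\<dots> = (real n + 2) / (real n + 1)" by (simp add: field_simps)
    finally have "\<bar>q n x\<bar> * ((real n + 1) / (real n + 2)) \<le> 1" by (simp add: field_simps)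
    then have "\<theta> x * (\<bar>q n x\<bar> * ((real n + 1) / (real n + 2))) \<le> \<theta> x * 1"
      by (rule mult_left_mono) (rule \<theta>)
    then show ?thesis using \<theta>(2)[of x] by (simp add: f_def abs_mult)
  qed (simp add: f_def K)
  have int: "integrable lborel (\<lambda>x. \<theta> x * \<bar>g x\<bar>)"
    using integrable_abs[OF test_fun_mult_integrable[OF \<theta>(1) g]] \<theta>(2) by (simp add: abs_mult)
  have "(\<lambda>n. \<integral>x. f n x * g x \<partial>lborel) \<longlonglongrightarrow> (\<integral>x. \<theta> x * \<bar>g x\<bar> \<partial>lborel)"
  proof (rule integral_dominated_convergence[where w = "\<lambda>x. \<theta> x * \<bar>g x\<bar>"])
    show "(\<lambda>x. \<theta> x * \<bar>g x\<bar>) \<in> borel_measurable lborel" using int by (rule borel_measurable_integrable)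
    show "(\<lambda>x. f n x * g x) \<in> borel_measurable lborel" for n
      using test_fun_mult_integrable[OF f_test g] by (rule borel_measurable_integrable)
    show "integrable lborel (\<lambda>x. \<theta> x * \<bar>g x\<bar>)" by (rule int)
    show "AE x in lborel. norm (f n x * g x) \<le> \<theta> x * \<bar>g x\<bar>" for n
      using f_le by (auto simp: abs_mult intro!: mult_right_mono)
    have "(\<lambda>n. f n x * g x) \<longlonglongrightarrow> \<theta> x * \<bar>g x\<bar>" if x: "x \<notin> N" for x
    proof (cases "x \<in> K")
      case True
      have "(\<lambda>n. 1 / (real n + 1)) \<longlonglongrightarrow> 0"
        using lim_inverse_n' LIMSEQ_inverse_real_of_nat by (simp add: inverse_eq_divide add.commute)
      then have "(\<lambda>n. k n x - q n x) \<longlonglongrightarrow> 0"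
        by (rule Lim_null_comparison[rotated]) (use qk[OF True] in \<open>auto intro!: always_eventually less_imp_le\<close>)
      from tendsto_diff[OF klim[OF x] this] have "(\<lambda>n. q n x) \<longlonglongrightarrow> sgn (g x)" by simp
      moreover have "(\<lambda>n. (real n + 1) / (real n + 2)) \<longlonglongrightarrow> 1"
      proof -
        have "(\<lambda>n. 1 - inverse (real (Suc (Suc n)))) \<longlonglongrightarrow> 1 - 0"
          by (intro tendsto_diff tendsto_const LIMSEQ_Suc[OF LIMSEQ_inverse_real_of_nat])
        moreover have "1 - inverse (real (Suc (Suc n))) = (real n + 1) / (real n + 2)" for n
          by (simp add: field_simps)
        ultimately show ?thesis by simp
      qed
      ultimately have "(\<lambda>n. \<theta> x * (q n x * ((real n + 1) / (real n + 2))) * g x) \<longlonglongrightarrow> \<theta> x * (sgn (g x) * 1) * g x"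
        by (intro tendsto_intros)
      then show ?thesis by (simp add: f_def abs_sgn mult_ac)
    qed (simp add: f_def K)
    moreover have "AE x in lborel. x \<notin> N"
    proof -
      have "N \<in> null_sets lebesgue" using N by (simp add: negligible_iff_null_sets)
      then have "AE x in lebesgue. x \<notin> N" by (rule AE_not_in)
      then show ?thesis by (simp add: AE_completion_iff)
    qed
    ultimately show "AE x in lborel. (\<lambda>n. f n x * g x) \<longlonglongrightarrow> \<theta> x * \<bar>g x\<bar>" by (auto elim: eventually_mono)
  qed
  then show ?thesis
    by (rule LIMSEQ_le_const2) (use bound[OF f_test f_le] in auto)
qed

subsection \<open>Volume preserving maps of Euclidean spaces\<close>

text \<open>The change of variables theorem of the library is stated for \<open>real^'m\<close> with a well-ordered
  index type; this type makes it applicable to every Euclidean space.\<close>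

typedef (overloaded) ('a::euclidean_space) bidx = "Basis :: 'a set"
  using nonempty_Basis by blast

lemma range_Rep_bidx: "range (Rep_bidx :: 'a::euclidean_space bidx \<Rightarrow> 'a) = Basis"
  using type_definition.Rep_range[OF type_definition_bidx] .

lemma inj_Rep_bidx: "inj (Rep_bidx :: 'a::euclidean_space bidx \<Rightarrow> 'a)"
  by (simp add: inj_def Rep_bidx_inject)

instance bidx :: (euclidean_space) finite
proof
  show "finite (UNIV :: 'a bidx set)"
    by (rule finite_imageD[OF _ inj_Rep_bidx]) (simp add: range_Rep_bidx)
qed

instantiation bidx :: (euclidean_space) wellorder
begin

definition bidx_pos :: "'a bidx \<Rightarrow> nat" where
  "bidx_pos = (SOME f. inj f)"

definition less_eq_bidx :: "'a bidx \<Rightarrow> 'a bidx \<Rightarrow> bool" where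
  "less_eq_bidx i j \<longleftrightarrow> bidx_pos i \<le> bidx_pos j"

definition less_bidx :: "'a bidx \<Rightarrow> 'a bidx \<Rightarrow> bool" where
  "less_bidx i j \<longleftrightarrow> bidx_pos i < bidx_pos j"

instance
proof
  have inj: "inj (bidx_pos :: 'a bidx \<Rightarrow> nat)"
    unfolding bidx_pos_def using finite_imp_inj_to_nat_seg[OF finite_class.finite_UNIV]
    by (metis someI_ex)
  fix i j k :: "'a bidx"
  show "i < j \<longleftrightarrow> i \<le> j \<and> \<not> j \<le> i" "i \<le> i" "i \<le> j \<or> j \<le> i"
    by (auto simp: less_eq_bidx_def less_bidx_def)
  show "i \<le> j \<Longrightarrow> j \<le> k \<Longrightarrow> i \<le> k" by (simp add: less_eq_bidx_def)
  show "i \<le> j \<Longrightarrow> j \<le> i \<Longrightarrow> i = j" using inj by (simp add: less_eq_bidx_def inj_def)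
  fix P assume P: "\<And>i::'a bidx. (\<And>j. j < i \<Longrightarrow> P j) \<Longrightarrow> P i"
  show "P k"
    by (induction k rule: measure_induct_rule[of bidx_pos]) (use P in \<open>auto simp: less_bidx_def\<close>)
qed

end

lemma sum_bidx: "(\<Sum>i\<in>UNIV. F (Rep_bidx i)) = (\<Sum>b\<in>(Basis::'a::euclidean_space set). F b)"
  using sum.reindex[OF inj_Rep_bidx, of F] by (simp add: range_Rep_bidx)

definition of_coords :: "real ^ ('a::euclidean_space) bidx \<Rightarrow> 'a" where
  "of_coords z = (\<Sum>i\<in>UNIV. z $ i *\<^sub>R Rep_bidx i)"

definition to_coords :: "'a::euclidean_space \<Rightarrow> real ^ 'a bidx" where
  "to_coords u = (\<chi> i. u \<bullet> Rep_bidx i)"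

lemma of_coords_to_coords [simp]: "of_coords (to_coords u) = u"
  by (simp add: of_coords_def to_coords_def sum_bidx[of "\<lambda>b. (u \<bullet> b) *\<^sub>R b"] euclidean_representation)

lemma Rep_bidx_inner: "Rep_bidx i \<bullet> Rep_bidx j = (if i = j then 1 else 0)"
  using inner_Basis[OF Rep_bidx Rep_bidx, of i j] by (simp add: Rep_bidx_inject)

lemma to_coords_of_coords [simp]: "to_coords (of_coords z) = z"
  by (simp add: of_coords_def to_coords_def vec_eq_iff inner_sum_left Rep_bidx_inner if_distrib cong: if_cong)

lemma linear_of_coords: "linear of_coords"
  by (auto intro!: linearI simp: of_coords_def sum.distrib scaleR_left_distrib scaleR_sum_right)

lemma linear_to_coords: "linear to_coords"
  by (auto intro!: linearI simp: to_coords_def vec_eq_iff inner_add_left)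

lemma of_coords_axis: "of_coords (axis i 1) = Rep_bidx i"
  by (simp add: of_coords_def axis_def if_distrib[of "\<lambda>c. c *\<^sub>R _"] cong: if_cong)

text \<open>A linear map matching the two bases pulls each box back to a box with the same side
  lengths.\<close>

lemma lborel_distr_basis_bij:
  fixes T :: "'a::euclidean_space \<Rightarrow> 'b::euclidean_space"
  assumes T: "linear T" "bij_betw T Basis Basis"
  shows "distr lborel borel T = lborel"
proof (rule lborel_eqI[symmetric])
  have Tm: "T \<in> borel_measurable borel"
    using T by (simp add: borel_measurable_continuous_onI linear_continuous_on linear_conv_bounded_linear)
  have TB: "T b \<in> Basis" if "b \<in> Basis" for b using T(2) that by (auto simp: bij_betw_def)
  have T_inner: "T x \<bullet> T b = x \<bullet> b" if b: "b \<in> Basis" for x b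
  proof -
    have "T c \<bullet> T b = (if c = b then 1 else 0)" if "c \<in> Basis" for c
      using inner_Basis[OF TB[OF that] TB[OF b]] that b T(2) by (auto simp: bij_betw_def inj_on_def)
    then have "T x \<bullet> T b = (\<Sum>c\<in>Basis. (x \<bullet> c) * (if c = b then 1 else 0))"
      unfolding linear_basis_expansion[OF T(1), of x] inner_sum_left by (intro sum.cong) auto
    then show ?thesis using b by (simp add: if_distrib[of "\<lambda>t. _ * t"] cong: if_cong)
  qed
  fix l u :: 'b assume lu: "\<And>b. b \<in> Basis \<Longrightarrow> l \<bullet> b \<le> u \<bullet> b"
  define S where "S v = (\<Sum>b\<in>Basis. (v \<bullet> T b) *\<^sub>R b)" for v
  have S: "S v \<bullet> b = v \<bullet> T b" if "b \<in> Basis" for v b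
    using that by (simp add: S_def)
  have ball: "(\<forall>b\<in>Basis. P b) \<longleftrightarrow> (\<forall>b\<in>Basis. P (T b))" for P
    by (subst bij_betw_imp_surj_on[OF T(2), symmetric]) simp
  have "T -` box l u = box (S l) (S u)"
    by (simp add: set_eq_iff mem_box ball S T_inner)
  then have "emeasure (distr lborel borel T) (box l u) = emeasure lborel (box (S l) (S u))"
    by (simp add: emeasure_distr Tm)
  also have "\<dots> = (\<Prod>b\<in>Basis. (S u - S l) \<bullet> b)"
    using lu TB by (intro emeasure_lborel_box) (simp add: S)
  also have "(\<Prod>b\<in>Basis. (S u - S l) \<bullet> b) = (\<Prod>b\<in>Basis. (u - l) \<bullet> T b)"
    by (intro prod.cong) (auto simp: S inner_diff_left)
  also have "\<dots> = (\<Prod>b\<in>Basis. (u - l) \<bullet> b)"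
    by (rule prod.reindex_bij_betw[OF T(2)])
  finally show "emeasure (distr lborel borel T) (box l u) = ennreal (\<Prod>b\<in>Basis. (u - l) \<bullet> b)" .
qed simp

lemma lborel_distr_of_coords: "distr lborel borel of_coords = lborel"
proof (rule lborel_distr_basis_bij[OF linear_of_coords])
  have "(of_coords :: real ^ 'a bidx \<Rightarrow> 'a) ` Basis = Basis"
    by (auto simp: Basis_vec_def of_coords_axis image_iff Rep_bidx range_Rep_bidx[symmetric])
  moreover have "inj (of_coords :: real ^ 'a bidx \<Rightarrow> 'a)"
    by (metis injI to_coords_of_coords)
  ultimately show "bij_betw (of_coords :: real ^ 'a bidx \<Rightarrow> 'a) Basis Basis"
    by (auto simp: bij_betw_def inj_on_def inj_def)
qed

definition eucl_det :: "('a::euclidean_space \<Rightarrow> 'a) \<Rightarrow> real" where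
  "eucl_det f = det (matrix (to_coords \<circ> f \<circ> of_coords))"

lemma eucl_det_compose:
  assumes "linear f" "linear g" shows "eucl_det (f \<circ> g) = eucl_det f * eucl_det g"
proof -
  have "linear (to_coords \<circ> f \<circ> of_coords)" "linear (to_coords \<circ> g \<circ> of_coords)"
    using assms linear_of_coords linear_to_coords by (auto intro!: linear_compose)
  note matrix_compose[OF this(2,1)]
  moreover have "(to_coords \<circ> f \<circ> of_coords) \<circ> (to_coords \<circ> g \<circ> of_coords) = to_coords \<circ> (f \<circ> g) \<circ> of_coords"
    by (simp add: fun_eq_iff)
  ultimately show ?thesis by (simp add: eucl_det_def det_mul)
qed

lemma eucl_det_id: "eucl_det id = 1"
proof -
  have "to_coords \<circ> id \<circ> of_coords = (id :: real ^ 'a bidx \<Rightarrow> _)" by (simp add: fun_eq_iff)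
  then show ?thesis by (simp add: eucl_det_def matrix_id_mat_1)
qed

lemma eucl_det_involution:
  assumes "linear f" "\<And>x. f (f x) = x" shows "\<bar>eucl_det f\<bar> = 1"
proof -
  have "f \<circ> f = id" using assms by (simp add: fun_eq_iff)
  then have "eucl_det f * eucl_det f = 1" using eucl_det_compose[OF assms(1,1)] eucl_det_id by metis
  then show ?thesis by (simp add: abs_square_eq_1[symmetric] power2_eq_square)
qed

text \<open>By multiplicativity the determinants of \<open>P\<close> and \<open>Q\<close> have
  product 1, so that of \<open>P\<close> can be cancelled. With dilations as \<open>P\<close> and
  \<open>Q\<close> this compares Jacobians at dilated points.\<close>

lemma eucl_det_conjugate:
  fixes f g P Q :: "'a::euclidean_space \<Rightarrow> 'a"
  assumes "linear f" "linear g" "linear P" "linear Q" "\<And>x. P (Q x) = x" "\<And>x. P (f x) = g (P x)"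
  shows "eucl_det f = eucl_det g"
proof -
  have "P \<circ> Q = id" "P \<circ> f = g \<circ> P" using assms by (auto simp: fun_eq_iff)
  have "eucl_det P * eucl_det Q = 1"
    unfolding eucl_det_compose[OF assms(3,4), symmetric] \<open>P \<circ> Q = id\<close> by (rule eucl_det_id)
  moreover have "eucl_det P * eucl_det f = eucl_det g * eucl_det P"
    unfolding eucl_det_compose[OF assms(3,1), symmetric] eucl_det_compose[OF assms(2,3), symmetric]
      \<open>P \<circ> f = g \<circ> P\<close> ..
  ultimately have "eucl_det P \<noteq> 0" "eucl_det P * eucl_det f = eucl_det P * eucl_det g" by auto
  then show ?thesis by simp
qed

text \<open>By the Leibniz formula the determinant is a polynomial in the matrix entries.\<close>

lemma tendsto_eucl_det:
  assumes "\<And>b c. b \<in> Basis \<Longrightarrow> c \<in> Basis \<Longrightarrow> ((\<lambda>x. f x b \<bullet> c) \<longlongrightarrow> g b \<bullet> c) F"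
  shows "((\<lambda>x. eucl_det (f x)) \<longlongrightarrow> eucl_det g) F"
  unfolding eucl_det_def det_def
  by (intro tendsto_sum tendsto_mult tendsto_const tendsto_prod)
    (simp add: matrix_def of_coords_axis to_coords_def Rep_bidx assms)

text \<open>Lebesgue measure is determined by boxes. In coordinates a box is the image under
  \<open>g\<close> of its preimage \<open>S\<close>, and with Jacobian 1 in absolute value both have
  the same volume.\<close>

proposition lborel_distr_volume_preserving:
  fixes f :: "'a::euclidean_space \<Rightarrow> 'a"
  assumes der: "\<And>x. (f has_derivative f' x) (at x)" and bij: "bij f"
    and det: "\<And>x. \<bar>eucl_det (f' x)\<bar> = 1"
  shows "distr lborel borel f = lborel"
proof -
  define g where "g = to_coords \<circ> f \<circ> of_coords"
  have bl: "bounded_linear (of_coords :: real ^ 'a bidx \<Rightarrow> 'a)" "bounded_linear (to_coords :: 'a \<Rightarrow> _)"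
    using linear_of_coords linear_to_coords by (simp_all add: linear_conv_bounded_linear)
  have gder: "(g has_derivative (to_coords \<circ> f' (of_coords z) \<circ> of_coords)) (at z)" for z
    unfolding g_def
    by (intro diff_chain_at bounded_linear_imp_has_derivative bl der)
  have gbij: "bij g"
  proof -
    have "bij (of_coords :: real ^ 'a bidx \<Rightarrow> 'a)" "bij (to_coords :: 'a \<Rightarrow> _)"
      by (rule o_bij[where g = to_coords], auto)(rule o_bij[where g = of_coords], auto)
    then show ?thesis unfolding g_def using bij by (intro bij_comp)
  qed
  have cont: "continuous_on UNIV h" if "\<And>x. (h has_derivative h' x) (at x)"
    for h :: "'c::euclidean_space \<Rightarrow> 'd::euclidean_space" and h'
    using that by (meson has_derivative_at_withinI has_derivative_continuous_on)
  have [measurable]: "g \<in> borel_measurable borel" "f \<in> borel_measurable borel"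
    "(of_coords :: real ^ 'a bidx \<Rightarrow> 'a) \<in> borel_measurable borel"
    by (intro borel_measurable_continuous_onI cont[OF gder] cont[OF der] linear_continuous_on bl)+
  have "lborel = distr lborel borel g"
  proof (rule lborel_eqI)
    fix l u :: "real ^ 'a bidx" assume lu: "\<And>b. b \<in> Basis \<Longrightarrow> l \<bullet> b \<le> u \<bullet> b"
    define S where "S = g -` box l u"
    have S: "S \<in> sets borel" unfolding S_def using measurable_sets_borel[of g] by auto
    have gS: "g ` S = box l u"
      unfolding S_def using gbij by (simp add: bij_is_surj surj_image_vimage_eq)
    \<comment> \<open>Read from left to right: the image is the box, so the left side holds
      trivially, and the right side then shows that \<open>S\<close> has finite measure, equal to
      that of the box.\<close>
    have "g ` S \<in> lmeasurable \<and> measure lebesgue (g ` S) = measure lebesgue (box l u) \<longleftrightarrow>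
      ((\<lambda>x. \<bar>det (matrix (to_coords \<circ> f' (of_coords x) \<circ> of_coords))\<bar>) has_integral measure lebesgue (box l u)) S"
      by (rule has_measure_differentiable_image)
        (use S gbij in \<open>auto intro: has_derivative_at_withinI[OF gder] simp: bij_is_inj inj_on_subset[OF bij_is_inj[OF gbij]]\<close>)
    moreover have "box l u \<in> lmeasurable" by simp
    ultimately have "((\<lambda>x. 1) has_integral measure lebesgue (box l u)) S"
      unfolding gS using det by (simp add: eucl_det_def)
    then have 1: "S \<in> lmeasurable" "((\<lambda>x. 1) has_integral measure lebesgue (box l u)) S"
      using lmeasurable_iff_integrable_on by (auto simp: integrable_on_def)
    then have "measure lebesgue S = measure lebesgue (box l u)"
      using lmeasure_integral integral_unique by metis
    then have "emeasure lebesgue S = emeasure lebesgue (box l u)"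
      using 1(1) by (simp add: emeasure_eq_measure2)
    then have "emeasure lborel S = emeasure lborel (box l u)"
      using S by simp
    then show "emeasure (distr lborel borel g) (box l u) = (\<Prod>b\<in>Basis. (u - l) \<bullet> b)"
      using lu by (simp add: emeasure_distr S_def emeasure_lborel_box)
  qed simp
  then have gl: "distr lborel borel g = lborel" by simp
  have "distr lborel borel f = distr (distr lborel borel of_coords) borel f"
    by (simp add: lborel_distr_of_coords)
  also have "\<dots> = distr lborel borel (f \<circ> of_coords)" by (subst distr_distr) auto
  also have "f \<circ> of_coords = of_coords \<circ> g" by (simp add: g_def fun_eq_iff)
  also have "distr lborel borel (of_coords \<circ> g) = distr (distr lborel borel g) borel of_coords"
    by (subst distr_distr) auto
  also have "\<dots> = lborel" by (simp add: gl lborel_distr_of_coords)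
  finally show ?thesis .
qed

subsection \<open>Differentiation under the integral sign\<close>

text \<open>Compact support in \<open>c\<close>, locally uniformly in the parameter
  \<open>b\<close>. Joint compact support would be too strong:
  \<open>f (p * q\<^sup>-\<^sup>1)\<close> need not vanish for large \<open>p\<close> and
  \<open>q\<close> whose quotient stays fixed.\<close>

definition locally_compact_support :: "('a::euclidean_space \<times> 'c::euclidean_space \<Rightarrow> real) \<Rightarrow> bool" where
  "locally_compact_support F \<longleftrightarrow>
     (\<forall>R. \<exists>K. compact K \<and> (\<forall>b c. norm b \<le> R \<longrightarrow> c \<notin> K \<longrightarrow> F (b, c) = 0))"

lemma frechet_derivative_fst:
  assumes "smooth F"
  shows "fderiv (\<lambda>b. F (b, c)) b v = fderiv F (b, c) (v, 0)"
  by (rule frechet_derivative_compose'[OF assms]) (auto intro!: derivative_eq_intros)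

lemma frechet_derivative_snd:
  assumes "smooth F"
  shows "fderiv (\<lambda>c. F (b, c)) c v = fderiv F (b, c) (0, v)"
  by (rule frechet_derivative_compose'[OF assms]) (auto intro!: derivative_eq_intros)

lemma frechet_derivative_fst_expansion:
  fixes F :: "'a::euclidean_space \<times> 'c::euclidean_space \<Rightarrow> real"
  assumes "smooth F"
  shows "fderiv F p (v, 0) = (\<Sum>i\<in>Basis. (v \<bullet> i) * fderiv F p (i, 0))"
proof -
  have "linear (\<lambda>v::'a. (v, 0::'c))" by (rule linearI) simp_all
  then have "linear (fderiv F p \<circ> (\<lambda>v. (v, 0)))"
    by (rule linear_compose) (rule linear_frechet_derivative[OF assms])
  from linear_basis_expansion[OF this, of v] show ?thesis by (simp add: o_def)
qed

lemma smooth_slice_fst: "smooth F \<Longrightarrow> smooth (\<lambda>b. F (b, c))"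
  and smooth_slice_snd: "smooth F \<Longrightarrow> smooth (\<lambda>c. F (b, c))"
  by (auto intro!: smooth_compose[of F])

lemma fderiv_fst_eq_0:
  assumes F: "smooth F" and zero: "\<And>b. norm b < R \<Longrightarrow> F (b, c) = 0" and b: "norm b < R"
  shows "fderiv F (b, c) (v, 0) = 0"
proof -
  have "((\<lambda>b. 0) has_derivative (\<lambda>v. 0)) (at b)" by simp
  then have "((\<lambda>b. F (b, c)) has_derivative (\<lambda>v. 0)) (at b)"
    by (rule has_derivative_transform_within_open[where s = "ball 0 R"]) (use b zero in auto)
  from frechet_derivative_at[OF this] show ?thesis
    unfolding frechet_derivative_fst[OF F, symmetric] by metis
qed

lemma locally_compact_support_partial:
  assumes F: "smooth F" "locally_compact_support F"
  shows "locally_compact_support (\<lambda>p. fderiv F p (V p, 0))"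
  unfolding locally_compact_support_def
proof
  fix R :: real
  \<comment> \<open>The radius exceeds \<open>R\<close> by 1, since the derivative at
    \<open>b\<close> vanishes only if \<open>F\<close> vanishes on a neighbourhood of
    \<open>b\<close>.\<close>
  obtain K where K: "compact K" "\<And>b c. norm b \<le> R + 1 \<Longrightarrow> c \<notin> K \<Longrightarrow> F (b, c) = 0"
    using F(2) unfolding locally_compact_support_def by blast
  have "fderiv F (b, c) (V (b, c), 0) = 0" if "norm b \<le> R" "c \<notin> K" for b c
    by (rule fderiv_fst_eq_0[OF F(1), of "R + 1"]) (use K that in auto)
  with K(1) show "\<exists>K. compact K \<and> (\<forall>b c. norm b \<le> R \<longrightarrow> c \<notin> K \<longrightarrow> fderiv F (b, c) (V (b, c), 0) = 0)"
    by blast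
qed

lemma locally_compact_support_test_fun:
  assumes "smooth F" "locally_compact_support F" shows "test_fun (\<lambda>c. F (b, c))"
  using assms(2) smooth_slice_snd[OF assms(1)] unfolding test_fun_iff locally_compact_support_def
  by (metis order_refl)

text \<open>The remainder of the first-order expansion of \<open>F\<close> in \<open>b\<close> is
  estimated uniformly for \<open>c\<close> in a compact set \<open>K\<close> and vanishes off
  \<open>K\<close>. This estimate is then integrated against \<open>|g|\<close> over
  \<open>K\<close>.\<close>

lemma param_integral_has_derivative:
  fixes F :: "'a::euclidean_space \<times> 'c::euclidean_space \<Rightarrow> real"
  assumes F: "smooth F" "locally_compact_support F" and g: "loc_integrable g"
  shows "((\<lambda>b. \<integral>c. F (b, c) * g c \<partial>lborel) has_derivative
    (\<lambda>v. \<Sum>i\<in>Basis. (v \<bullet> i) * (\<integral>c. fderiv F (b, c) (i, 0) * g c \<partial>lborel))) (at b)"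
proof -
  define D where "D i p = fderiv F p (i, 0)" for i p
  have D: "smooth (D i)" "locally_compact_support (D i)" for i
    using F locally_compact_support_partial[OF F] unfolding D_def[abs_def] by auto
  have int: "integrable lborel (\<lambda>c. F (b, c) * g c)" "integrable lborel (\<lambda>c. D i (b, c) * g c)" for b i
    by (intro test_fun_mult_integrable locally_compact_support_test_fun F D g)+
  obtain K where K: "compact K" and KF: "\<And>x c. norm x \<le> norm b + 1 \<Longrightarrow> c \<notin> K \<Longrightarrow> F (x, c) = 0"
    using F(2) unfolding locally_compact_support_def by blast
  have KD: "D i (b, c) = 0" if "c \<notin> K" for i c
    unfolding D_def by (rule fderiv_fst_eq_0[OF F(1), of "norm b + 1"]) (use KF that in auto)
  define A where "A = (\<integral>c. indicator K c * \<bar>g c\<bar> \<partial>lborel)"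
  have Aint: "integrable lborel (\<lambda>c. indicator K c * \<bar>g c\<bar>)"
  proof -
    have "integrable lborel (\<lambda>c. \<bar>indicator K c *\<^sub>R g c\<bar>)"
      using g K unfolding loc_integrable_def set_integrable_def by (intro integrable_abs) blast
    then show ?thesis by (simp add: abs_mult)
  qed
  have A: "A \<ge> 0" unfolding A_def by (intro Bochner_Integration.integral_nonneg) auto
  define n where "n = real DIM('a)"
  have n: "n > 0" by (simp add: n_def)
  show ?thesis unfolding has_derivative_at_alt D_def[symmetric]
  proof (intro conjI allI impI)
    show "bounded_linear (\<lambda>v. \<Sum>i\<in>Basis. (v \<bullet> i) * (\<integral>c. D i (b, c) * g c \<partial>lborel))"
      by (intro bounded_linear_sum bounded_linear_mult_left[THEN bounded_linear_compose] bounded_linear_inner_left)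
    fix e :: real assume e: "e > 0"
    \<comment> \<open>Each of the \<open>n\<close> coordinate directions contributes at most
      \<open>e'\<close>, and integration over \<open>K\<close> multiplies by \<open>A\<close>;
      \<open>A + 1\<close> avoids a zero denominator.\<close>
    define e' where "e' = e / (n * (A + 1))"
    have e': "e' > 0" using e n A by (simp add: e'_def)
    have "\<exists>d>0. \<forall>x c. norm (x - b) < d \<longrightarrow> c \<in> K \<longrightarrow> \<bar>D i (x, c) - D i (b, c)\<bar> < e'" for i
    proof -
      have "uniformly_continuous_on (cball b 1 \<times> K) (D i)"
        by (intro compact_uniformly_continuous smooth_imp_continuous_on D compact_Times compact_cball K)
      then obtain d where d: "d > 0" "\<And>p q. p \<in> cball b 1 \<times> K \<Longrightarrow> q \<in> cball b 1 \<times> K \<Longrightarrow> dist q p < d \<Longrightarrow>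
          dist (D i q) (D i p) < e'"
        using e' unfolding uniformly_continuous_on_def by meson
      have "\<bar>D i (x, c) - D i (b, c)\<bar> < e'" if "norm (x - b) < min d 1" "c \<in> K" for x c
        using d(2)[of "(b, c)" "(x, c)"] that by (auto simp: dist_Pair_Pair dist_norm norm_minus_commute)
      then show ?thesis using d(1) by (intro exI[of _ "min d 1"]) auto
    qed
    then obtain \<delta> where \<delta>: "\<And>i. \<delta> i > 0"
      "\<And>i x c. norm (x - b) < \<delta> i \<Longrightarrow> c \<in> K \<Longrightarrow> \<bar>D i (x, c) - D i (b, c)\<bar> < e'" by metis
    define d where "d = Min (insert 1 (\<delta> ` Basis))"
    have d: "d > 0" using \<delta>(1) by (simp add: d_def)
    have d1: "d \<le> 1" and di: "\<And>i. i \<in> Basis \<Longrightarrow> d \<le> \<delta> i"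
      unfolding d_def by (rule Min_le; simp)+
    have est: "\<bar>F (x, c) - F (b, c) - (\<Sum>i\<in>Basis. ((x - b) \<bullet> i) * D i (b, c))\<bar> \<le> n * e' * norm (x - b)"
      if x: "norm (x - b) < d" and c: "c \<in> K" for x c
    proof -
      \<comment> \<open>\<open>F\<close> minus its linear part at \<open>b\<close>: its partial
        derivatives are differences of those of \<open>F\<close> and stay below \<open>e'\<close>,
        so the mean value inequality bounds the remainder.\<close>
      define \<psi> where "\<psi> y = F (y, c) - (\<Sum>i\<in>Basis. (y \<bullet> i) * D i (b, c))" for y
      have der: "(\<psi> has_derivative (\<lambda>v. \<Sum>i\<in>Basis. (v \<bullet> i) * (D i (y, c) - D i (b, c)))) (at y within ball b d)" for y
      proof -
        have "((\<lambda>y. F (y, c)) has_derivative fderiv (\<lambda>y. F (y, c)) y) (at y)"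
          by (rule smooth_has_derivative[OF smooth_slice_fst[OF F(1)]])
        moreover have "fderiv (\<lambda>y. F (y, c)) y = (\<lambda>v. \<Sum>i\<in>Basis. (v \<bullet> i) * D i (y, c))"
          by (rule ext) (simp only: D_def frechet_derivative_fst[OF F(1)] frechet_derivative_fst_expansion[OF F(1), symmetric])
        ultimately have "((\<lambda>y. F (y, c)) has_derivative (\<lambda>v. \<Sum>i\<in>Basis. (v \<bullet> i) * D i (y, c))) (at y)" by simp
        moreover have "((\<lambda>y. \<Sum>i\<in>Basis. (y \<bullet> i) * D i (b, c)) has_derivative
            (\<lambda>v. \<Sum>i\<in>Basis. (v \<bullet> i) * D i (b, c))) (at y)"
          by (auto intro!: derivative_eq_intros)
        ultimately have "(\<psi> has_derivative (\<lambda>v. (\<Sum>i\<in>Basis. (v \<bullet> i) * D i (y, c)) - (\<Sum>i\<in>Basis. (v \<bullet> i) * D i (b, c)))) (at y)"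
          unfolding \<psi>_def[abs_def] by (rule has_derivative_diff)
        then show ?thesis
          by (rule has_derivative_at_withinI[THEN back_subst[where P = "\<lambda>h. (\<psi> has_derivative h) (at y within ball b d)"]])
            (simp only: right_diff_distrib sum_subtractf)
      qed
      have "norm (\<psi> x - \<psi> b) \<le> n * e' * norm (x - b)"
      proof (rule differentiable_bound[OF convex_ball der])
        show "onorm (\<lambda>v. \<Sum>i\<in>Basis. (v \<bullet> i) * (D i (y, c) - D i (b, c))) \<le> n * e'" if y: "y \<in> ball b d" for y
        proof (rule onorm_bound)
          show "0 \<le> n * e'" using n e' by simp
          fix v
          have "norm (\<Sum>i\<in>Basis. (v \<bullet> i) * (D i (y, c) - D i (b, c))) \<le> (\<Sum>i\<in>(Basis::'a set). norm v * e')"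
          proof (rule sum_norm_le)
            fix i :: 'a assume i: "i \<in> Basis"
            have "\<bar>D i (y, c) - D i (b, c)\<bar> < e'"
              using y di[OF i] by (intro \<delta>(2) c) (auto simp: dist_norm norm_minus_commute)
            then show "norm ((v \<bullet> i) * (D i (y, c) - D i (b, c))) \<le> norm v * e'"
              using Basis_le_norm[OF i, of v] e' unfolding real_norm_def abs_mult
              by (intro mult_mono) auto
          qed
          then show "norm (\<Sum>i\<in>Basis. (v \<bullet> i) * (D i (y, c) - D i (b, c))) \<le> n * e' * norm v"
            by (simp add: n_def mult_ac)
        qed
      qed (use x d in \<open>auto simp: dist_norm norm_minus_commute\<close>)
      moreover have "\<psi> x - \<psi> b = F (x, c) - F (b, c) - (\<Sum>i\<in>Basis. ((x - b) \<bullet> i) * D i (b, c))"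
        by (simp add: \<psi>_def inner_diff_left sum_subtractf algebra_simps)
      ultimately show ?thesis by simp
    qed
    have "norm ((\<integral>c. F (x, c) * g c \<partial>lborel) - (\<integral>c. F (b, c) * g c \<partial>lborel) -
        (\<Sum>i\<in>Basis. ((x - b) \<bullet> i) * (\<integral>c. D i (b, c) * g c \<partial>lborel))) \<le> e * norm (x - b)"
      if x: "norm (x - b) < d" for x
    proof -
      let ?E = "\<lambda>c. F (x, c) - F (b, c) - (\<Sum>i\<in>Basis. ((x - b) \<bullet> i) * D i (b, c))"
      have nx: "norm x \<le> norm b + 1" using x d1 norm_triangle_ineq2[of x b] by linarith
      have Eg: "?E c * g c = F (x, c) * g c - F (b, c) * g c - (\<Sum>i\<in>Basis. ((x - b) \<bullet> i) * (D i (b, c) * g c))" for c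
        by (simp add: algebra_simps sum_distrib_left)
      have E_int: "(\<integral>c. ?E c * g c \<partial>lborel) = (\<integral>c. F (x, c) * g c \<partial>lborel) - (\<integral>c. F (b, c) * g c \<partial>lborel) -
        (\<Sum>i\<in>Basis. ((x - b) \<bullet> i) * (\<integral>c. D i (b, c) * g c \<partial>lborel))"
        unfolding Eg using int by (simp add: Bochner_Integration.integral_diff Bochner_Integration.integral_sum)
      have Ei: "integrable lborel (\<lambda>c. ?E c * g c)"
        unfolding Eg using int by simp
      have "norm (\<integral>c. ?E c * g c \<partial>lborel) \<le> (\<integral>c. n * e' * norm (x - b) * (indicator K c * \<bar>g c\<bar>) \<partial>lborel)"
      proof (rule Bochner_Integration.integral_norm_bound_integral[OF Ei])
        show "integrable lborel (\<lambda>c. n * e' * norm (x - b) * (indicator K c * \<bar>g c\<bar>))"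
          using Aint by (rule integrable_mult_right)
        fix c
        show "norm (?E c * g c) \<le> n * e' * norm (x - b) * (indicator K c * \<bar>g c\<bar>)"
        proof (cases "c \<in> K")
          case True
          then show ?thesis using mult_right_mono[OF est[OF x True] abs_ge_zero[of "g c"]]
            by (simp add: abs_mult)
        next
          case False
          then have "?E c = 0" using KF[OF nx] KF[of b] KD by simp
          then show ?thesis using False by (simp only: mult_zero_left norm_zero) simp
        qed
      qed
      also have "(\<integral>c. n * e' * norm (x - b) * (indicator K c * \<bar>g c\<bar>) \<partial>lborel) = n * e' * norm (x - b) * A"
        unfolding A_def by (rule Bochner_Integration.integral_mult_right_zero)
      also have "\<dots> \<le> e * norm (x - b)"
      proof -
        have "n * e' * A \<le> n * e' * (A + 1)" using n e' by (intro mult_left_mono) auto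
        also have "\<dots> = e" using n A by (simp add: e'_def)
        finally have "n * e' * A \<le> e" .
        then have "n * e' * A * norm (x - b) \<le> e * norm (x - b)" by (rule mult_right_mono) simp
        then show ?thesis by (simp only: mult_ac)
      qed
      finally show ?thesis unfolding E_int .
    qed
    then show "\<exists>d>0. \<forall>y. norm (y - b) < d \<longrightarrow>
        norm ((\<integral>c. F (y, c) * g c \<partial>lborel) - (\<integral>c. F (b, c) * g c \<partial>lborel) -
        (\<Sum>i\<in>Basis. ((y - b) \<bullet> i) * (\<integral>c. D i (b, c) * g c \<partial>lborel))) \<le> e * norm (y - b)"
      using d by blast
  qed
qed

lemma frechet_derivative_param_integral:
  assumes F: "smooth F" "locally_compact_support F" and g: "loc_integrable g"
  shows "fderiv (\<lambda>b. \<integral>c. F (b, c) * g c \<partial>lborel) b v =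
    (\<integral>c. fderiv F (b, c) (v, 0) * g c \<partial>lborel)"
proof -
  have int: "integrable lborel (\<lambda>c. fderiv F (b, c) (i, 0) * g c)" for i
    by (rule test_fun_mult_integrable[OF locally_compact_support_test_fun g])
      (use F locally_compact_support_partial[OF F] in auto)
  have eq: "fderiv F (b, c) (v, 0) =
      (\<Sum>i\<in>Basis. (v \<bullet> i) * fderiv F (b, c) (i, 0))" for c
    by (rule frechet_derivative_fst_expansion[OF F(1)])
  have "(\<integral>c. fderiv F (b, c) (v, 0) * g c \<partial>lborel) =
      (\<integral>c. (\<Sum>i\<in>Basis. (v \<bullet> i) * (fderiv F (b, c) (i, 0) * g c)) \<partial>lborel)"
    by (subst eq) (simp add: sum_distrib_right mult.assoc)
  also have "\<dots> = (\<Sum>i\<in>Basis. (v \<bullet> i) * (\<integral>c. fderiv F (b, c) (i, 0) * g c \<partial>lborel))"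
    using int by (simp add: Bochner_Integration.integral_sum)
  finally show ?thesis
    using fun_cong[OF frechet_derivative_at[OF param_integral_has_derivative[OF assms, of b]], of v] by simp
qed

text \<open>Each partial derivative is an integral of the same kind with the same \<open>g\<close>,
  so coinduction applies.\<close>

lemma smooth_param_integral:
  assumes F: "smooth F" "locally_compact_support F" and g: "loc_integrable g"
  shows "smooth (\<lambda>b. \<integral>c. F (b, c) * g c \<partial>lborel)"
proof (rule smooth_coinduct[of "\<lambda>W. \<exists>F. smooth F \<and> locally_compact_support F \<and> W = (\<lambda>b. \<integral>c. F (b, c) * g c \<partial>lborel)"])
  fix W :: "'a \<Rightarrow> real" assume "\<exists>F. smooth F \<and> locally_compact_support F \<and> W = (\<lambda>b. \<integral>c. F (b, c) * g c \<partial>lborel)"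
  then obtain F where F: "smooth F" "locally_compact_support F" and W: "W = (\<lambda>b. \<integral>c. F (b, c) * g c \<partial>lborel)"
    by blast
  show "(\<forall>x. W differentiable at x) \<and> (\<forall>v\<in>Basis. \<exists>F. smooth F \<and> locally_compact_support F \<and>
      (\<lambda>x. fderiv W x v) = (\<lambda>b. \<integral>c. F (b, c) * g c \<partial>lborel))"
  proof (intro conjI allI ballI)
    show "W differentiable at x" for x
      unfolding W by (rule differentiableI[OF param_integral_has_derivative[OF F g]])
    fix v :: 'a
    show "\<exists>F. smooth F \<and> locally_compact_support F \<and>
      (\<lambda>x. fderiv W x v) = (\<lambda>b. \<integral>c. F (b, c) * g c \<partial>lborel)"
      by (intro exI[of _ "\<lambda>p. fderiv F p (v, 0)"] conjI locally_compact_support_partial F)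
        (use F in \<open>auto simp: W frechet_derivative_param_integral[OF F g]\<close>)
  qed
qed (use F in blast)

subsection \<open>The maximum principle\<close>

lemma smooth_tvf [intro]:
  assumes "smooth V" shows "smooth (tvf V)"
proof -
  have "tvf V = (\<lambda>p. (0, V (snd p)))" by (simp add: tvf_def fun_eq_iff split_beta)
  then show ?thesis by (simp only:) (intro smooth_Pair smooth_const smooth_compose[OF assms] smooth_snd smooth_id)
qed

lemma vf_apply_tvf:
  assumes "smooth f"
  shows "vf_apply (tvf V) f (t, x) = vf_apply V (\<lambda>x. f (t, x)) x"
  unfolding vf_apply_def
  by (subst frechet_derivative_compose'[OF assms, where g' = "\<lambda>v. (0, v)"])
    (auto intro!: derivative_eq_intros simp: tvf_def)

lemma vf_apply_tvf_twice:
  assumes "smooth f" "smooth V"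
  shows "vf_apply (tvf V) (vf_apply (tvf V) f) (t, x) = vf_apply V (vf_apply V (\<lambda>x. f (t, x))) x"
proof -
  have "vf_apply (tvf V) (vf_apply (tvf V) f) (t, x) = vf_apply V (\<lambda>x. vf_apply (tvf V) f (t, x)) x"
    using assms by (intro vf_apply_tvf) auto
  also have "(\<lambda>x. vf_apply (tvf V) f (t, x)) = vf_apply V (\<lambda>x. f (t, x))"
    by (simp add: vf_apply_tvf[OF assms(1)] fun_eq_iff)
  finally show ?thesis .
qed

lemma dt_has_derivative:
  assumes "smooth f" shows "((\<lambda>t. f (t, x)) has_real_derivative dt f (t, x)) (at t)"
proof -
  have "((\<lambda>s. f ((0, x) + s *\<^sub>R (1, 0))) has_real_derivative
      fderiv f ((0, x) + t *\<^sub>R (1, 0)) (1, 0)) (at t)"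
    by (rule smooth_line_derivative[OF assms])
  then show ?thesis by (simp add: dt_def vf_apply_def)
qed

text \<open>The product rule separates a second derivative with the direction \<open>W x\<close>
  frozen from a first-order term with the derivative of \<open>W\<close>. By symmetry of second
  derivatives only the latter can obstruct commutation, and it vanishes at critical points of
  \<open>g\<close>.\<close>

lemma vf_apply_vf_apply:
  fixes g :: "'a::euclidean_space \<Rightarrow> real"
  assumes g: "smooth g" and W: "smooth W"
  shows "vf_apply U (vf_apply W g) x =
    fderiv (\<lambda>y. fderiv g y (W x)) x (U x) +
    fderiv g x (fderiv W x (U x))"
proof -
  let ?D = "\<lambda>v y. fderiv g y v"
  have exp: "?D w y = (\<Sum>b\<in>Basis. (w \<bullet> b) * ?D b y)" for w y
    using linear_basis_expansion[OF linear_frechet_derivative[OF g], of y w] by simp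
  have "vf_apply W g = (\<lambda>y. \<Sum>b\<in>Basis. (W y \<bullet> b) * ?D b y)"
    by (simp only: vf_apply_def exp[symmetric])
  moreover have "((\<lambda>y. \<Sum>b\<in>Basis. (W y \<bullet> b) * ?D b y) has_derivative
      (\<lambda>h. \<Sum>b\<in>Basis. (W x \<bullet> b) * fderiv (?D b) x h + (fderiv W x h \<bullet> b) * ?D b x)) (at x)"
    by (intro has_derivative_sum has_derivative_mult bounded_linear.has_derivative[OF bounded_linear_inner_left]
        smooth_has_derivative W smooth_partial g)
  ultimately have "(vf_apply W g has_derivative (\<lambda>h. (\<Sum>b\<in>Basis. (W x \<bullet> b) * fderiv (?D b) x h) +
      ?D (fderiv W x h) x)) (at x)"
    by (simp only: sum.distrib exp[symmetric])
  from fun_cong[OF frechet_derivative_at[OF this], of "U x"]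
  have 1: "vf_apply U (vf_apply W g) x = (\<Sum>b\<in>Basis. (W x \<bullet> b) * fderiv (?D b) x (U x)) +
      ?D (fderiv W x (U x)) x"
    by (simp add: vf_apply_def)
  have "((\<lambda>y. \<Sum>b\<in>Basis. (W x \<bullet> b) * ?D b y) has_derivative
      (\<lambda>h. \<Sum>b\<in>Basis. (W x \<bullet> b) * fderiv (?D b) x h)) (at x)"
    by (intro has_derivative_sum has_derivative_mult_right smooth_has_derivative smooth_partial g)
  then have "(?D (W x) has_derivative (\<lambda>h. \<Sum>b\<in>Basis. (W x \<bullet> b) * fderiv (?D b) x h)) (at x)"
    by (simp only: exp[symmetric])
  from fun_cong[OF frechet_derivative_at[OF this], of "U x"] 1 show ?thesis by simp
qed

lemma vf_apply_commute:
  fixes g :: "'a::euclidean_space \<Rightarrow> real"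
  assumes "smooth g" "smooth U" "smooth W"
    and "fderiv W x (U x) = fderiv U x (W x)"
  shows "vf_apply U (vf_apply W g) x = vf_apply W (vf_apply U g) x"
  unfolding vf_apply_vf_apply[OF assms(1,2)] vf_apply_vf_apply[OF assms(1,3)]
  by (simp only: assms(4) second_derivative_symmetric[OF assms(1), where v = "W x"])

lemma frechet_derivative_uminus:
  "smooth f \<Longrightarrow> fderiv (\<lambda>x. - f x) q h = - fderiv f q h"
  using fun_cong[OF frechet_derivative_at[OF has_derivative_minus[OF smooth_has_derivative]], of f q h] by simp

lemma vf_apply_uminus: "smooth f \<Longrightarrow> vf_apply V (\<lambda>q. - f q) = (\<lambda>q. - vf_apply V f q)"
  by (simp add: vf_apply_def frechet_derivative_uminus)

text \<open>The gradient vanishes at a maximum, so \<open>V\<close> can be frozen at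
  \<open>p\<close>. A positive second derivative in that direction would make \<open>g\<close>
  increase along the line through \<open>p\<close>.\<close>

lemma vf_apply_twice_at_max:
  fixes g :: "'a::euclidean_space \<Rightarrow> real"
  assumes g: "smooth g" and V: "smooth V" and max: "\<And>x. g x \<le> g p"
  shows "vf_apply V (vf_apply V g) p \<le> 0"
proof -
  let ?D = "\<lambda>v x. fderiv g x v"
  define u where "u = V p"
  have crit: "?D v p = 0" for v
    using differential_zero_maxmin[of p UNIV g "fderiv g p"] smooth_has_derivative[OF g] max
    by auto
  have 2: "vf_apply V (vf_apply V g) p = fderiv (?D u) p u"
    unfolding vf_apply_vf_apply[OF g V] by (simp add: crit u_def)
  show ?thesis
  proof (rule ccontr)
    assume "\<not> ?thesis"
    then have pos: "fderiv (?D u) p u > 0" using 2 by simp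
    have "((\<lambda>s. ?D u (p + s *\<^sub>R u)) has_real_derivative fderiv (?D u) (p + 0 *\<^sub>R u) u) (at 0)"
      by (intro smooth_line_derivative smooth_frechet_derivative g smooth_const)
    from DERIV_pos_inc_right[OF this] pos obtain d where d: "d > 0"
      "\<And>h. 0 < h \<Longrightarrow> h < d \<Longrightarrow> ?D u (p + 0 *\<^sub>R u) < ?D u (p + h *\<^sub>R u)" by auto
    have "\<exists>z. 0 < z \<and> z < d / 2 \<and> g (p + (d / 2) *\<^sub>R u) - g (p + 0 *\<^sub>R u) = (d / 2 - 0) * ?D u (p + z *\<^sub>R u)"
      by (rule MVT2) (use d in \<open>auto intro: smooth_line_derivative[OF g]\<close>)
    then obtain z where z: "0 < z" "z < d / 2" "g (p + (d / 2) *\<^sub>R u) - g p = d / 2 * ?D u (p + z *\<^sub>R u)" by auto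
    then have "0 < ?D u (p + z *\<^sub>R u)" using d(2)[of z] crit d(1) by simp
    then have "0 < d / 2 * ?D u (p + z *\<^sub>R u)" using d(1) by simp
    then show False using z(3) max[of "p + (d / 2) *\<^sub>R u"] by linarith
  qed
qed

text \<open>The barrier is \<open>C * (arctan t + pi / 2)\<close>, on which the heat operator takes the value \<open>- C / (1 + t\<^sup>2)\<close>.\<close>

proposition heat_maximum_principle:
  fixes w :: "real \<times> 'a::euclidean_space \<Rightarrow> real"
  assumes X: "\<And>j. j < m \<Longrightarrow> smooth (X j)" and w: "smooth w" and lim: "(w \<longlongrightarrow> 0) at_infinity"
    and C: "C > 0" and L: "\<And>t x. heat_op X m w (t, x) > - C / (1 + t\<^sup>2)"
  shows "w p \<le> C * pi"
proof (rule ccontr)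
  assume "\<not> w p \<le> C * pi"
  then have wp: "w p > C * pi" by simp
  \<comment> \<open>The barrier lies between 0 and \<open>C * pi\<close>, so \<open>v\<close> is at
    most \<open>w\<close> and still positive at \<open>p\<close>. As \<open>w\<close> tends to 0 at
    infinity, \<open>v\<close> attains a global maximum.\<close>
  define v where "v q = w q - C * (arctan (fst q) + pi / 2)" for q
  have v_le: "v q \<le> w q" for q
    using C arctan_lbound[of "fst q"] by (simp add: v_def)
  have vp: "v p > 0"
  proof -
    have "C * (arctan (fst p) + pi / 2) \<le> C * pi"
      using C arctan_ubound[of "fst p"] by (intro mult_left_mono) auto
    then show ?thesis using wp by (simp add: v_def)
  qed
  have "eventually (\<lambda>q. w q < v p) at_infinity"
    using order_tendstoD(2)[OF lim vp] .
  then obtain R where R: "\<And>q. norm q \<ge> R \<Longrightarrow> w q < v p"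
    unfolding eventually_at_infinity by blast
  have pR: "p \<in> cball 0 R" using R[of p] v_le[of p] by (cases "norm p \<ge> R") auto
  have "continuous_on (cball 0 R) v"
    unfolding v_def by (intro continuous_intros smooth_imp_continuous_on w) 
  then have "\<exists>q\<in>cball 0 R. \<forall>r\<in>cball 0 R. v r \<le> v q"
    using continuous_attains_sup[OF compact_cball] pR by blast
  then obtain q where q: "q \<in> cball 0 R" "\<And>r. r \<in> cball 0 R \<Longrightarrow> v r \<le> v q" by blast
  have max: "v r \<le> v q" for r
  proof (cases "r \<in> cball 0 R")
    case False
    then have "v r \<le> v p" using R[of r] v_le[of r] by simp
    then show ?thesis using q(2)[OF pR] by simp
  qed (rule q)
  obtain t x where qtx: "q = (t, x)" by (cases q)
  \<comment> \<open>For fixed time the barrier is constant in space, so \<open>w\<close> restricted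
    to this time also has its maximum at \<open>x\<close>.\<close>
  have "vf_apply (tvf (X j)) (vf_apply (tvf (X j)) w) (t, x) \<le> 0" if "j < m" for j
    unfolding vf_apply_tvf_twice[OF w X[OF that]]
  proof (rule vf_apply_twice_at_max[OF _ X[OF that]])
    show "smooth (\<lambda>x. w (t, x))" by (intro smooth_compose[OF w] smooth_Pair smooth_const smooth_id)
    show "w (t, y) \<le> w (t, x)" for y using max[of "(t, y)"] by (simp add: v_def qtx)
  qed
  then have sum: "(\<Sum>j<m. vf_apply (tvf (X j)) (vf_apply (tvf (X j)) w) (t, x)) \<le> 0"
    by (intro sum_nonpos) auto
  have "((\<lambda>t. v (t, x)) has_real_derivative dt w (t, x) - C * (1 / (1 + t\<^sup>2))) (at t)"
    unfolding v_def by (auto intro!: derivative_eq_intros dt_has_derivative[OF w] simp: inverse_eq_divide)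
  \<comment> \<open>Stationarity in time gives \<open>dt w = C / (1 + t\<^sup>2)\<close> there; with
    the nonpositive spatial sum this contradicts the strict lower bound on
    \<open>heat_op\<close>.\<close>
  then have "dt w (t, x) - C * (1 / (1 + t\<^sup>2)) = 0"
    by (rule DERIV_local_max[of _ _ _ 1]) (use max qtx in auto)
  then show False
    using sum L[of t x] by (simp add: heat_op_def)
qed

text \<open>A solution satisfies the strict inequality with every positive \<open>C\<close>; the
  choice \<open>C = e / pi\<close> gives the bound \<open>e\<close>, and the same applies to
  \<open>- w\<close>.\<close>

corollary heat_liouville:
  fixes w :: "real \<times> 'a::euclidean_space \<Rightarrow> real"
  assumes X: "\<And>j. j < m \<Longrightarrow> smooth (X j)" and w: "smooth w" and lim: "(w \<longlongrightarrow> 0) at_infinity"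
    and L: "\<And>p. heat_op X m w p = 0"
  shows "w p = 0"
proof -
  have le: "v p \<le> 0" if v: "smooth v" "(v \<longlongrightarrow> 0) at_infinity" "\<And>p. heat_op X m v p = 0"
    for v :: "real \<times> 'a \<Rightarrow> real"
  proof (rule field_le_epsilon)
    fix e :: real assume e: "e > 0"
    have pos: "1 + t\<^sup>2 > 0" for t :: real by (rule add_pos_nonneg) auto
    have "v p \<le> (e / pi) * pi"
      by (rule heat_maximum_principle[OF X v(1,2)]) (use e pos v(3) in auto)
    then show "v p \<le> 0 + e" by simp
  qed
  have "vf_apply (tvf (X j)) (vf_apply (tvf (X j)) (\<lambda>q. - w q)) q = - vf_apply (tvf (X j)) (vf_apply (tvf (X j)) w) q"
    if "j < m" for j q
    using w X[OF that] by (simp add: vf_apply_uminus smooth_vf_apply smooth_tvf)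
  then have "heat_op X m (\<lambda>q. - w q) q = - heat_op X m w q" for q
    using w by (simp add: heat_op_def dt_def vf_apply_uminus sum_negf)
  then have "- w p \<le> 0"
    using tendsto_minus[OF lim] w L by (intro le) auto
  with le[OF w lim L] show ?thesis by simp
qed

subsection \<open>Groups with dilations\<close>

text \<open>The dilations are diagonal with weights attached to basis vectors, which treats both
  blocks of exponents at once. The lower bound on the weights makes \<open>D r\<close> contract to
  the origin as \<open>r\<close> tends to 0.\<close>

locale homogeneous_group =
  fixes star :: "'a::euclidean_space \<Rightarrow> 'a \<Rightarrow> 'a" and ginv :: "'a \<Rightarrow> 'a" and d :: "'a \<Rightarrow> real"
    and D :: "real \<Rightarrow> 'a \<Rightarrow> 'a"
  assumes star_smooth: "smooth (\<lambda>(a, b). star a b)" and ginv_smooth: "smooth ginv"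
    and star_assoc: "star (star a b) c = star a (star b c)"
    and star_0_left [simp]: "star 0 a = a" and star_0_right [simp]: "star a 0 = a"
    and ginv_left [simp]: "star (ginv a) a = 0" and ginv_right [simp]: "star a (ginv a) = 0"
    and d_ge_1: "b \<in> Basis \<Longrightarrow> 1 \<le> d b"
    and D_eq: "D r u = (\<Sum>b\<in>Basis. (r powr d b * (u \<bullet> b)) *\<^sub>R b)"
    and D_star: "r > 0 \<Longrightarrow> D r (star a b) = star (D r a) (D r b)"
begin

lemma star_ginv_cancel [simp]: "star a (star (ginv a) b) = b" "star (ginv a) (star a b) = b"
  by (simp_all add: star_assoc[symmetric])

lemma ginv_unique: "star a b = 0 \<Longrightarrow> ginv a = b"
  by (metis star_ginv_cancel(2) star_0_right)

lemma ginv_0 [simp]: "ginv 0 = 0"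
  by (rule ginv_unique) simp

lemma ginv_ginv [simp]: "ginv (ginv a) = a"
  by (rule ginv_unique) simp

lemma ginv_star: "ginv (star a b) = star (ginv b) (ginv a)"
  by (rule ginv_unique) (simp add: star_assoc)

lemma smooth_star [intro]:
  fixes f g :: "'b::euclidean_space \<Rightarrow> 'a"
  assumes "smooth f" "smooth g" shows "smooth (\<lambda>x. star (f x) (g x))"
  using smooth_compose[OF star_smooth smooth_Pair[OF assms]] by simp

lemma smooth_ginv [intro]: "smooth f \<Longrightarrow> smooth (\<lambda>x. ginv (f x))"
  by (rule smooth_compose[OF ginv_smooth])

lemma D_inner: "b \<in> Basis \<Longrightarrow> D r u \<bullet> b = r powr d b * (u \<bullet> b)"
  by (simp add: D_eq)

lemma linear_D: "linear (D r)"
  by (rule linearI) (auto intro!: euclidean_eqI[where 'a = 'a] simp: D_inner inner_add_left algebra_simps)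

lemma smooth_D [intro]: "smooth f \<Longrightarrow> smooth (\<lambda>x. D r (f x))"
  using smooth_bounded_linear linear_D linear_conv_bounded_linear by blast

lemma D_Basis: "b \<in> Basis \<Longrightarrow> D r b = r powr d b *\<^sub>R b"
  by (rule euclidean_eqI) (auto simp: D_inner inner_Basis)

lemma D_inverse: "r > 0 \<Longrightarrow> D r (D (1 / r) u) = u"
  by (rule euclidean_eqI) (simp add: D_inner powr_divide)

lemma D_0 [simp]: "D r 0 = 0"
  by (simp add: D_eq)

lemma D_ginv: "r > 0 \<Longrightarrow> D r (ginv a) = ginv (D r a)"
  by (rule ginv_unique[symmetric]) (simp add: D_star[symmetric])

lemma D_tendsto_0: "((\<lambda>r. D r u) \<longlongrightarrow> 0) (at_right 0)"
proof -
  have "((\<lambda>r. \<Sum>b\<in>Basis. (r powr d b * (u \<bullet> b)) *\<^sub>R b) \<longlongrightarrow> (\<Sum>b\<in>Basis. (0 * (u \<bullet> b)) *\<^sub>R b)) (at_right 0)"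
  proof (intro tendsto_intros)
    fix b :: 'a assume "b \<in> Basis"
    then have "d b > 0" using d_ge_1[of b] by simp
    moreover have "((\<lambda>r::real. r) \<longlongrightarrow> 0) (at_right 0)" by (rule tendsto_ident_at)
    ultimately show "((\<lambda>r. r powr d b) \<longlongrightarrow> 0) (at_right 0)"
      using tendsto_powr'[of "\<lambda>r. r" 0 "at_right 0" "\<lambda>_. d b" "d b"]
      by (auto simp: eventually_at_right_less eventually_at_filter)
  qed
  then show ?thesis by (simp add: D_eq)
qed

text \<open>As 0 is a two-sided unit, both partial maps at the origin are the identity, and
  linearity adds their derivatives.\<close>

lemma star_derivative_0:
  "fderiv (\<lambda>(a, b). star a b) (0, 0) (v, w) = v + w"
proof -
  let ?S = "\<lambda>p. fderiv (\<lambda>(a, b). star a b) (0, 0) p"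
  have "fderiv (\<lambda>a. (case (a, 0) of (a, b) \<Rightarrow> star a b)) 0 v = ?S (v, 0)"
    by (rule frechet_derivative_fst[OF star_smooth])
  moreover have "fderiv (\<lambda>b. (case (0, b) of (a, b) \<Rightarrow> star a b)) 0 w = ?S (0, w)"
    by (rule frechet_derivative_snd[OF star_smooth])
  moreover have "?S ((v, 0) + (0, w)) = ?S (v, 0) + ?S (0, w)"
    by (rule linear_add[OF linear_frechet_derivative[OF star_smooth]])
  moreover have "fderiv (\<lambda>x. x) 0 u = u" for u :: 'a
    using fun_cong[OF frechet_derivative_at[OF has_derivative_ident], of u "0::'a"] by simp
  ultimately show ?thesis by simp
qed

text \<open>Differentiate \<open>star x (ginv x) = 0\<close> at the origin.\<close>

lemma ginv_derivative_0: "fderiv ginv 0 v = - v"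
proof -
  have "((\<lambda>x. (x, ginv x)) has_derivative (\<lambda>v. (v, fderiv ginv 0 v))) (at 0)"
    by (intro has_derivative_Pair has_derivative_ident smooth_has_derivative ginv_smooth)
  from frechet_derivative_compose'[OF star_smooth this, of v]
  have "fderiv (\<lambda>x. 0) 0 v = v + fderiv ginv 0 v"
    by (simp add: star_derivative_0)
  moreover have "fderiv (\<lambda>x. 0::'a) (0::'a) v = 0"
  proof -
    have "((\<lambda>x::'a. 0::'a) has_derivative (\<lambda>v. 0)) (at 0)" by simp
    from fun_cong[OF frechet_derivative_at[OF this], of v] show ?thesis by simp
  qed
  ultimately show ?thesis by (simp add: eq_neg_iff_add_eq_0 add.commute)
qed

text \<open>The Jacobian of a map commuting with the dilations is homogeneous of degree 0 and continuous,
  hence equal to its value at the origin.\<close>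

proposition equivariant_volume_preserving:
  assumes \<Psi>: "smooth \<Psi>" and eqv: "\<And>r x u. r > 0 \<Longrightarrow> \<Psi> (D r x, D r u) = D r (\<Psi> (x, u))"
    and bij: "bij (\<lambda>u. \<Psi> (x, u))"
    and J0: "\<bar>eucl_det (\<lambda>v. fderiv \<Psi> (0, 0) (0, v))\<bar> = 1"
  shows "distr lborel borel (\<lambda>u. \<Psi> (x, u)) = lborel"
proof -
  \<comment> \<open>The derivative is taken in \<open>u\<close> only, but \<open>x\<close> has to be
    dilated along with \<open>u\<close>: for fixed \<open>x\<close> the map need not commute with
    the dilations.\<close>
  define A where "A x u v = fderiv \<Psi> (x, u) (0, v)" for x u v
  have A: "A x u = fderiv (\<lambda>u. \<Psi> (x, u)) u" for x u
    unfolding A_def by (rule ext) (rule frechet_derivative_snd[OF \<Psi>, symmetric])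
  have sl: "smooth (\<lambda>u. \<Psi> (x, u))" for x using \<Psi> by (rule smooth_slice_snd)
  have Alin: "linear (A x u)" for x u
    unfolding A by (rule linear_frechet_derivative[OF sl])
  have conj: "D r (A x u v) = A (D r x) (D r u) (D r v)" if r: "r > 0" for r x u v
  proof -
    have Dd: "(D r has_derivative D r) F" for F
      using linear_D linear_conv_bounded_linear bounded_linear_imp_has_derivative by blast
    have "((\<lambda>u. D r (\<Psi> (x, u))) has_derivative (\<lambda>v. D r (A x u v))) (at u)"
      unfolding A using diff_chain_at[OF smooth_has_derivative[OF sl] Dd] by (simp only: o_def)
    moreover have "((\<lambda>u. \<Psi> (D r x, D r u)) has_derivative (\<lambda>v. A (D r x) (D r u) (D r v))) (at u)"
      unfolding A using diff_chain_at[OF Dd smooth_has_derivative[OF sl]] by (simp only: o_def)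
    ultimately have "(\<lambda>v. D r (A x u v)) = (\<lambda>v. A (D r x) (D r u) (D r v))"
      unfolding eqv[OF r] by (rule has_derivative_unique)
    then show ?thesis by (rule fun_cong)
  qed
  have inv: "eucl_det (A x u) = eucl_det (A (D r x) (D r u))" if r: "r > 0" for r x u
    by (rule eucl_det_conjugate[OF Alin Alin linear_D linear_D, of r "1 / r"])
      (use r conj D_inverse in auto)
  have "((\<lambda>r. eucl_det (A (D r x) (D r u))) \<longlongrightarrow> eucl_det (A 0 0)) (at_right 0)" for x u
  proof (rule tendsto_eucl_det)
    fix b c :: 'a
    have "smooth (\<lambda>p. fderiv \<Psi> p (0, b) \<bullet> c)"
      by (intro smooth_inner_left smooth_frechet_derivative \<Psi> smooth_const)
    then have "isCont (\<lambda>p. fderiv \<Psi> p (0, b) \<bullet> c) (0, 0)" by (rule smooth_isCont)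
    moreover have "((\<lambda>r. (D r x, D r u)) \<longlongrightarrow> (0, 0)) (at_right 0)"
      by (intro tendsto_Pair D_tendsto_0)
    ultimately show "((\<lambda>r. A (D r x) (D r u) b \<bullet> c) \<longlongrightarrow> A 0 0 b \<bullet> c) (at_right 0)"
      unfolding A_def by (rule isCont_tendsto_compose)
  qed
  moreover have "((\<lambda>r. eucl_det (A (D r x) (D r u))) \<longlongrightarrow> eucl_det (A x u)) (at_right 0)" for x u
    by (rule tendsto_eventually, rule eventually_mono[OF eventually_at_right_less[of 0]], rule inv[symmetric])
  ultimately have eq: "eucl_det (A x u) = eucl_det (A 0 0)" for x u
    by (blast intro: tendsto_unique[OF trivial_limit_at_right_real])
  have "\<bar>eucl_det (A 0 0)\<bar> = 1" using J0 unfolding A_def[abs_def] .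
  then have det: "\<bar>eucl_det (A x u)\<bar> = 1" for u
    by (simp only: eq[of x u])
  show ?thesis
    by (rule lborel_distr_volume_preserving[OF _ bij det])
      (unfold A, rule smooth_has_derivative[OF sl])
qed

text \<open>Inversion and translation are handled as one map, equivariant jointly in
  \<open>a\<close> and \<open>c\<close>, with derivative \<open>- v\<close> at the origin. The sign
  is harmless: an involution has determinant 1 in absolute value.\<close>

lemma lborel_distr_star_ginv: "distr lborel borel (\<lambda>c. star a (ginv c)) = lborel"
proof -
  let ?\<Psi> = "\<lambda>p. star (fst p) (ginv (snd p))"
  have sm: "smooth ?\<Psi>" by (intro smooth_star smooth_ginv smooth_fst smooth_snd smooth_id)
  have der: "fderiv ?\<Psi> (0, 0) (0, v) = - v" for v
    unfolding frechet_derivative_snd[OF sm, symmetric] by (simp add: ginv_derivative_0)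
  have "distr lborel borel (\<lambda>u. ?\<Psi> (a, u)) = lborel"
  proof (rule equivariant_volume_preserving[OF sm])
    show "?\<Psi> (D r x, D r u) = D r (?\<Psi> (x, u))" if "r > 0" for r x u
      using that by (simp add: D_star D_ginv)
    show "bij (\<lambda>u. ?\<Psi> (a, u))"
      by (rule o_bij[where g = "\<lambda>u. star (ginv u) a"]) (auto simp: fun_eq_iff ginv_star star_assoc)
    show "\<bar>eucl_det (\<lambda>v. fderiv ?\<Psi> (0, 0) (0, v))\<bar> = 1"
      unfolding der by (rule eucl_det_involution) (auto intro: linearI)
  qed
  then show ?thesis by simp
qed

end

lemma lborel_distr_reflect: "distr lborel borel (\<lambda>s. t - s) = (lborel :: real measure)"
  using lborel_real_affine[of "-1" t] by (simp add: density_1)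

lemma lborel_distr_time_reflect:
  fixes \<psi> :: "'a::euclidean_space \<Rightarrow> 'b::euclidean_space"
  assumes \<psi>: "\<psi> \<in> borel_measurable borel" "distr lborel borel \<psi> = lborel"
  shows "distr lborel borel (\<lambda>q. (t - fst q, \<psi> (snd q))) = (lborel :: (real \<times> 'b) measure)"
proof -
  have "(lborel :: (real \<times> 'b) measure) = distr lborel borel (\<lambda>s. t - s) \<Otimes>\<^sub>M distr lborel borel \<psi>"
    by (simp add: \<psi> lborel_distr_reflect lborel_prod)
  also have "\<dots> = distr (lborel \<Otimes>\<^sub>M lborel) (borel \<Otimes>\<^sub>M borel) (\<lambda>(s, u). (t - s, \<psi> u))"
    by (rule pair_measure_distr) (use \<psi> lborel.sigma_finite_measure_axioms in auto)
  also have "\<dots> = distr lborel borel (\<lambda>q. (t - fst q, \<psi> (snd q)))"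
    by (simp add: lborel_prod borel_prod split_beta')
  finally show ?thesis by simp
qed

subsection \<open>Convolution with the fundamental solution\<close>

lemma vf_apply_snd:
  assumes "smooth F"
  shows "vf_apply (\<lambda>x. (0, V (snd x))) F (p, q) = vf_apply V (\<lambda>q. F (p, q)) q"
  by (simp add: vf_apply_def frechet_derivative_snd[OF assms])

lemma smooth_lift_fst:
  fixes V :: "'a::euclidean_space \<Rightarrow> 'a"
  assumes "smooth V" shows "smooth (\<lambda>x::'a \<times> 'b::euclidean_space. (V (fst x), 0::'b))"
  by (intro smooth_Pair smooth_const smooth_compose[OF assms] smooth_fst smooth_id)

lemma smooth_lift_snd:
  fixes V :: "'b::euclidean_space \<Rightarrow> 'b"
  assumes "smooth V" shows "smooth (\<lambda>x::'a::euclidean_space \<times> 'b. (0::'a, V (snd x)))"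
  by (intro smooth_Pair smooth_const smooth_compose[OF assms] smooth_snd smooth_id)

lemma vf_apply_snd_twice:
  assumes "smooth F" "smooth V"
  shows "vf_apply (\<lambda>x. (0, V (snd x))) (vf_apply (\<lambda>x. (0, V (snd x))) F) (p, q) =
    vf_apply V (vf_apply V (\<lambda>q. F (p, q))) q"
proof -
  have "(\<lambda>q. vf_apply (\<lambda>x. (0, V (snd x))) F (p, q)) = vf_apply V (\<lambda>q. F (p, q))"
    by (rule ext) (rule vf_apply_snd[OF assms(1)])
  then show ?thesis
    by (subst vf_apply_snd) (auto intro!: smooth_vf_apply smooth_lift_snd assms)
qed

text \<open>The two fields act on separate variables, so neither coefficient map varies in the
  direction of the other field.\<close>

lemma vf_apply_lift_commute:
  fixes F :: "'a::euclidean_space \<times> 'b::euclidean_space \<Rightarrow> real"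
  assumes F: "smooth F" and V: "smooth V" and W: "smooth W"
  shows "vf_apply (\<lambda>x. (V (fst x), 0)) (vf_apply (\<lambda>x. (0, W (snd x))) F) x =
    vf_apply (\<lambda>x. (0, W (snd x))) (vf_apply (\<lambda>x. (V (fst x), 0)) F) x"
proof (rule vf_apply_commute[OF F smooth_lift_fst[OF V] smooth_lift_snd[OF W]])
  have "((\<lambda>x. (0::'a, W (snd x))) has_derivative (\<lambda>h. (0, fderiv W (snd x) (snd h)))) (at x)"
    using diff_chain_at[OF bounded_linear_imp_has_derivative[OF bounded_linear_snd] smooth_has_derivative[OF W]]
    by (intro has_derivative_Pair has_derivative_const) (simp only: o_def)
  from fun_cong[OF frechet_derivative_at[OF this], of "(V (fst x), 0)", symmetric]
  have 1: "fderiv (\<lambda>x. (0::'a, W (snd x))) x (V (fst x), 0) = 0"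
    using linear_0[OF linear_frechet_derivative[OF W]] by (simp add: zero_prod_def)
  have "((\<lambda>x. (V (fst x), 0::'b)) has_derivative (\<lambda>h. (fderiv V (fst x) (fst h), 0))) (at x)"
    using diff_chain_at[OF bounded_linear_imp_has_derivative[OF bounded_linear_fst] smooth_has_derivative[OF V]]
    by (intro has_derivative_Pair has_derivative_const) (simp only: o_def)
  from fun_cong[OF frechet_derivative_at[OF this], of "(0, W (snd x))", symmetric]
  have 2: "fderiv (\<lambda>x. (V (fst x), 0::'b)) x (0, W (snd x)) = 0"
    using linear_0[OF linear_frechet_derivative[OF V]] by (simp add: zero_prod_def)
  show "fderiv (\<lambda>x. (0, W (snd x))) x (V (fst x), 0) =
      fderiv (\<lambda>x. (V (fst x), 0)) x (0, W (snd x))"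
    using 1 2 by simp
qed

text \<open>A function constant along \<open>k\<close> has zero derivative in the direction
  \<open>(v, w)\<close>; splitting this direction trades a derivative in the first variable for one
  in the second.\<close>

lemma fderiv_constant_along:
  assumes F: "smooth F" and k: "(k has_derivative k') (at y)"
    and c: "\<And>z. F (k z) = c" and h: "k' h = (v, w)"
  shows "fderiv F (k y) (v, 0) = - fderiv F (k y) (0, w)"
proof -
  have "fderiv F (k y) (v, w) = 0"
    using frechet_derivative_compose'[OF F k, of h] by (simp add: c h frechet_derivative_const)
  then show ?thesis
    using linear_add[OF linear_frechet_derivative[OF F], of "k y" "(v, 0)" "(0, w)"]
    by (simp add: eq_neg_iff_add_eq_0)
qed

lemma vf_apply_param_integral:
  assumes "smooth F" "locally_compact_support F" "loc_integrable g"
  shows "vf_apply V (\<lambda>b. \<integral>c. F (b, c) * g c \<partial>lborel) =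
    (\<lambda>b. \<integral>c. vf_apply (\<lambda>x. (V (fst x), 0)) F (b, c) * g c \<partial>lborel)"
  by (simp add: vf_apply_def frechet_derivative_param_integral[OF assms])

lemma locally_compact_support_vf_apply:
  assumes "smooth F" "locally_compact_support F"
  shows "locally_compact_support (vf_apply (\<lambda>x. (V (fst x), 0)) F)"
  unfolding vf_apply_def by (rule locally_compact_support_partial[OF assms])

lemma vf_apply_add:
  assumes "smooth f" "smooth g"
  shows "vf_apply V (\<lambda>x. f x + g x) = (\<lambda>x. vf_apply V f x + vf_apply V g x)"
proof
  fix x
  have "((\<lambda>x. f x + g x) has_derivative (\<lambda>h. fderiv f x h + fderiv g x h)) (at x)"
    by (intro has_derivative_add smooth_has_derivative assms)
  from fun_cong[OF frechet_derivative_at[OF this], of "V x"]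
  show "vf_apply V (\<lambda>x. f x + g x) x = vf_apply V f x + vf_apply V g x" by (simp add: vf_apply_def)
qed

lemma heat_op_add:
  assumes "\<And>j. j < m \<Longrightarrow> smooth (X j)" "smooth f" "smooth g"
  shows "heat_op X m (\<lambda>x. f x + g x) p = heat_op X m f p + heat_op X m g p"
proof -
  have "vf_apply (tvf (X j)) (vf_apply (tvf (X j)) (\<lambda>x. f x + g x)) p =
      vf_apply (tvf (X j)) (vf_apply (tvf (X j)) f) p + vf_apply (tvf (X j)) (vf_apply (tvf (X j)) g) p"
    if "j < m" for j
    using assms(1)[OF that] by (simp add: vf_apply_add assms smooth_vf_apply smooth_tvf)
  then show ?thesis
    by (simp add: heat_op_def dt_def vf_apply_add assms sum.distrib)
qed

lemma test_fun_heat_op: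
  assumes "\<And>j. j < m \<Longrightarrow> smooth (X j)" "test_fun f"
  shows "test_fun (heat_op X m f)"
  unfolding heat_op_def dt_def
  by (intro test_fun_diff test_fun_sum test_fun_vf_apply smooth_tvf smooth_const) (use assms in auto)

lemma test_fun_compose:
  assumes f: "test_fun f" and h: "smooth h" and k: "continuous_on UNIV k" "\<And>x. k (h x) = x"
  shows "test_fun (\<lambda>x. f (h x))"
proof -
  obtain K where K: "compact K" "\<And>x. x \<notin> K \<Longrightarrow> f x = 0" using f test_fun_iff by metis
  have "compact (k ` K)" by (rule compact_continuous_image[OF continuous_on_subset[OF k(1)] K(1)]) simp
  moreover have "f (h x) = 0" if "x \<notin> k ` K" for x
    using K(2)[of "h x"] k(2)[of x] that by (metis imageI)
  ultimately show ?thesis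
    unfolding test_fun_iff using smooth_compose[OF test_fun_smooth[OF f] h] by blast
qed

lemma test_fun_tendsto_0: 
  assumes "test_fun f" shows "(f \<longlongrightarrow> 0) at_infinity"
proof (rule tendsto_eventually)
  obtain K where K: "compact K" "\<And>x. x \<notin> K \<Longrightarrow> f x = 0" using assms test_fun_iff by metis
  obtain R where "\<And>x. x \<in> K \<Longrightarrow> norm x \<le> R"
    using compact_imp_bounded[OF K(1)] bounded_iff by blast
  then show "eventually (\<lambda>x. f x = 0) at_infinity"
    unfolding eventually_at_infinity using K(2) by (intro exI[of _ "R + 1"]) force
qed

section \<open>Potentials of test functions\<close>

locale homogeneous_heat_kernel = homogeneous_group star ginv d D
  for star :: "'a::euclidean_space \<Rightarrow> 'a \<Rightarrow> 'a" and ginv d D +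
  fixes Z :: "nat \<Rightarrow> 'a \<Rightarrow> 'a" and m :: nat and \<gamma> :: "real \<times> 'a \<Rightarrow> real"
  assumes Z_smooth: "j < m \<Longrightarrow> smooth (Z j)"
    and Z_left: "j < m \<Longrightarrow> fderiv (\<lambda>b. star a b) b (Z j b) = Z j (star a b)"
    and Z_hom: "j < m \<Longrightarrow> r > 0 \<Longrightarrow> D r (Z j u) = r *\<^sub>R Z j (D r u)"
    and gamma_loc: "loc_integrable \<gamma>"
    and gamma_fund: "test_fun \<phi> \<Longrightarrow> (\<integral>w. \<gamma> w * heat_op_transp Z m \<phi> w \<partial>lborel) = - \<phi> (0, 0)"
    and gamma_inf: "(\<gamma> \<longlongrightarrow> 0) at_infinity"
begin

text \<open>Differentiated homogeneity of degree 1 shows that a diagonal entry \<open>a\<close> of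
  the derivative satisfies \<open>r * a (D r u) = a u\<close>. Being continuous at the origin,
  \<open>a\<close> has to vanish, as \<open>r\<close> tending to 0 shows.\<close>

lemma Z_divergence_free:
  assumes j: "j < m" and b: "b \<in> Basis"
  shows "fderiv (Z j) u b \<bullet> b = 0"
proof -
  let ?a = "\<lambda>u. fderiv (Z j) u b \<bullet> b"
  have Dd: "(D r has_derivative D r) F" for r F
    using linear_D linear_conv_bounded_linear bounded_linear_imp_has_derivative by blast
  note Zd = smooth_has_derivative[OF Z_smooth[OF j]]
  have eq: "r * ?a (D r u) = ?a u" if r: "r > 0" for r
  proof -
    have "((\<lambda>u. D r (Z j u)) has_derivative (\<lambda>v. D r (fderiv (Z j) u v))) (at u)"
      using diff_chain_at[OF Zd Dd] by (simp only: o_def)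
    moreover have "((\<lambda>u. r *\<^sub>R Z j (D r u)) has_derivative (\<lambda>v. r *\<^sub>R fderiv (Z j) (D r u) (D r v))) (at u)"
      using has_derivative_scaleR_right[OF diff_chain_at[OF Dd Zd]] by (simp only: o_def)
    ultimately have "(\<lambda>v. D r (fderiv (Z j) u v)) = (\<lambda>v. r *\<^sub>R fderiv (Z j) (D r u) (D r v))"
      unfolding Z_hom[OF j r] by (rule has_derivative_unique)
    from fun_cong[OF this, of b]
    have "D r (fderiv (Z j) u b) \<bullet> b = r * (fderiv (Z j) (D r u) (r powr d b *\<^sub>R b) \<bullet> b)"
      by (simp add: D_Basis b)
    then show ?thesis
      using r by (simp add: D_inner b linear_scale[OF has_derivative_linear[OF Zd]])
  qed
  have "smooth ?a" by (intro smooth_inner_left smooth_frechet_derivative Z_smooth[OF j] smooth_const)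
  from isCont_tendsto_compose[OF smooth_isCont[OF this] D_tendsto_0]
  have "((\<lambda>r. r * ?a (D r u)) \<longlongrightarrow> 0 * ?a 0) (at_right 0)"
    by (intro tendsto_mult tendsto_ident_at)
  moreover have "((\<lambda>r. r * ?a (D r u)) \<longlongrightarrow> ?a u) (at_right 0)"
    by (rule tendsto_eventually, rule eventually_mono[OF eventually_at_right_less[of 0]], rule eq)
  ultimately show ?thesis
    using tendsto_unique[OF trivial_limit_at_right_real] by force
qed

lemma vf_div_tvf_Z: "j < m \<Longrightarrow> vf_div (tvf (Z j)) p = 0"
proof -
  assume j: "j < m"
  obtain t x where p: "p = (t, x)" by (cases p)
  have tv: "tvf (Z j) = (\<lambda>p. (0, Z j (snd p)))" by (simp add: tvf_def fun_eq_iff split_beta)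
  have der: "(tvf (Z j) has_derivative (\<lambda>h. (0, fderiv (Z j) x (snd h)))) (at p)"
    using diff_chain_at[OF bounded_linear_imp_has_derivative[OF bounded_linear_snd] smooth_has_derivative[OF Z_smooth[OF j]], of p]
    unfolding tv by (intro has_derivative_Pair has_derivative_const) (simp add: o_def p)
  have "fderiv (tvf (Z j)) p b \<bullet> b = 0" if b: "b \<in> Basis" for b
    using b linear_0[OF linear_frechet_derivative[OF Z_smooth[OF j]]]
    by (auto simp: frechet_derivative_at[OF der, symmetric] Basis_prod_def Z_divergence_free[OF j])
  then show ?thesis by (simp add: vf_div_def)
qed

text \<open>For a divergence-free field the adjoint is \<open>- Z j\<close>, and applying it twice
  removes the sign.\<close>

lemma heat_op_transp_Z:
  assumes "smooth \<phi>"
  shows "heat_op_transp Z m \<phi> w = (\<Sum>j<m. vf_apply (tvf (Z j)) (vf_apply (tvf (Z j)) \<phi>) w) + dt \<phi> w"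
proof -
  have "vf_adj (tvf (Z j)) (vf_adj (tvf (Z j)) \<phi>) w = vf_apply (tvf (Z j)) (vf_apply (tvf (Z j)) \<phi>) w"
    if j: "j < m" for j
  proof -
    have adj: "vf_adj (tvf (Z j)) f = (\<lambda>x. - vf_apply (tvf (Z j)) f x)" for f
      by (simp add: vf_adj_def vf_div_tvf_Z[OF j])
    show ?thesis
      unfolding adj using assms Z_smooth[OF j] by (subst vf_apply_uminus) auto
  qed
  then show ?thesis by (simp add: heat_op_transp_def)
qed

definition right_shift :: "(real \<times> 'a \<Rightarrow> real) \<Rightarrow> (real \<times> 'a) \<times> (real \<times> 'a) \<Rightarrow> real" where
  "right_shift f x = f (fst (fst x) - fst (snd x), star (snd (fst x)) (ginv (snd (snd x))))"

lemma smooth_right_shift: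
  assumes "smooth f" shows "smooth (right_shift f)"
  unfolding right_shift_def[abs_def]
  by (intro smooth_compose[OF assms] smooth_Pair smooth_diff smooth_star smooth_ginv smooth_fst smooth_snd smooth_id)

text \<open>If \<open>p * q\<^sup>-\<^sup>1 = k\<close> with \<open>k\<close> in the support, then
  \<open>q = k\<^sup>-\<^sup>1 * p\<close>, which stays in a compact set while \<open>p\<close> is
  bounded.\<close>

lemma locally_compact_support_right_shift:
  assumes f: "test_fun f" shows "locally_compact_support (right_shift f)"
  unfolding locally_compact_support_def
proof
  fix R :: real
  obtain K where K: "compact K" "\<And>x. x \<notin> K \<Longrightarrow> f x = 0" using f test_fun_iff by metis
  let ?h = "\<lambda>x. (fst (fst x) - fst (snd x), star (ginv (snd (snd x))) (snd (fst x)))"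
  have "smooth ?h"
    by (intro smooth_Pair smooth_diff smooth_star smooth_ginv smooth_fst smooth_snd smooth_id)
  then have "compact (?h ` (cball 0 R \<times> K))"
    by (intro compact_continuous_image smooth_imp_continuous_on compact_Times compact_cball K)
  moreover have "right_shift f (p, q) = 0" if p: "norm p \<le> R" and q: "q \<notin> ?h ` (cball 0 R \<times> K)" for p q
  proof -
    let ?k = "(fst p - fst q, star (snd p) (ginv (snd q)))"
    have h: "q = ?h (p, ?k)" by (simp add: ginv_star star_assoc)
    have "?k \<notin> K"
    proof
      assume "?k \<in> K"
      then have "(p, ?k) \<in> cball 0 R \<times> K" using p by (intro SigmaI) simp_all
      then have "q \<in> ?h ` (cball 0 R \<times> K)" by (rule image_eqI[where f = ?h, OF h])
      then show False using q by contradiction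
    qed
    then show ?thesis using K(2) by (simp add: right_shift_def)
  qed
  ultimately show "\<exists>K. compact K \<and> (\<forall>p q. norm p \<le> R \<longrightarrow> q \<notin> K \<longrightarrow> right_shift f (p, q) = 0)"
    by blast
qed

text \<open>A function of \<open>p * q\<^sup>-\<^sup>1\<close> is constant along \<open>(p * x, q * x)\<close>, so a left-invariant field
  acting on \<open>p\<close> is the negative of the same field acting on \<open>q\<close>.\<close>

lemma vf_apply_right_shift:
  assumes f: "smooth f" and j: "j < m"
  shows "vf_apply (\<lambda>x. (tvf (Z j) (fst x), 0)) (right_shift f) =
    (\<lambda>x. - vf_apply (\<lambda>x. (0, tvf (Z j) (snd x))) (right_shift f) x)"
proof
  fix x :: "(real \<times> 'a) \<times> (real \<times> 'a)"
  obtain t a s c where x: "x = ((t, a), (s, c))" by (metis prod.collapse)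
  \<comment> \<open>At \<open>y = 0\<close> in the direction \<open>Z j 0\<close> the two spatial
    components move with velocities \<open>Z j a\<close> and \<open>Z j c\<close>, by left
    invariance.\<close>
  let ?k = "\<lambda>y. ((t, star a y), (s, star c y))"
  have "smooth (\<lambda>y. star b y)" for b by (intro smooth_star smooth_const smooth_id)
  then have "(?k has_derivative (\<lambda>v. ((0, fderiv (star a) 0 v), (0, fderiv (star c) 0 v)))) (at 0)"
    by (intro has_derivative_Pair has_derivative_const smooth_has_derivative)
  from fderiv_constant_along[OF smooth_right_shift[OF f] this, of "right_shift f x" "Z j 0" "(0, Z j a)" "(0, Z j c)"]
  show "vf_apply (\<lambda>x. (tvf (Z j) (fst x), 0)) (right_shift f) x = - vf_apply (\<lambda>x. (0, tvf (Z j) (snd x))) (right_shift f) x"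
    using Z_left[OF j, of a 0] Z_left[OF j, of c 0]
    by (simp add: right_shift_def x ginv_star star_assoc vf_apply_def tvf_def)
qed

lemma dt_right_shift:
  assumes f: "smooth f"
  shows "vf_apply (\<lambda>x. ((1, 0), 0)) (right_shift f) x = - vf_apply (\<lambda>x. (0, (1, 0))) (right_shift f) x"
proof -
  obtain t a s c where x: "x = ((t, a), (s, c))" by (metis prod.collapse)
  have "((\<lambda>h::real. ((t + h, a), (s + h, c))) has_derivative (\<lambda>v. ((v, 0), (v, 0)))) (at 0)"
    by (auto intro!: derivative_eq_intros)
  from fderiv_constant_along[OF smooth_right_shift[OF f] this, of "right_shift f x" 1 "(1, 0)" "(1, 0)"]
  show ?thesis by (simp add: right_shift_def x vf_apply_def)
qed

text \<open>The inner field is moved from \<open>p\<close> to \<open>q\<close>, commuted past the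
  outer one, and then the outer one is moved; the two minus signs cancel.\<close>

lemma vf_apply_right_shift_twice:
  assumes f: "smooth f" and j: "j < m"
  defines "V1 \<equiv> \<lambda>x::(real \<times> 'a) \<times> (real \<times> 'a). (tvf (Z j) (fst x), 0::real \<times> 'a)"
    and "V2 \<equiv> \<lambda>x::(real \<times> 'a) \<times> (real \<times> 'a). (0::real \<times> 'a, tvf (Z j) (snd x))"
  shows "vf_apply V1 (vf_apply V1 (right_shift f)) x = vf_apply V2 (vf_apply V2 (right_shift f)) x"
proof -
  let ?F = "right_shift f"
  have Z: "smooth (tvf (Z j))" by (intro smooth_tvf Z_smooth j)
  have V: "smooth V1" "smooth V2" unfolding V1_def V2_def by (intro smooth_lift_fst smooth_lift_snd Z)+
  have F: "smooth ?F" by (rule smooth_right_shift[OF f])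
  have eq: "vf_apply V1 ?F = (\<lambda>x. - vf_apply V2 ?F x)"
    unfolding V1_def V2_def by (rule vf_apply_right_shift[OF f j])
  have "vf_apply V1 (vf_apply V1 ?F) x = - vf_apply V1 (vf_apply V2 ?F) x"
    unfolding eq using V F by (subst vf_apply_uminus) auto
  also have "\<dots> = - vf_apply V2 (vf_apply V1 ?F) x"
    unfolding V1_def V2_def by (subst vf_apply_lift_commute[OF F Z Z]) simp
  also have "\<dots> = vf_apply V2 (vf_apply V2 ?F) x"
    unfolding eq using V F by (subst vf_apply_uminus) auto
  finally show ?thesis .
qed

definition potential :: "(real \<times> 'a \<Rightarrow> real) \<Rightarrow> real \<times> 'a \<Rightarrow> real" where
  "potential f p = (\<integral>q. right_shift f (p, q) * \<gamma> q \<partial>lborel)"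

lemma smooth_potential: "test_fun f \<Longrightarrow> smooth (potential f)"
  unfolding potential_def[abs_def]
  by (intro smooth_param_integral smooth_right_shift locally_compact_support_right_shift gamma_loc test_fun_smooth)

text \<open>With all derivatives moved to \<open>q\<close>, the integrand is \<open>\<gamma>\<close>
  times the transpose operator applied to \<open>q \<mapsto> f (p * q\<^sup>-\<^sup>1)\<close>; the
  sign change of the time derivative is the one in the transpose. The equation of
  \<open>\<gamma>\<close> evaluates this test function at the origin, where it equals
  \<open>f p\<close>.\<close>

proposition heat_op_potential:
  assumes f: "test_fun f" shows "heat_op Z m (potential f) p = - f p"
proof -
  let ?F = "right_shift f"
  have F: "smooth ?F" and Fc: "locally_compact_support ?F"
    by (intro smooth_right_shift test_fun_smooth f, intro locally_compact_support_right_shift f)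
  define \<phi> where "\<phi> q = ?F (p, q)" for q
  let ?ZZ = "\<lambda>j. vf_apply (tvf (Z j)) (vf_apply (tvf (Z j)) \<phi>)"
  have \<phi>: "test_fun \<phi>"
    unfolding \<phi>_def[abs_def] by (rule locally_compact_support_test_fun[OF F Fc])
  have ZZ: "vf_apply (tvf (Z j)) (vf_apply (tvf (Z j)) (potential f)) p =
      (\<integral>q. ?ZZ j q * \<gamma> q \<partial>lborel)" if j: "j < m" for j
  proof -
    have Z: "smooth (tvf (Z j))" by (intro smooth_tvf Z_smooth j)
    let ?V1 = "\<lambda>x::(real \<times> 'a) \<times> (real \<times> 'a). (tvf (Z j) (fst x), 0::real \<times> 'a)"
    have "vf_apply (tvf (Z j)) (vf_apply (tvf (Z j)) (potential f)) p =
        (\<integral>q. vf_apply ?V1 (vf_apply ?V1 ?F) (p, q) * \<gamma> q \<partial>lborel)"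
      unfolding potential_def[abs_def] vf_apply_param_integral[OF F Fc gamma_loc]
      by (subst vf_apply_param_integral) (auto intro!: smooth_vf_apply smooth_lift_fst Z F Fc gamma_loc locally_compact_support_vf_apply)
    also have "\<dots> = (\<integral>q. ?ZZ j q * \<gamma> q \<partial>lborel)"
      unfolding vf_apply_right_shift_twice[OF test_fun_smooth[OF f] j] vf_apply_snd_twice[OF F Z] \<phi>_def[abs_def] ..
    finally show ?thesis .
  qed
  have T: "dt (potential f) p = - (\<integral>q. dt \<phi> q * \<gamma> q \<partial>lborel)"
  proof -
    have "dt (potential f) p = (\<integral>q. vf_apply (\<lambda>x. ((1, 0), 0)) ?F (p, q) * \<gamma> q \<partial>lborel)"
      unfolding dt_def potential_def[abs_def] vf_apply_param_integral[OF F Fc gamma_loc] ..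
    also have "\<dots> = (\<integral>q. - (dt \<phi> q * \<gamma> q) \<partial>lborel)"
      unfolding dt_right_shift[OF test_fun_smooth[OF f]] vf_apply_snd[OF F, of "\<lambda>_. (1, 0)"] dt_def \<phi>_def[abs_def]
      by simp
    finally show ?thesis by simp
  qed
  have int: "integrable lborel (\<lambda>q. ?ZZ j q * \<gamma> q)" if "j < m" for j
    by (intro test_fun_mult_integrable test_fun_vf_apply \<phi> smooth_tvf Z_smooth that gamma_loc)
  have intT: "integrable lborel (\<lambda>q. dt \<phi> q * \<gamma> q)"
    unfolding dt_def by (intro test_fun_mult_integrable test_fun_vf_apply \<phi> smooth_const gamma_loc)
  have "heat_op Z m (potential f) p =
      (\<Sum>j<m. \<integral>q. ?ZZ j q * \<gamma> q \<partial>lborel) + (\<integral>q. dt \<phi> q * \<gamma> q \<partial>lborel)"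
    by (simp add: heat_op_def ZZ T)
  also have "\<dots> = (\<integral>q. (\<Sum>j<m. ?ZZ j q * \<gamma> q) + dt \<phi> q * \<gamma> q \<partial>lborel)"
  proof -
    have "integrable lborel (\<lambda>q. \<Sum>j<m. ?ZZ j q * \<gamma> q)"
      by (rule Bochner_Integration.integrable_sum) (use int in auto)
    moreover have "(\<integral>q. (\<Sum>j<m. ?ZZ j q * \<gamma> q) \<partial>lborel) =
        (\<Sum>j<m. \<integral>q. ?ZZ j q * \<gamma> q \<partial>lborel)"
      by (rule Bochner_Integration.integral_sum) (use int in auto)
    ultimately show ?thesis using intT by (simp add: Bochner_Integration.integral_add)
  qed
  also have "\<dots> = (\<integral>q. \<gamma> q * heat_op_transp Z m \<phi> q \<partial>lborel)"
    by (simp add: heat_op_transp_Z[OF test_fun_smooth[OF \<phi>]] algebra_simps sum_distrib_left)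
  also have "\<dots> = - f p"
    unfolding gamma_fund[OF \<phi>] by (simp add: \<phi>_def right_shift_def)
  finally show ?thesis .
qed

text \<open>For \<open>p\<close> far away, \<open>f (p * q\<^sup>-\<^sup>1)\<close> is nonzero only
  for large \<open>q\<close>, where \<open>\<gamma>\<close> is small. By invariance of the volume
  the integral of \<open>|f (p * q\<^sup>-\<^sup>1)|\<close> over \<open>q\<close> is the same for
  all \<open>p\<close>, so the estimate is uniform.\<close>

lemma potential_tendsto_0:
  assumes f: "test_fun f" shows "(potential f \<longlongrightarrow> 0) at_infinity"
proof -
  obtain K where K: "compact K" "\<And>x. x \<notin> K \<Longrightarrow> f x = 0" using f test_fun_iff by metis
  have fint: "integrable lborel (\<lambda>x. \<bar>f x\<bar>)"
  proof -
    have "loc_integrable (\<lambda>x::real \<times> 'a. 1)"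
      by (auto simp: loc_integrable_def set_integrable_def intro!: integrable_real_indicator emeasure_compact_finite borel_compact)
    from integrable_abs[OF test_fun_mult_integrable[OF f this]] show ?thesis by simp
  qed
  define I where "I = (\<integral>x. \<bar>f x\<bar> \<partial>lborel)"
  have I: "I \<ge> 0" unfolding I_def by (intro Bochner_Integration.integral_nonneg) auto
  have fm [measurable]: "f \<in> borel_measurable borel"
    by (intro smooth_borel_measurable test_fun_smooth f)
  have m1: "(\<lambda>c. star a (ginv c)) \<in> borel_measurable borel" for a
    by (intro smooth_borel_measurable smooth_star smooth_const smooth_ginv smooth_id)
  have shift: "integrable lborel (\<lambda>q. \<bar>right_shift f (p, q)\<bar>)" "(\<integral>q. \<bar>right_shift f (p, q)\<bar> \<partial>lborel) = I" for p
  proof -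
    let ?h = "\<lambda>q. (fst p - fst q, star (snd p) (ginv (snd q)))"
    have eq: "distr lborel borel ?h = lborel"
      by (rule lborel_distr_time_reflect[OF m1 lborel_distr_star_ginv])
    have hm: "?h \<in> measurable lborel borel"
      by (simp, intro smooth_borel_measurable smooth_Pair smooth_diff smooth_star smooth_const
          smooth_ginv smooth_fst smooth_snd smooth_id)
    have "integrable (distr lborel borel ?h) (\<lambda>x. \<bar>f x\<bar>)" unfolding eq by (rule fint)
    then show "integrable lborel (\<lambda>q. \<bar>right_shift f (p, q)\<bar>)"
      by (subst (asm) integrable_distr_eq[OF hm]) (auto simp: right_shift_def)
    have "I = (\<integral>x. \<bar>f x\<bar> \<partial>distr lborel borel ?h)" unfolding eq I_def ..
    also have "\<dots> = (\<integral>q. \<bar>right_shift f (p, q)\<bar> \<partial>lborel)"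
      by (subst integral_distr[OF hm]) (auto simp: right_shift_def)
    finally show "(\<integral>q. \<bar>right_shift f (p, q)\<bar> \<partial>lborel) = I" by simp
  qed
  show ?thesis
  proof (rule tendstoI)
    fix e :: real assume e: "e > 0"
    define e' where "e' = e / (I + 1)"
    have e': "e' > 0" using e I by (simp add: e'_def)
    obtain R where R: "\<And>q. norm q \<ge> R \<Longrightarrow> \<bar>\<gamma> q\<bar> < e'"
      using tendstoD[OF gamma_inf e'] unfolding eventually_at_infinity by (auto simp: dist_real_def)
    \<comment> \<open>The product in time and space: if \<open>q\<close> lies in the ball and the
      quotient of \<open>p\<close> by \<open>q\<close> in \<open>K\<close>, then \<open>p\<close>
      lies in the bounded image of \<open>K \<times> cball 0 R\<close>.\<close>
    let ?h = "\<lambda>x. (fst (fst x) + fst (snd x), star (snd (fst x)) (snd (snd x)))"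
    have "smooth ?h"
      by (intro smooth_Pair smooth_add smooth_star smooth_fst smooth_snd smooth_id)
    then have "bounded (?h ` (K \<times> cball 0 R))"
      by (intro compact_imp_bounded compact_continuous_image smooth_imp_continuous_on compact_Times compact_cball K)
    then obtain R' where "\<forall>p\<in>?h ` (K \<times> cball 0 R). norm p \<le> R'"
      unfolding bounded_iff ..
    then have R': "p \<in> ?h ` (K \<times> cball 0 R) \<Longrightarrow> norm p \<le> R'" for p by (rule bspec)
    have "\<bar>potential f p\<bar> < e" if p: "norm p > R'" for p
    proof -
      have pt: "\<bar>right_shift f (p, q) * \<gamma> q\<bar> \<le> \<bar>right_shift f (p, q)\<bar> * e'" for q
      proof (cases "norm q \<ge> R")
        case True
        then show ?thesis using R[OF True] by (simp add: abs_mult mult_left_mono)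
      next
        case False
        let ?k = "(fst p - fst q, star (snd p) (ginv (snd q)))"
        have h: "p = ?h (?k, q)" by (simp add: star_assoc)
        have "?k \<notin> K"
        proof
          assume "?k \<in> K"
          then have "(?k, q) \<in> K \<times> cball 0 R" using False by (intro SigmaI) simp_all
          then have "p \<in> ?h ` (K \<times> cball 0 R)" by (rule image_eqI[where f = ?h, OF h])
          from R'[OF this] p show False by simp
        qed
        then show ?thesis using K(2) by (simp add: right_shift_def)
      qed
      have "norm (potential f p) \<le> (\<integral>q. \<bar>right_shift f (p, q)\<bar> * e' \<partial>lborel)"
        unfolding potential_def
      proof (rule Bochner_Integration.integral_norm_bound_integral)
        show "integrable lborel (\<lambda>q. right_shift f (p, q) * \<gamma> q)"
          by (intro test_fun_mult_integrable locally_compact_support_test_fun smooth_right_shift test_fun_smooth f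
              locally_compact_support_right_shift gamma_loc)
        show "integrable lborel (\<lambda>q. \<bar>right_shift f (p, q)\<bar> * e')"
          by (intro integrable_mult_left shift)
      qed (use pt in auto)
      also have "\<dots> = I * e'" by (simp add: shift)
      also have "\<dots> < (I + 1) * e'" using e' by simp
      also have "\<dots> = e" using I by (simp add: e'_def)
      finally show ?thesis by simp
    qed
    then show "\<forall>\<^sub>F p in at_infinity. dist (potential f p) 0 < e"
      unfolding eventually_at_infinity dist_real_def by (intro exI[of _ "R' + 1"]) auto
  qed
qed

text \<open>The operator under the integral acts before the right translation and cannot be moved to
  \<open>q\<close>. Instead, the sum of the potential and \<open>u\<close> solves the homogeneous
  equation and tends to 0.\<close>

proposition potential_heat_op:
  assumes u: "test_fun u" shows "potential (heat_op Z m u) p = - u p"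
proof -
  have f: "test_fun (heat_op Z m u)" by (rule test_fun_heat_op[OF Z_smooth u])
  have "potential (heat_op Z m u) p + u p = 0"
  proof (rule heat_liouville[of m Z])
    show "smooth (\<lambda>p. potential (heat_op Z m u) p + u p)"
      by (intro smooth_add smooth_potential f test_fun_smooth u)
    show "((\<lambda>p. potential (heat_op Z m u) p + u p) \<longlongrightarrow> 0) at_infinity"
      using tendsto_add[OF potential_tendsto_0[OF f] test_fun_tendsto_0[OF u]] by simp
    show "heat_op Z m (\<lambda>p. potential (heat_op Z m u) p + u p) p = 0" for p
      by (subst heat_op_add) (use f u in \<open>auto simp: heat_op_potential Z_smooth smooth_potential test_fun_smooth\<close>)
  qed (rule Z_smooth)
  then show ?thesis by simp
qed

end

section \<open>Integrability of the kernel over strips in time\<close>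

context homogeneous_heat_kernel
begin

text \<open>The integral is the value of a potential at the origin. The maximum principle sees only
  the size of \<open>g\<close> and its extent in time, so the bound is independent of the spatial
  support.\<close>

lemma gamma_duality_bound:
  assumes g: "test_fun g" and g1: "\<And>q. \<bar>g q\<bar> \<le> 1" and gT: "\<And>q. \<bar>fst q\<bar> > T \<Longrightarrow> g q = 0"
  shows "(\<integral>q. g q * \<gamma> q \<partial>lborel) \<le> (2 + T\<^sup>2) * pi"
proof -
  \<comment> \<open>At the origin the potential evaluates its function at the inverse of
    \<open>q\<close>, so \<open>g\<close> is reflected beforehand; \<open>?h\<close> is an
    involution.\<close>
  let ?h = "\<lambda>q. (- fst q, ginv (snd q))"
  define f where "f q = g (?h q)" for q
  have h: "smooth ?h" by (intro smooth_Pair smooth_uminus smooth_ginv smooth_fst smooth_snd smooth_id)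
  have f: "test_fun f"
    unfolding f_def[abs_def]
    by (rule test_fun_compose[OF g h, of ?h]) (use h in \<open>auto intro: smooth_imp_continuous_on\<close>)
  \<comment> \<open>With 2 in place of 1 the quotient
    \<open>(2 + T\<^sup>2) / (1 + t\<^sup>2)\<close> is strictly above 1 for
    \<open>|t| \<le> T\<close>, as the strict hypothesis of the maximum principle demands.\<close>
  have C: "2 + T\<^sup>2 > 0" by (rule add_pos_nonneg) auto
  have "potential f (0, 0) \<le> (2 + T\<^sup>2) * pi"
  proof (rule heat_maximum_principle[OF Z_smooth smooth_potential[OF f] potential_tendsto_0[OF f] C])
    fix t :: real and x :: 'a
    have pos: "1 + t\<^sup>2 > 0" by (rule add_pos_nonneg) auto
    have "f (t, x) < (2 + T\<^sup>2) / (1 + t\<^sup>2)"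
    proof (cases "\<bar>t\<bar> > T")
      case True
      then have "f (t, x) = 0" by (simp add: f_def gT)
      then show ?thesis using C pos by simp
    next
      case False
      then have "t\<^sup>2 \<le> T\<^sup>2" by (intro abs_le_square_iff[THEN iffD1]) simp
      then have "1 < (2 + T\<^sup>2) / (1 + t\<^sup>2)" using pos by (simp add: field_simps)
      moreover have "f (t, x) \<le> 1" using g1[of "?h (t, x)"] unfolding f_def by linarith
      ultimately show ?thesis by linarith
    qed
    then show "- (2 + T\<^sup>2) / (1 + t\<^sup>2) < heat_op Z m (potential f) (t, x)"
      by (simp only: heat_op_potential[OF f] minus_divide_left[symmetric] neg_less_iff_less)
  qed
  then show ?thesis by (simp add: potential_def right_shift_def f_def)
qed

text \<open>Since the dual bound ignores the spatial support, the cutoffs may be widened in space,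
  and Fatou's lemma passes to the limit.\<close>

proposition gamma_strip_integrable:
  assumes T: "T > 0"
  shows "integrable lborel (\<lambda>q. indicator {-T..T} (fst q) * \<gamma> q)"
proof -
  define C where "C = (2 + (2 * T)\<^sup>2) * pi"
  have C: "C \<ge> 0" by (simp add: C_def)
  \<comment> \<open>In time the cutoff lives on \<open>|t| \<le> 2 * T\<close>, which keeps it away
    from 0 on \<open>[-T, T]\<close>; the dilation by \<open>1 / real (Suc k)\<close> spreads it
    over all of space as \<open>k\<close> grows.\<close>
  define \<theta> :: "nat \<Rightarrow> real \<times> 'a \<Rightarrow> real"
    where "\<theta> k q = cutoff (fst q / (2 * T), D (1 / real (Suc k)) (snd q))" for k q
  define \<theta>' :: "real \<times> 'a \<Rightarrow> real" where "\<theta>' q = cutoff (fst q / (2 * T), 0::'a)" for q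
  have gm [measurable]: "\<gamma> \<in> borel_measurable borel" by (rule loc_integrable_borel_measurable[OF gamma_loc])
  have \<theta>: "test_fun (\<theta> k)" for k
    unfolding \<theta>_def[abs_def]
  proof (rule test_fun_compose[OF test_fun_cutoff, where k = "\<lambda>q. (fst q * (2 * T), D (real (Suc k)) (snd q))"])
    show "smooth (\<lambda>q::real \<times> 'a. (fst q / (2 * T), D (1 / real (Suc k)) (snd q)))"
      unfolding divide_inverse by (intro smooth_Pair smooth_mult smooth_const smooth_D smooth_fst smooth_snd smooth_id)
    show "continuous_on UNIV (\<lambda>q::real \<times> 'a. (fst q * (2 * T), D (real (Suc k)) (snd q)))"
      by (intro smooth_imp_continuous_on smooth_Pair smooth_mult smooth_const smooth_D smooth_fst smooth_snd smooth_id)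
    show "(fst (fst x / (2 * T), D (1 / real (Suc k)) (snd x)) * (2 * T),
        D (real (Suc k)) (snd (fst x / (2 * T), D (1 / real (Suc k)) (snd x)))) = x" for x
      using T by (simp add: D_inverse)
  qed
  have int: "integrable lborel (\<lambda>q. \<theta> k q * \<bar>\<gamma> q\<bar>)" for k
  proof -
    have "\<theta> k q * \<bar>\<gamma> q\<bar> = \<bar>\<theta> k q * \<gamma> q\<bar>" for q
      by (simp only: abs_mult \<theta>_def abs_of_nonneg[OF cutoff_nonneg])
    then show ?thesis using integrable_abs[OF test_fun_mult_integrable[OF \<theta> gamma_loc]] by simp
  qed
  have le: "(\<integral>q. \<theta> k q * \<bar>\<gamma> q\<bar> \<partial>lborel) \<le> C" for k
  proof (rule integral_abs_le_by_duality[OF gamma_loc \<theta>])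
    show "0 \<le> \<theta> k q" for q by (simp add: \<theta>_def cutoff_nonneg)
    fix f assume f: "test_fun f" "\<And>q. \<bar>f q\<bar> \<le> \<theta> k q"
    show "(\<integral>q. f q * \<gamma> q \<partial>lborel) \<le> C"
      unfolding C_def
    proof (rule gamma_duality_bound[OF f(1)])
      show "\<bar>f q\<bar> \<le> 1" for q
        using f(2)[of q] cutoff_le_1 unfolding \<theta>_def by (rule order_trans)
      fix q :: "real \<times> 'a" assume "\<bar>fst q\<bar> > 2 * T"
      then have "1 \<le> norm (fst q / (2 * T))" using T by (simp add: field_simps)
      also have "\<dots> \<le> norm (fst q / (2 * T), D (1 / real (Suc k)) (snd q))"
        using norm_fst_le[of "fst q / (2 * T)" "D (1 / real (Suc k)) (snd q)"] by simp
      finally have "\<theta> k q = 0" unfolding \<theta>_def by (rule cutoff_eq_0)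
      then show "f q = 0" using f(2)[of q] by simp
    qed
  qed
  have lim: "(\<lambda>k. \<theta> k q) \<longlonglongrightarrow> \<theta>' q" for q
  proof -
    have "filterlim (\<lambda>k. 1 / real (Suc k)) (at_right 0) sequentially"
      unfolding filterlim_at using LIMSEQ_inverse_real_of_nat by (auto simp: inverse_eq_divide)
    from filterlim_compose[OF D_tendsto_0 this]
    have "(\<lambda>k. (fst q / (2 * T), D (1 / real (Suc k)) (snd q))) \<longlonglongrightarrow> (fst q / (2 * T), 0)"
      by (intro tendsto_Pair tendsto_const)
    from isCont_tendsto_compose[OF smooth_isCont[OF smooth_cutoff] this]
    show ?thesis unfolding \<theta>_def \<theta>'_def .
  qed
  have \<theta>'m [measurable]: "\<theta>' \<in> borel_measurable borel"
    unfolding \<theta>'_def[abs_def] divide_inverse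
    by (intro smooth_borel_measurable smooth_compose[OF smooth_cutoff]
        smooth_Pair smooth_mult smooth_const smooth_fst smooth_id)
  have "(\<integral>\<^sup>+q. ennreal (\<theta>' q * \<bar>\<gamma> q\<bar>) \<partial>lborel) = (\<integral>\<^sup>+q. liminf (\<lambda>k. ennreal (\<theta> k q * \<bar>\<gamma> q\<bar>)) \<partial>lborel)"
  proof (rule nn_integral_cong)
    fix q
    have "(\<lambda>k. ennreal (\<theta> k q * \<bar>\<gamma> q\<bar>)) \<longlonglongrightarrow> ennreal (\<theta>' q * \<bar>\<gamma> q\<bar>)"
      by (intro tendsto_ennrealI tendsto_mult lim tendsto_const)
    then show "ennreal (\<theta>' q * \<bar>\<gamma> q\<bar>) = liminf (\<lambda>k. ennreal (\<theta> k q * \<bar>\<gamma> q\<bar>))"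
      by (intro lim_imp_Liminf[symmetric]) auto
  qed
  also have "\<dots> \<le> liminf (\<lambda>k. \<integral>\<^sup>+q. ennreal (\<theta> k q * \<bar>\<gamma> q\<bar>) \<partial>lborel)"
    using int by (intro nn_integral_liminf) auto
  also have "\<dots> \<le> ennreal C"
  proof (rule Liminf_le)
    have "(\<integral>\<^sup>+q. ennreal (\<theta> k q * \<bar>\<gamma> q\<bar>) \<partial>lborel) = ennreal (\<integral>q. \<theta> k q * \<bar>\<gamma> q\<bar> \<partial>lborel)" for k
      by (rule nn_integral_eq_integral[OF int]) (simp add: \<theta>_def cutoff_nonneg)
    then show "\<forall>\<^sub>F k in sequentially. (\<integral>\<^sup>+q. ennreal (\<theta> k q * \<bar>\<gamma> q\<bar>) \<partial>lborel) \<le> ennreal C"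
      using ennreal_leI[OF le] by (intro always_eventually) simp
  qed simp
  finally have fin: "(\<integral>\<^sup>+q. ennreal (\<theta>' q * \<bar>\<gamma> q\<bar>) \<partial>lborel) < \<infinity>"
    by (rule order.strict_trans1) simp
  have int': "integrable lborel (\<lambda>q. \<theta>' q * \<bar>\<gamma> q\<bar>)"
  proof (rule integrableI_nonneg)
    show "(\<lambda>q. \<theta>' q * \<bar>\<gamma> q\<bar>) \<in> borel_measurable lborel" by measurable
    show "AE q in lborel. 0 \<le> \<theta>' q * \<bar>\<gamma> q\<bar>" by (simp add: \<theta>'_def cutoff_nonneg)
  qed (rule fin)
  have cont: "continuous_on {-T..T} (\<lambda>s. cutoff (s * inverse (2 * T), 0::'a))"
    by (intro smooth_imp_continuous_on smooth_compose[OF smooth_cutoff] smooth_Pair smooth_mult smooth_const smooth_id)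
  have "\<exists>s\<in>{-T..T}. \<forall>s'\<in>{-T..T}. cutoff (s / (2 * T), 0::'a) \<le> cutoff (s' / (2 * T), 0::'a)"
    using continuous_attains_inf[OF compact_Icc _ cont] T unfolding divide_inverse by simp
  then obtain s where s: "s \<in> {-T..T}" "\<And>s'. s' \<in> {-T..T} \<Longrightarrow> cutoff (s / (2 * T), 0::'a) \<le> cutoff (s' / (2 * T), 0::'a)"
    by blast
  \<comment> \<open>The least value on \<open>[-T, T]\<close>; it is positive because
    \<open>|s / (2 * T)| < 1\<close>, and dividing by it turns the cutoff into a majorant of the
    indicator.\<close>
  define c where "c = cutoff (s / (2 * T), 0::'a)"
  have "norm (s / (2 * T), 0::'a) = \<bar>s / (2 * T)\<bar>" by (simp only: norm_Pair) simp
  also have "\<dots> < 1" using s(1) T by (auto simp: abs_less_iff field_simps)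
  finally have c: "c > 0" unfolding c_def by (rule cutoff_pos)
  show ?thesis
  proof (rule Bochner_Integration.integrable_bound)
    show "integrable lborel (\<lambda>q. (1 / c) * (\<theta>' q * \<bar>\<gamma> q\<bar>))" using int' by (rule integrable_mult_right)
    have "(\<lambda>q::real \<times> 'a. indicator {-T..T} (fst q) :: real) \<in> borel_measurable borel"
      by (rule measurable_compose[OF _ borel_measurable_indicator]) (auto simp: borel_prod[symmetric])
    then show "(\<lambda>q. indicator {-T..T} (fst q) * \<gamma> q) \<in> borel_measurable lborel" by simp
    have "norm (indicator {-T..T} (fst q) * \<gamma> q) \<le> norm ((1 / c) * (\<theta>' q * \<bar>\<gamma> q\<bar>))" for q
    proof (cases "fst q \<in> {-T..T}")
      case True
      then have "1 \<le> (1 / c) * \<theta>' q" using s(2)[OF True] c by (simp add: c_def \<theta>'_def field_simps)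
      from mult_right_mono[OF this abs_ge_zero[of "\<gamma> q"]] show ?thesis
        using True c cutoff_nonneg[of "(fst q / (2 * T), 0::'a)"] by (simp add: abs_mult \<theta>'_def)
    qed simp
    then show "AE q in lborel. norm (indicator {-T..T} (fst q) * \<gamma> q) \<le> norm ((1 / c) * (\<theta>' q * \<bar>\<gamma> q\<bar>))" by simp
  qed
qed

end

subsection \<open>Projection of the group law\<close>

lemma smooth_lipschitz_cball:
  fixes P :: "'a::euclidean_space \<Rightarrow> 'b::euclidean_space"
  assumes P: "smooth P"
  shows "\<exists>L\<ge>0. \<forall>x\<in>cball 0 R. \<forall>y\<in>cball 0 R. norm (P x - P y) \<le> L * norm (x - y)"
proof -
  have "\<exists>B\<ge>0. \<forall>x\<in>cball 0 R. norm (fderiv P x i) \<le> B" for i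
  proof -
    have "bounded ((\<lambda>x. fderiv P x i) ` cball 0 R)"
      by (intro compact_imp_bounded compact_continuous_image smooth_imp_continuous_on
          smooth_frechet_derivative P smooth_const compact_cball)
    then obtain B where "\<forall>y\<in>(\<lambda>x. fderiv P x i) ` cball 0 R. norm y \<le> B" unfolding bounded_iff ..
    then show ?thesis by (intro exI[of _ "max 0 B"]) (auto intro: max.coboundedI2)
  qed
  then obtain B where B: "\<And>i. B i \<ge> 0" "\<And>i x. x \<in> cball 0 R \<Longrightarrow> norm (fderiv P x i) \<le> B i"
    by metis
  let ?L = "\<Sum>i\<in>(Basis::'a set). B i"
  have "norm (P x - P y) \<le> ?L * norm (x - y)" if xy: "x \<in> cball 0 R" "y \<in> cball 0 R" for x y
  proof (rule differentiable_bound[OF convex_cball])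
    fix z :: 'a assume z: "z \<in> cball 0 R"
    show "(P has_derivative fderiv P z) (at z within cball 0 R)"
      by (rule has_derivative_at_withinI[OF smooth_has_derivative[OF P]])
    show "onorm (fderiv P z) \<le> ?L"
    proof (rule onorm_bound)
      show "0 \<le> ?L" using B(1) by (intro sum_nonneg)
      fix v
      have "norm (fderiv P z v) = norm (\<Sum>i\<in>Basis. (v \<bullet> i) *\<^sub>R fderiv P z i)"
        using linear_basis_expansion[OF linear_frechet_derivative[OF P], of z v] by simp
      also have "\<dots> \<le> (\<Sum>i\<in>Basis. B i * norm v)"
      proof (rule sum_norm_le)
        fix i :: 'a assume i: "i \<in> Basis"
        have "norm ((v \<bullet> i) *\<^sub>R fderiv P z i) \<le> norm v * B i"
          unfolding norm_scaleR by (intro mult_mono Basis_le_norm i B z) auto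
        then show "norm ((v \<bullet> i) *\<^sub>R fderiv P z i) \<le> B i * norm v" by (simp add: mult.commute)
      qed
      also have "\<dots> = ?L * norm v" by (simp add: sum_distrib_right)
      finally show "norm (fderiv P z v) \<le> ?L * norm v" .
    qed
  qed (use xy in auto)
  then show ?thesis using B(1) by (intro exI[of _ ?L]) (auto intro: sum_nonneg)
qed

text \<open>The energy \<open>|r|\<^sup>2 exp (-2 K s)\<close> does not increase and starts at
  0.\<close>

lemma gronwall_unique:
  fixes r :: "real \<Rightarrow> 'a::real_inner"
  assumes r: "\<And>s. (r has_vector_derivative r' s) (at s)" and r0: "r 0 = 0"
    and bound: "\<And>s. s \<in> {0..1} \<Longrightarrow> norm (r' s) \<le> K * norm (r s)"
  shows "r 1 = 0"
proof -
  define \<psi> where "\<psi> s = (r s \<bullet> r s) * exp (- (2 * K) * s)" for s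
  have "\<psi> 1 \<le> \<psi> 0"
  proof (rule DERIV_nonpos_imp_nonincreasing[of 0 1 \<psi>])
    fix s :: real assume s: "0 \<le> s" "s \<le> 1"
    have "((\<lambda>s. r s \<bullet> r s) has_real_derivative 2 * (r s \<bullet> r' s)) (at s)"
    proof -
      have "((\<lambda>s. r s \<bullet> r s) has_derivative (\<lambda>h. r s \<bullet> (h *\<^sub>R r' s) + (h *\<^sub>R r' s) \<bullet> r s)) (at s)"
        using r[of s] unfolding has_vector_derivative_def by (intro has_derivative_inner)
      moreover have "(\<lambda>h. r s \<bullet> (h *\<^sub>R r' s) + (h *\<^sub>R r' s) \<bullet> r s) = (*) (2 * (r s \<bullet> r' s))"
        by (simp add: fun_eq_iff inner_commute)
      ultimately show ?thesis by (simp only: has_field_derivative_def)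
    qed
    then have "(\<psi> has_real_derivative (2 * (r s \<bullet> r' s) - 2 * K * (r s \<bullet> r s)) * exp (- (2 * K) * s)) (at s)"
      unfolding \<psi>_def[abs_def] by (auto intro!: derivative_eq_intros simp: algebra_simps)
    moreover have "(2 * (r s \<bullet> r' s) - 2 * K * (r s \<bullet> r s)) * exp (- (2 * K) * s) \<le> 0"
    proof -
      have "r s \<bullet> r' s \<le> norm (r s) * norm (r' s)" by (rule norm_cauchy_schwarz)
      also have "\<dots> \<le> norm (r s) * (K * norm (r s))" using s by (intro mult_left_mono bound) auto
      also have "\<dots> = K * (r s \<bullet> r s)" by (simp add: power2_norm_eq_inner[symmetric] power2_eq_square)
      finally show ?thesis by (intro mult_nonpos_nonneg) auto
    qed
    ultimately show "\<exists>y. (\<psi> has_real_derivative y) (at s) \<and> y \<le> 0" by blast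
  qed simp
  then have "r 1 \<bullet> r 1 \<le> 0" by (simp add: \<psi>_def r0 mult_le_0_iff)
  then show ?thesis by (metis inner_eq_zero_iff inner_ge_zero order_antisym)
qed

text \<open>A straight line through 0 need not be a one-parameter subgroup. So the path near time
  \<open>s\<close> is factored into its value at \<open>s\<close> times the quotient of
  \<open>s' *\<^sub>R c\<close> by \<open>s *\<^sub>R c\<close>. That quotient passes through 0 with
  a velocity independent of \<open>a\<close>: the path follows a time-dependent left-invariant field
  that does not involve \<open>a\<close>.\<close>

lemma (in homogeneous_group) star_path_derivative:
  "((\<lambda>s. star a (s *\<^sub>R c)) has_vector_derivative
     fderiv (star (star a (s *\<^sub>R c))) 0
       (fderiv (\<lambda>(a, b). star a b) (ginv (s *\<^sub>R c), s *\<^sub>R c) (0, c))) (at s)"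
proof -
  let ?g = "ginv (s *\<^sub>R c)"
  let ?v = "fderiv (\<lambda>(a, b). star a b) (?g, s *\<^sub>R c) (0, c)"
  have sm: "smooth (star b)" for b
    using smooth_star[OF smooth_const smooth_id, of b] .
  have "((\<lambda>s'. s' *\<^sub>R c) has_derivative (\<lambda>h. h *\<^sub>R c)) (at s)"
    by (auto intro!: derivative_eq_intros)
  from diff_chain_at[OF this smooth_has_derivative[OF sm]]
  have "((\<lambda>s'. star ?g (s' *\<^sub>R c)) has_derivative (\<lambda>h. fderiv (star ?g) (s *\<^sub>R c) (h *\<^sub>R c))) (at s)"
    by (simp only: o_def)
  moreover have "fderiv (star ?g) (s *\<^sub>R c) (h *\<^sub>R c) = h *\<^sub>R ?v" for h
    using frechet_derivative_snd[OF star_smooth, of ?g "s *\<^sub>R c" c]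
      linear_scale[OF linear_frechet_derivative[OF sm]] by simp
  ultimately have "((\<lambda>s'. star ?g (s' *\<^sub>R c)) has_derivative (\<lambda>h. h *\<^sub>R ?v)) (at s)" by simp
  moreover have "(star (star a (s *\<^sub>R c)) has_derivative fderiv (star (star a (s *\<^sub>R c))) 0)
      (at (star ?g (s *\<^sub>R c)))"
    using smooth_has_derivative[OF sm] by simp
  ultimately have "((\<lambda>s'. star (star a (s *\<^sub>R c)) (star ?g (s' *\<^sub>R c))) has_derivative
      (\<lambda>h. fderiv (star (star a (s *\<^sub>R c))) 0 (h *\<^sub>R ?v))) (at s)"
    using diff_chain_at by (fastforce simp: o_def)
  then show ?thesis
    unfolding has_vector_derivative_def
    using linear_scale[OF linear_frechet_derivative[OF sm]]
    by (simp add: star_assoc)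
qed

text \<open>The paths from \<open>a\<close> and \<open>a'\<close> along \<open>c\<close> project to
  solutions of one equation \<open>x' = G s x\<close>: their common velocity \<open>w s\<close> does
  not involve the starting point, and left-invariant fields project. Equal initial values force
  equal ends.\<close>

lemma fst_star_eqI:
  fixes star :: "'x::euclidean_space \<times> 'y::euclidean_space \<Rightarrow> 'x \<times> 'y \<Rightarrow> 'x \<times> 'y"
  assumes "homogeneous_group star ginv d D"
    and proj: "\<And>v. \<exists>P. smooth P \<and> (\<forall>u. fst (fderiv (star u) 0 v) = P (fst u))"
    and aa: "fst a = fst a'"
  shows "fst (star a c) = fst (star a' c)"
proof -
  interpret homogeneous_group star ginv d D by fact
  obtain P where P: "\<And>v. smooth (P v)" "\<And>v u. fst (fderiv (star u) 0 v) = P v (fst u)"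
    using proj by metis
  define w where "w s = fderiv (\<lambda>(a, b). star a b) (ginv (s *\<^sub>R c), s *\<^sub>R c) (0, c)" for s :: real
  have sw: "smooth w"
  proof -
    have "smooth (\<lambda>p. fderiv (\<lambda>(a, b). star a b) p (0, c))"
      by (intro smooth_frechet_derivative star_smooth smooth_const)
    moreover have "smooth (\<lambda>s::real. (ginv (s *\<^sub>R c), s *\<^sub>R c))"
      by (intro smooth_Pair smooth_ginv smooth_scaleR smooth_id smooth_const)
    ultimately show ?thesis unfolding w_def[abs_def] by (rule smooth_compose)
  qed
  have sm: "smooth (star b)" for b
    using smooth_star[OF smooth_const smooth_id, of b] .
  define path where "path b s = fst (star b (s *\<^sub>R c))" for b and s :: real
  have path: "smooth (path b)" for b
    unfolding path_def[abs_def] by (intro smooth_fst smooth_star smooth_const smooth_scaleR smooth_id)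
  \<comment> \<open>A projected field \<open>P v\<close> is available for each fixed
    \<open>v\<close>; expanding the moving direction \<open>w s\<close> in the basis requires only
    finitely many of them, and hence one Lipschitz bound.\<close>
  define G where "G s x = (\<Sum>b\<in>Basis. (w s \<bullet> b) *\<^sub>R P b x)" for s x
  have der: "(path b has_vector_derivative G s (path b s)) (at s)" for b s
  proof -
    have "fderiv (star (star b (s *\<^sub>R c))) 0 (w s) =
        (\<Sum>i\<in>Basis. (w s \<bullet> i) *\<^sub>R fderiv (star (star b (s *\<^sub>R c))) 0 i)"
      by (rule linear_basis_expansion[OF linear_frechet_derivative[OF sm]])
    then have "fst (fderiv (star (star b (s *\<^sub>R c))) 0 (w s)) = G s (path b s)"
      by (simp add: G_def path_def fst_sum P(2))
    then show ?thesis
      using bounded_linear.has_vector_derivative[OF bounded_linear_fst star_path_derivative[of b c s]]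
      by (simp add: path_def[abs_def] w_def)
  qed
  have "\<exists>R. \<forall>s\<in>{0..1}. norm (h s) \<le> R" if "smooth h" for h :: "real \<Rightarrow> 'z::real_normed_vector"
  proof -
    have "bounded (h ` {0..1})"
      by (intro compact_imp_bounded compact_continuous_image smooth_imp_continuous_on that compact_Icc)
    then show ?thesis unfolding bounded_iff by auto
  qed note bdd = this
  obtain R1 R2 M where R: "\<And>s. s \<in> {0..1} \<Longrightarrow> norm (path a s) \<le> R1" "\<And>s. s \<in> {0..1} \<Longrightarrow> norm (path a' s) \<le> R2"
    and M: "\<And>s. s \<in> {0..1} \<Longrightarrow> norm (w s) \<le> M"
    using bdd[OF path[of a]] bdd[OF path[of a']] bdd[OF sw] by blast
  define R where "R = max R1 R2"
  have M0: "M \<ge> 0" using M[of 0] norm_ge_zero[of "w 0"] by (simp del: norm_ge_zero)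
  obtain L where L: "\<And>b. L b \<ge> 0"
    "\<And>b x y. x \<in> cball 0 R \<Longrightarrow> y \<in> cball 0 R \<Longrightarrow> norm (P b x - P b y) \<le> L b * norm (x - y)"
    using smooth_lipschitz_cball[OF P(1), where R = R] by metis
  define K where "K = (\<Sum>b\<in>(Basis::('x \<times> 'y) set). M * L b)"
  have "path a 1 - path a' 1 = 0"
  proof (rule gronwall_unique[where r = "\<lambda>s. path a s - path a' s"])
    show "((\<lambda>s. path a s - path a' s) has_vector_derivative G s (path a s) - G s (path a' s)) (at s)" for s
      by (intro has_vector_derivative_diff der)
    show "path a 0 - path a' 0 = 0" using aa by (simp add: path_def)
    fix s :: real assume s: "s \<in> {0..1}"
    have in_ball: "path a s \<in> cball 0 R" "path a' s \<in> cball 0 R"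
      using R(1)[OF s] R(2)[OF s] by (auto simp: R_def)
    have "norm (G s (path a s) - G s (path a' s)) =
        norm (\<Sum>b\<in>Basis. (w s \<bullet> b) *\<^sub>R (P b (path a s) - P b (path a' s)))"
      by (simp add: G_def sum_subtractf scaleR_diff_right)
    also have "\<dots> \<le> (\<Sum>b\<in>Basis. M * L b * norm (path a s - path a' s))"
    proof (rule sum_norm_le)
      fix b :: "'x \<times> 'y" assume b: "b \<in> Basis"
      have "norm (w s \<bullet> b) * norm (P b (path a s) - P b (path a' s)) \<le> M * (L b * norm (path a s - path a' s))"
        using order_trans[OF Basis_le_norm[OF b] M[OF s]] M0 by (intro mult_mono L in_ball) auto
      then show "norm ((w s \<bullet> b) *\<^sub>R (P b (path a s) - P b (path a' s))) \<le> M * L b * norm (path a s - path a' s)"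
        by (simp add: mult.assoc)
    qed
    also have "\<dots> = K * norm (path a s - path a' s)" by (simp add: K_def sum_distrib_right)
    finally show "norm (G s (path a s) - G s (path a' s)) \<le> K * norm (path a s - path a' s)" .
  qed
  then show ?thesis by (simp add: path_def)
qed

subsection \<open>Saturation of the lifted kernel\<close>

lemma vf_apply_mult:
  assumes "smooth f" "smooth g"
  shows "vf_apply V (\<lambda>x. f x * g x) x = f x * vf_apply V g x + vf_apply V f x * g x"
proof -
  have "((\<lambda>x. f x * g x) has_derivative (\<lambda>h. f x * fderiv g x h + fderiv f x h * g x)) (at x)"
    by (intro has_derivative_mult smooth_has_derivative assms)
  from fun_cong[OF frechet_derivative_at[OF this], of "V x"] show ?thesis by (simp add: vf_apply_def)
qed

lemma vf_apply_mult_twice: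
  assumes f: "smooth f" and g: "smooth g" and V: "smooth V"
  shows "vf_apply V (vf_apply V (\<lambda>x. f x * g x)) x =
    f x * vf_apply V (vf_apply V g) x + 2 * (vf_apply V f x * vf_apply V g x) + vf_apply V (vf_apply V f) x * g x"
proof -
  have "vf_apply V (\<lambda>x. f x * g x) = (\<lambda>x. f x * vf_apply V g x + vf_apply V f x * g x)"
    by (rule ext) (rule vf_apply_mult[OF f g])
  then show ?thesis
    by (simp add: vf_apply_add vf_apply_mult f g V smooth_mult smooth_vf_apply algebra_simps)
qed

text \<open>Every summand but the first contains a derivative of \<open>g\<close>; these are the
  errors caused by a cutoff \<open>g\<close>.\<close>

lemma heat_op_mult:
  assumes f: "smooth f" and g: "smooth g" and X: "\<And>j. j < m \<Longrightarrow> smooth (X j)"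
  shows "heat_op X m (\<lambda>p. f p * g p) p = heat_op X m f p * g p - f p * dt g p +
    (\<Sum>j<m. 2 * (vf_apply (tvf (X j)) f p * vf_apply (tvf (X j)) g p) + f p * vf_apply (tvf (X j)) (vf_apply (tvf (X j)) g) p)"
proof -
  have "vf_apply (tvf (X j)) (vf_apply (tvf (X j)) (\<lambda>p. f p * g p)) p =
      vf_apply (tvf (X j)) (vf_apply (tvf (X j)) f) p * g p +
      (2 * (vf_apply (tvf (X j)) f p * vf_apply (tvf (X j)) g p) + f p * vf_apply (tvf (X j)) (vf_apply (tvf (X j)) g) p)"
    if "j < m" for j
    by (simp add: vf_apply_mult_twice[OF f g smooth_tvf[OF X[OF that]]] algebra_simps)
  then have "(\<Sum>j<m. vf_apply (tvf (X j)) (vf_apply (tvf (X j)) (\<lambda>p. f p * g p)) p) =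
      (\<Sum>j<m. vf_apply (tvf (X j)) (vf_apply (tvf (X j)) f) p) * g p +
      (\<Sum>j<m. 2 * (vf_apply (tvf (X j)) f p * vf_apply (tvf (X j)) g p) + f p * vf_apply (tvf (X j)) (vf_apply (tvf (X j)) g) p)"
    by (simp add: sum.distrib sum_distrib_right)
  then show ?thesis
    by (simp add: heat_op_def dt_def vf_apply_mult[OF f g] algebra_simps)
qed

definition strip_bounded :: "(real \<times> 'a::euclidean_space \<Rightarrow> real) \<Rightarrow> bool" where
  "strip_bounded h \<longleftrightarrow> (\<exists>B\<ge>0. \<exists>T>0. \<forall>p. \<bar>h p\<bar> \<le> B * indicator {-T..T} (fst p))"

lemma strip_bounded_compact:
  assumes K: "compact K" "\<And>p. p \<notin> K \<Longrightarrow> h p = 0" and B: "\<And>p. \<bar>h p\<bar> \<le> B"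
  shows "strip_bounded h"
proof -
  obtain R where R: "R > 0" "\<forall>x\<in>K. norm x \<le> R" using bounded_pos compact_imp_bounded[OF K(1)] by blast
  have B0: "B \<ge> 0" using order_trans[OF abs_ge_zero B] .
  have "\<bar>h p\<bar> \<le> B * indicator {-R..R} (fst p)" for p
  proof (cases "p \<in> K")
    case True
    then have "\<bar>fst p\<bar> \<le> R"
      using R(2) norm_fst_le[of "fst p" "snd p"] by (auto intro: order_trans)
    then show ?thesis using B[of p] by (simp add: indicator_def abs_le_iff)
  qed (use K(2) B0 in auto)
  then show ?thesis unfolding strip_bounded_def using R(1) B0 by blast
qed

lemma test_fun_strip_bounded: "test_fun h \<Longrightarrow> strip_bounded h"
  using test_fun_iff[of h] strip_bounded_compact test_fun_bounded by metis

lemma strip_bounded_add: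
  assumes "strip_bounded f" "strip_bounded g" shows "strip_bounded (\<lambda>p. f p + g p)"
proof -
  obtain B T where f: "B \<ge> 0" "T > 0" "\<And>p. \<bar>f p\<bar> \<le> B * indicator {-T..T} (fst p)"
    using assms(1) unfolding strip_bounded_def by blast
  obtain C S where g: "C \<ge> 0" "S > 0" "\<And>p. \<bar>g p\<bar> \<le> C * indicator {-S..S} (fst p)"
    using assms(2) unfolding strip_bounded_def by blast
  have "\<bar>f p + g p\<bar> \<le> (B + C) * indicator {- max T S..max T S} (fst p)" for p
  proof -
    have "\<bar>f p + g p\<bar> \<le> B * indicator {-T..T} (fst p) + C * indicator {-S..S} (fst p)"
      using f(3)[of p] g(3)[of p] by linarith
    also have "\<dots> \<le> B * indicator {- max T S..max T S} (fst p) + C * indicator {- max T S..max T S} (fst p)"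
      using f(1) g(1) by (intro add_mono mult_left_mono) (auto simp: indicator_def)
    finally show ?thesis by (simp add: distrib_right)
  qed
  then show ?thesis unfolding strip_bounded_def using f(1,2) g(1,2)
    by (intro exI[of _ "B + C"] conjI exI[of _ "max T S"] allI) auto
qed

lemma strip_bounded_mult_abs:
  assumes "strip_bounded f" shows "strip_bounded (\<lambda>p. c * \<bar>f p\<bar>)"
proof -
  obtain B T where f: "B \<ge> 0" "T > 0" "\<And>p. \<bar>f p\<bar> \<le> B * indicator {-T..T} (fst p)"
    using assms unfolding strip_bounded_def by blast
  have "\<bar>c * \<bar>f p\<bar>\<bar> \<le> (\<bar>c\<bar> * B) * indicator {-T..T} (fst p)" for p
    using mult_left_mono[OF f(3)[of p] abs_ge_zero[of c]] by (simp add: abs_mult mult.assoc)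
  then show ?thesis unfolding strip_bounded_def using f(1,2)
    by (intro exI[of _ "\<bar>c\<bar> * B"] conjI exI[of _ T] allI) auto
qed

lemma strip_bounded_sum:
  "(\<And>i. i \<in> I \<Longrightarrow> strip_bounded (F i)) \<Longrightarrow> strip_bounded (\<lambda>p. \<Sum>i\<in>I. F i p)"
proof (induction I rule: infinite_finite_induct)
  case (insert i I)
  then show ?case by (auto intro: strip_bounded_add)
qed (simp_all add: test_fun_strip_bounded[OF test_fun_zero])

locale lifted_heat_kernel = homogeneous_heat_kernel star ginv d D Z m \<gamma>
  for star :: "'x::euclidean_space \<times> 'y::euclidean_space \<Rightarrow> 'x \<times> 'y \<Rightarrow> 'x \<times> 'y"
    and ginv d D Z m and \<gamma> :: "real \<times> 'x \<times> 'y \<Rightarrow> real" +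
  fixes X :: "nat \<Rightarrow> 'x \<Rightarrow> 'x"
  assumes X_smooth: "j < m \<Longrightarrow> smooth (X j)"
    and Z_fst: "j < m \<Longrightarrow> fst (Z j u) = X j (fst u)"
    and fst_star: "fst a = fst a' \<Longrightarrow> fst (star a c) = fst (star a' c)"
begin

abbreviation base_proj :: "real \<times> 'x \<times> 'y \<Rightarrow> real \<times> 'x" where
  "base_proj p \<equiv> (fst p, fst (snd p))"

lemma smooth_base_proj: "smooth base_proj"
  by (intro smooth_Pair smooth_fst smooth_snd smooth_id)

lemma vf_apply_base_proj:
  assumes f: "smooth f" and j: "j < m"
  shows "vf_apply (tvf (Z j)) (\<lambda>p. f (base_proj p)) = (\<lambda>p. vf_apply (tvf (X j)) f (base_proj p))"
proof
  fix p
  have "(base_proj has_derivative base_proj) (at p)"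
    by (auto intro!: derivative_eq_intros)
  from frechet_derivative_compose'[OF f this, of "tvf (Z j) p"]
  show "vf_apply (tvf (Z j)) (\<lambda>p. f (base_proj p)) p = vf_apply (tvf (X j)) f (base_proj p)"
    by (simp add: vf_apply_def tvf_def split_beta Z_fst[OF j])
qed

lemma heat_op_base_proj:
  assumes f: "smooth f"
  shows "heat_op Z m (\<lambda>p. f (base_proj p)) p = heat_op X m f (base_proj p)"
proof -
  have "(base_proj has_derivative base_proj) (at p)"
    by (auto intro!: derivative_eq_intros)
  from frechet_derivative_compose'[OF f this, of "(1, 0)"]
  have "dt (\<lambda>p. f (base_proj p)) p = dt f (base_proj p)"
    by (simp add: dt_def vf_apply_def)
  moreover have "vf_apply (tvf (Z j)) (vf_apply (tvf (Z j)) (\<lambda>p. f (base_proj p))) p =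
      vf_apply (tvf (X j)) (vf_apply (tvf (X j)) f) (base_proj p)" if j: "j < m" for j
    using vf_apply_base_proj[OF smooth_vf_apply[OF smooth_tvf[OF X_smooth[OF j]] f] j]
    by (simp add: vf_apply_base_proj[OF f j])
  ultimately show ?thesis by (simp add: heat_op_def)
qed

text \<open>Each application of \<open>Z j\<close> to a dilated function produces one factor
  \<open>r\<close>, which removes the derivatives of the cutoff in the limit.\<close>

lemma vf_apply_dilation:
  assumes f: "smooth f" and j: "j < m" and r: "r > 0"
  shows "vf_apply (Z j) (\<lambda>a. f (D r a)) = (\<lambda>a. r * vf_apply (Z j) f (D r a))"
proof
  fix a
  have "(D r has_derivative D r) (at a)"
    using linear_D linear_conv_bounded_linear bounded_linear_imp_has_derivative by blast
  from frechet_derivative_compose'[OF f this, of "Z j a"]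
  show "vf_apply (Z j) (\<lambda>a. f (D r a)) a = r * vf_apply (Z j) f (D r a)"
    using linear_scale[OF linear_frechet_derivative[OF f]]
    by (simp add: vf_apply_def Z_hom[OF j r])
qed

lemma vf_apply_dilation_twice:
  assumes f: "smooth f" and j: "j < m" and r: "r > 0"
  shows "vf_apply (Z j) (vf_apply (Z j) (\<lambda>a. f (D r a))) a = r * r * vf_apply (Z j) (vf_apply (Z j) f) (D r a)"
proof -
  have s: "smooth (vf_apply (Z j) f)" by (intro smooth_vf_apply Z_smooth j f)
  then have "vf_apply (Z j) (\<lambda>a. r * vf_apply (Z j) f (D r a)) a = r * vf_apply (Z j) (\<lambda>a. vf_apply (Z j) f (D r a)) a"
    using vf_apply_mult[OF smooth_const[of r] smooth_compose[OF s smooth_D[OF smooth_id]], of "Z j" r a]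
      vf_apply_mult[OF smooth_const[of r] smooth_const[of 1], of "Z j" a]
    by (simp add: vf_apply_def frechet_derivative_const)
  then show ?thesis
    unfolding vf_apply_dilation[OF f j r] by (simp add: vf_apply_dilation[OF s j r])
qed

text \<open>A function of the base variables alone has no compact support on the lifted space unless
  it vanishes, so \<open>potential_heat_op\<close> is applied to cut-off versions, at the point
  \<open>(t, (x, 0))\<close>.\<close>

lemma potential_saturated:
  assumes \<phi>: "test_fun \<phi>"
  shows "(\<integral>q. heat_op X m \<phi> (t - fst q, fst (star (x, 0) (ginv (snd q)))) * \<gamma> q \<partial>lborel) = - \<phi> (t, x)"
proof -
  let ?X\<phi> = "\<lambda>j. vf_apply (tvf (X j)) \<phi>"
  define r where "r k = 1 / real (Suc k)" for k
  have r: "r k > 0" "r k \<le> 1" for k by (simp_all add: r_def)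
  have r0: "r \<longlonglongrightarrow> 0" unfolding r_def[abs_def] using LIMSEQ_inverse_real_of_nat by (simp add: inverse_eq_divide)
  have rD: "(\<lambda>k. D (r k) a) \<longlonglongrightarrow> 0" for a
  proof -
    have "filterlim r (at_right 0) sequentially"
      unfolding filterlim_at using r(1) r0 by (auto intro!: always_eventually simp: less_le)
    from filterlim_compose[OF D_tendsto_0 this] show ?thesis .
  qed
  note s\<phi> = test_fun_smooth[OF \<phi>]
  define \<theta> :: "'x \<times> 'y \<Rightarrow> real" where "\<theta> = cutoff"
  let ?Z\<theta> = "\<lambda>j. vf_apply (Z j) \<theta>" and ?ZZ\<theta> = "\<lambda>j. vf_apply (Z j) (vf_apply (Z j) \<theta>)"
  have \<theta>: "test_fun \<theta>" "smooth \<theta>" unfolding \<theta>_def by (rule test_fun_cutoff smooth_cutoff)+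
  define u where "u k p = \<phi> (base_proj p) * \<theta> (D (r k) (snd p))" for k p
  have s\<theta>: "smooth (\<lambda>p::real \<times> 'x \<times> 'y. \<theta> (D (r k) (snd p)))" for k
    by (intro smooth_compose[OF \<theta>(2)] smooth_D smooth_snd smooth_id)
  have s\<Phi>: "smooth (\<lambda>p. \<phi> (base_proj p))" by (rule smooth_compose[OF s\<phi> smooth_base_proj])
  have u: "test_fun (u k)" for k
  proof -
    obtain K where K: "compact K" "\<And>p. p \<notin> K \<Longrightarrow> \<phi> p = 0" using \<phi> test_fun_iff by metis
    let ?h = "\<lambda>z::(real \<times> 'x) \<times> ('x \<times> 'y). (fst (fst z), D (1 / r k) (snd z))"
    have "smooth ?h" by (intro smooth_Pair smooth_D smooth_fst smooth_snd smooth_id)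
    then have c: "compact (?h ` (K \<times> cball 0 1))"
      by (intro compact_continuous_image smooth_imp_continuous_on compact_Times compact_cball K)
    have "u k p = 0" if p: "p \<notin> ?h ` (K \<times> cball 0 1)" for p
    proof (rule ccontr)
      assume "u k p \<noteq> 0"
      then have "base_proj p \<in> K" "\<theta> (D (r k) (snd p)) \<noteq> 0" using K(2) by (auto simp: u_def)
      moreover from this have "\<not> 1 \<le> norm (D (r k) (snd p))"
        using cutoff_eq_0 unfolding \<theta>_def by blast
      ultimately have "base_proj p \<in> K" "D (r k) (snd p) \<in> cball 0 1" by simp_all
      then have "(base_proj p, D (r k) (snd p)) \<in> K \<times> cball 0 1" by (rule SigmaI)
      moreover have "p = ?h (base_proj p, D (r k) (snd p))"
        using D_inverse[of "1 / r k" "snd p"] r(1)[of k] by simp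
      ultimately have "p \<in> ?h ` (K \<times> cball 0 1)" by (rule image_eqI[rotated])
      with p show False by contradiction
    qed
    moreover have "smooth (u k)" unfolding u_def[abs_def] by (intro smooth_mult s\<Phi> s\<theta>)
    ultimately show ?thesis using c unfolding test_fun_iff by blast
  qed
  \<comment> \<open>The errors of the product rule: each carries \<open>r k\<close> or its square,
    hence tends to 0, and \<open>r k \<le> 1\<close> keeps it bounded.\<close>
  define E where "E j k p = 2 * (?X\<phi> j (base_proj p) * (r k * ?Z\<theta> j (D (r k) (snd p)))) +
      \<phi> (base_proj p) * (r k * r k * ?ZZ\<theta> j (D (r k) (snd p)))" for j k p
  have Hu: "heat_op Z m (u k) p = heat_op X m \<phi> (base_proj p) * \<theta> (D (r k) (snd p)) + (\<Sum>j<m. E j k p)" for k p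
  proof -
    obtain s a where p: "p = (s, a)" by (cases p)
    have "((\<lambda>s. \<theta> (D (r k) (snd (s, a)))) has_real_derivative dt (\<lambda>p. \<theta> (D (r k) (snd p))) (s, a)) (at s)"
      by (rule dt_has_derivative[OF s\<theta>])
    moreover have "((\<lambda>s. \<theta> (D (r k) (snd (s, a)))) has_real_derivative 0) (at s)" by simp
    ultimately have dt0: "dt (\<lambda>p. \<theta> (D (r k) (snd p))) p = 0" unfolding p by (rule DERIV_unique)
    have "vf_apply (tvf (Z j)) (\<lambda>p. \<theta> (D (r k) (snd p))) p = r k * ?Z\<theta> j (D (r k) (snd p))" if "j < m" for j
      unfolding p vf_apply_tvf[OF s\<theta>] by (simp add: vf_apply_dilation[OF \<theta>(2) that r(1)])
    moreover have "vf_apply (tvf (Z j)) (vf_apply (tvf (Z j)) (\<lambda>p. \<theta> (D (r k) (snd p)))) p =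
        r k * r k * ?ZZ\<theta> j (D (r k) (snd p))" if "j < m" for j
      unfolding p vf_apply_tvf_twice[OF s\<theta> Z_smooth[OF that]] by (simp add: vf_apply_dilation_twice[OF \<theta>(2) that r(1)])
    ultimately show ?thesis
      using heat_op_mult[where f = "\<lambda>p. \<phi> (base_proj p)" and g = "\<lambda>p. \<theta> (D (r k) (snd p))" and X = Z
          and m = m and p = p, OF s\<Phi> s\<theta> Z_smooth]
      by (simp add: u_def[abs_def] dt0 heat_op_base_proj[OF s\<phi>] vf_apply_base_proj[OF s\<phi>] E_def)
  qed
  have Z\<theta>: "test_fun (?Z\<theta> j)" "test_fun (?ZZ\<theta> j)" if "j < m" for j
    by (intro test_fun_vf_apply \<theta> Z_smooth that)+
  have "\<exists>c1 c2. (j < m \<longrightarrow> (\<forall>a. \<bar>?Z\<theta> j a\<bar> \<le> c1) \<and> (\<forall>a. \<bar>?ZZ\<theta> j a\<bar> \<le> c2))" for j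
    using test_fun_bounded Z\<theta>[of j] by metis
  then obtain c1 c2 where c1: "\<And>j a. j < m \<Longrightarrow> \<bar>?Z\<theta> j a\<bar> \<le> c1 j"
    and c2: "\<And>j a. j < m \<Longrightarrow> \<bar>?ZZ\<theta> j a\<bar> \<le> c2 j" by metis
  \<comment> \<open>A majorant in the base variables, independent of \<open>k\<close>; the compact
    support of \<open>\<phi>\<close> confines it to a strip in time.\<close>
  define S where "S p = 1 * \<bar>heat_op X m \<phi> p\<bar> + (\<Sum>j<m. (2 * c1 j) * \<bar>?X\<phi> j p\<bar> + c2 j * \<bar>\<phi> p\<bar>)" for p
  have "strip_bounded S"
    unfolding S_def[abs_def]
    by (intro strip_bounded_add strip_bounded_sum strip_bounded_mult_abs test_fun_strip_bounded test_fun_heat_op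
        test_fun_vf_apply smooth_tvf X_smooth \<phi>) auto
  then obtain B T where BT: "B \<ge> 0" "T > 0" "\<And>p. \<bar>S p\<bar> \<le> B * indicator {-T..T} (fst p)"
    unfolding strip_bounded_def by blast
  have dom: "\<bar>heat_op Z m (u k) p\<bar> \<le> S (base_proj p)" for k p
  proof -
    have "\<bar>E j k p\<bar> \<le> (2 * c1 j) * \<bar>?X\<phi> j (base_proj p)\<bar> + c2 j * \<bar>\<phi> (base_proj p)\<bar>" if j: "j < m" for j
    proof -
      have "\<bar>r k * ?Z\<theta> j (D (r k) (snd p))\<bar> \<le> 1 * c1 j"
        unfolding abs_mult using r[of k] c1[OF j] by (intro mult_mono) auto
      moreover have "\<bar>r k * r k * ?ZZ\<theta> j (D (r k) (snd p))\<bar> \<le> 1 * c2 j"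
        unfolding abs_mult using r[of k] c2[OF j] by (intro mult_mono) (auto intro: mult_le_one)
      ultimately have "\<bar>?X\<phi> j (base_proj p) * (r k * ?Z\<theta> j (D (r k) (snd p)))\<bar> \<le>
          \<bar>?X\<phi> j (base_proj p)\<bar> * c1 j"
        "\<bar>\<phi> (base_proj p) * (r k * r k * ?ZZ\<theta> j (D (r k) (snd p)))\<bar> \<le> \<bar>\<phi> (base_proj p)\<bar> * c2 j"
        unfolding abs_mult[of "?X\<phi> j (base_proj p)"] abs_mult[of "\<phi> (base_proj p)"]
        by (auto intro!: mult_left_mono)
      then show ?thesis unfolding E_def by (simp add: algebra_simps)
    qed
    then have "\<bar>\<Sum>j<m. E j k p\<bar> \<le> (\<Sum>j<m. (2 * c1 j) * \<bar>?X\<phi> j (base_proj p)\<bar> + c2 j * \<bar>\<phi> (base_proj p)\<bar>)"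
      by (intro order_trans[OF sum_abs sum_mono]) auto
    moreover have "\<bar>heat_op X m \<phi> (base_proj p) * \<theta> (D (r k) (snd p))\<bar> \<le> \<bar>heat_op X m \<phi> (base_proj p)\<bar> * 1"
      unfolding abs_mult by (intro mult_left_mono) (auto simp: \<theta>_def cutoff_le_1 cutoff_nonneg)
    ultimately show ?thesis unfolding Hu S_def by linarith
  qed
  have domB: "\<bar>heat_op Z m (u k) p\<bar> \<le> B * indicator {-T..T} (fst p)" for k p
    using order_trans[OF dom order_trans[OF abs_ge_self BT(3)], of k p] by simp
  have lim: "(\<lambda>k. heat_op Z m (u k) p) \<longlonglongrightarrow> heat_op X m \<phi> (base_proj p)" for p
  proof -
    have cont: "(\<lambda>k. f (D (r k) (snd p))) \<longlonglongrightarrow> f 0" if "smooth f" for f :: "'x \<times> 'y \<Rightarrow> real"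
      by (rule isCont_tendsto_compose[OF smooth_isCont[OF that] rD])
    have "(\<lambda>k. heat_op Z m (u k) p) \<longlonglongrightarrow> heat_op X m \<phi> (base_proj p) * \<theta> 0 +
        (\<Sum>j<m. 2 * (?X\<phi> j (base_proj p) * (0 * ?Z\<theta> j 0)) +
          \<phi> (base_proj p) * (0 * 0 * ?ZZ\<theta> j 0))"
      unfolding Hu E_def by (intro tendsto_intros r0 cont \<theta> test_fun_smooth Z\<theta>) auto
    then show ?thesis by (simp add: \<theta>_def)
  qed
  let ?p = "(t, (x, 0::'y))"
  let ?H = "\<lambda>q. heat_op X m \<phi> (t - fst q, fst (star (x, 0) (ginv (snd q))))"
  have gm [measurable]: "\<gamma> \<in> borel_measurable borel" by (rule loc_integrable_borel_measurable[OF gamma_loc])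
  have "(\<lambda>k. \<integral>q. right_shift (heat_op Z m (u k)) (?p, q) * \<gamma> q \<partial>lborel) \<longlonglongrightarrow> (\<integral>q. ?H q * \<gamma> q \<partial>lborel)"
  proof (rule integral_dominated_convergence)
    have "smooth ?H"
      by (intro smooth_compose[OF test_fun_smooth[OF test_fun_heat_op[OF X_smooth \<phi>]]] smooth_Pair smooth_diff smooth_const
          smooth_fst smooth_star smooth_ginv smooth_snd smooth_id)
    then have [measurable]: "?H \<in> borel_measurable borel"
      by (intro smooth_borel_measurable)
    show "(\<lambda>q. ?H q * \<gamma> q) \<in> borel_measurable lborel" by simp
    show "(\<lambda>q. right_shift (heat_op Z m (u k)) (?p, q) * \<gamma> q) \<in> borel_measurable lborel" for k
      by (intro borel_measurable_integrable test_fun_mult_integrable locally_compact_support_test_fun smooth_right_shift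
          locally_compact_support_right_shift gamma_loc test_fun_smooth test_fun_heat_op Z_smooth u)
    \<comment> \<open>If \<open>|t - s| \<le> T\<close>, then \<open>|s| \<le> T + |t|\<close>: this
      is the strip for the variable of integration.\<close>
    show "integrable lborel (\<lambda>q. B * \<bar>indicator {-(T + \<bar>t\<bar>)..T + \<bar>t\<bar>} (fst q) * \<gamma> q\<bar>)"
      using BT(2) by (intro integrable_mult_right integrable_abs gamma_strip_integrable) auto
    show "AE q in lborel. (\<lambda>k. right_shift (heat_op Z m (u k)) (?p, q) * \<gamma> q) \<longlonglongrightarrow> ?H q * \<gamma> q"
    proof (rule AE_I2)
      fix q
      show "(\<lambda>k. right_shift (heat_op Z m (u k)) (?p, q) * \<gamma> q) \<longlonglongrightarrow> ?H q * \<gamma> q"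
        using lim[of "(t - fst q, star (x, 0) (ginv (snd q)))"] unfolding right_shift_def by (intro tendsto_intros) simp
    qed
    show "AE q in lborel. norm (right_shift (heat_op Z m (u k)) (?p, q) * \<gamma> q) \<le>
        B * \<bar>indicator {-(T + \<bar>t\<bar>)..T + \<bar>t\<bar>} (fst q) * \<gamma> q\<bar>" for k
    proof (rule AE_I2)
      fix q :: "real \<times> 'x \<times> 'y"
      have "\<bar>right_shift (heat_op Z m (u k)) (?p, q)\<bar> \<le> B * indicator {-T..T} (t - fst q)"
        using domB[of k "(t - fst q, star (x, 0) (ginv (snd q)))"] by (simp add: right_shift_def)
      also have "\<dots> \<le> B * indicator {-(T + \<bar>t\<bar>)..T + \<bar>t\<bar>} (fst q)"
        using BT(1) by (intro mult_left_mono) (auto simp: indicator_def)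
      finally have "\<bar>right_shift (heat_op Z m (u k)) (?p, q)\<bar> \<le> B * indicator {-(T + \<bar>t\<bar>)..T + \<bar>t\<bar>} (fst q)" .
      from mult_right_mono[OF this abs_ge_zero[of "\<gamma> q"]]
      show "norm (right_shift (heat_op Z m (u k)) (?p, q) * \<gamma> q) \<le> B * \<bar>indicator {-(T + \<bar>t\<bar>)..T + \<bar>t\<bar>} (fst q) * \<gamma> q\<bar>"
        by (simp add: abs_mult mult.assoc)
    qed
  qed
  moreover have "(\<integral>q. right_shift (heat_op Z m (u k)) (?p, q) * \<gamma> q \<partial>lborel) = - u k ?p" for k
    using potential_heat_op[OF u[of k], of ?p] unfolding potential_def .
  moreover have "(\<lambda>k. - u k ?p) \<longlonglongrightarrow> - (\<phi> (t, x) * 1)"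
  proof -
    have "(\<lambda>k. \<theta> (D (r k) (snd ?p))) \<longlonglongrightarrow> \<theta> 0" by (rule isCont_tendsto_compose[OF smooth_isCont[OF \<theta>(2)] rD])
    then have "(\<lambda>k. - (\<phi> (base_proj ?p) * \<theta> (D (r k) (snd ?p)))) \<longlonglongrightarrow> - (\<phi> (base_proj ?p) * \<theta> 0)"
      by (intro tendsto_intros)
    then show ?thesis by (simp add: u_def \<theta>_def)
  qed
  ultimately show ?thesis using LIMSEQ_unique by fastforce
qed

end

section \<open>The volume-preserving substitution\<close>

lemma lborel_distr_assoc:
  "distr lborel borel (\<lambda>z::('a::euclidean_space \<times> 'b::euclidean_space) \<times> 'c::euclidean_space.
     (fst (fst z), (snd (fst z), snd z))) = lborel"
proof (rule lborel_distr_basis_bij)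
  let ?T = "\<lambda>z::('a \<times> 'b) \<times> 'c. (fst (fst z), (snd (fst z), snd z))"
  show "linear ?T" by (rule linearI) auto
  have "inj ?T" by (auto simp: inj_def)
  moreover have "?T ` Basis = Basis"
    by (simp add: Basis_prod_def image_Un image_image Un_assoc zero_prod_def)
  ultimately show "bij_betw ?T Basis Basis" by (auto simp: bij_betw_def intro: inj_on_subset)
qed

context lifted_heat_kernel
begin

text \<open>Elements of \<open>{x} \<times> 'y\<close> form one coset of the isotropy group \<open>{0} \<times> 'y\<close>; this is why the
  map is injective.\<close>

definition saturation :: "'x \<Rightarrow> 'x \<times> 'y \<Rightarrow> 'x \<times> 'y" where
  "saturation x u = star (ginv (fst u, 0)) (x, snd u)"

text \<open>In the first component \<open>(x, 0)\<close> may be replaced by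
  \<open>(x, snd u)\<close>, and then the product telescopes to \<open>(fst u, 0)\<close>. The base
  point is thus recovered from the group variable, which identifies the integrand after the
  substitution.\<close>

lemma fst_star_saturation: "fst (star (x, 0) (ginv (saturation x u))) = fst u"
proof -
  have "ginv (saturation x u) = star (ginv (x, snd u)) (fst u, 0)"
    by (simp add: saturation_def ginv_star)
  moreover have "fst (star (x, 0) (star (ginv (x, snd u)) (fst u, 0))) =
      fst (star (x, snd u) (star (ginv (x, snd u)) (fst u, 0)))"
    by (rule fst_star) simp
  ultimately show ?thesis by simp
qed

lemma bij_saturation: "bij (saturation x)"
proof (rule o_bij)
  \<comment> \<open>The first component \<open>y\<close> is recovered as before; the second is read
    off from \<open>star (y, 0) c = (x, \<eta>)\<close>.\<close>
  let ?g = "\<lambda>c. (fst (star (x, 0) (ginv c)), snd (star (fst (star (x, 0) (ginv c)), 0) c))"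
  show "?g \<circ> saturation x = id"
  proof
    fix u
    show "(?g \<circ> saturation x) u = id u"
      unfolding o_def fst_star_saturation by (simp add: saturation_def)
  qed
  show "saturation x \<circ> ?g = id"
  proof
    fix c
    let ?y = "fst (star (x, 0) (ginv c))"
    have "fst (star (?y, 0) c) = fst (star (star (x, 0) (ginv c)) c)" by (rule fst_star) simp
    then have "(x, snd (star (?y, 0) c)) = star (?y, 0) c" by (simp add: star_assoc prod_eq_iff)
    then show "(saturation x \<circ> ?g) c = id c" by (simp add: saturation_def)
  qed
qed

text \<open>The parameter \<open>x\<close> becomes the first component of a group element, so that
  the same \<open>D\<close> dilates it and the variable, as the volume criterion requires.\<close>

lemma smooth_saturation_map: "smooth (\<lambda>p::('x \<times> 'y) \<times> ('x \<times> 'y). saturation (fst (fst p)) (snd p))"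
  unfolding saturation_def[abs_def]
  by (intro smooth_star smooth_ginv smooth_Pair smooth_fst smooth_snd smooth_const smooth_id)

lemma smooth_saturation: "smooth (saturation x)"
  using smooth_slice_snd[OF smooth_saturation_map, of "(x, 0)"] by simp

lemma lborel_distr_saturation: "distr lborel borel (saturation x) = lborel"
proof -
  let ?\<Psi> = "\<lambda>p::('x \<times> 'y) \<times> ('x \<times> 'y). saturation (fst (fst p)) (snd p)"
  note sm = smooth_saturation_map
  have fst_D: "fst (D r u) = fst (D r u')" if "fst u = fst u'" for r u u'
  proof (rule euclidean_eqI)
    fix i :: 'x assume "i \<in> Basis"
    then have b: "(i, 0::'y) \<in> Basis" by (simp add: Basis_prod_def)
    have "fst v \<bullet> i = v \<bullet> (i, 0::'y)" for v by (simp add: inner_prod_def)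
    then show "fst (D r u) \<bullet> i = fst (D r u') \<bullet> i" using that by (simp only: D_inner[OF b]) (metis)
  qed
  have snd_D: "snd (D r u) = snd (D r u')" if "snd u = snd u'" for r u u'
  proof (rule euclidean_eqI)
    fix j :: 'y assume "j \<in> Basis"
    then have b: "(0::'x, j) \<in> Basis" by (simp add: Basis_prod_def)
    have "snd v \<bullet> j = v \<bullet> (0::'x, j)" for v by (simp add: inner_prod_def)
    then show "snd (D r u) \<bullet> j = snd (D r u') \<bullet> j" using that by (simp only: D_inner[OF b]) (metis)
  qed
  have D_fst: "D r (fst u, 0) = (fst (D r u), 0)" for r u
    using fst_D[of "(fst u, 0)" u] snd_D[of "(fst u, 0)" 0] by (simp add: prod_eq_iff)
  have D_mix: "D r (fst p, snd u) = (fst (D r p), snd (D r u))" for r p u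
    using fst_D[of "(fst p, snd u)" p] snd_D[of "(fst p, snd u)" u] by (simp add: prod_eq_iff)
  \<comment> \<open>At the origin the derivative reflects the first component and fixes the second;
    being an involution, it has determinant 1 in absolute value.\<close>
  have der: "fderiv ?\<Psi> (0, 0) (0, v) = (- fst v, snd v)" for v
  proof -
    have 1: "((\<lambda>u::'x \<times> 'y. (fst u, 0::'y)) has_derivative (\<lambda>v. (fst v, 0))) (at 0)"
      by (auto intro!: derivative_eq_intros)
    have "fderiv ginv 0 = uminus" by (rule ext) (rule ginv_derivative_0)
    then have 2: "(ginv has_derivative uminus) (at (fst (0::'x \<times> 'y), 0))"
      using smooth_has_derivative[OF ginv_smooth, of 0] by (simp add: zero_prod_def[symmetric])
    have "((\<lambda>u::'x \<times> 'y. ginv (fst u, 0)) has_derivative (\<lambda>v. - (fst v, 0))) (at 0)"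
      using diff_chain_at[OF 1 2] by (simp only: o_def)
    moreover have "((\<lambda>u::'x \<times> 'y. (0::'x, snd u)) has_derivative (\<lambda>v. (0, snd v))) (at 0)"
      by (auto intro!: derivative_eq_intros)
    ultimately have "((\<lambda>u::'x \<times> 'y. (ginv (fst u, 0), (0::'x, snd u))) has_derivative (\<lambda>v. (- (fst v, 0), (0, snd v)))) (at 0)"
      by (rule has_derivative_Pair)
    from frechet_derivative_compose'[OF star_smooth this, of v]
    have "fderiv (saturation 0) 0 v = (- fst v, snd v)"
      by (simp add: saturation_def[abs_def] star_derivative_0[folded zero_prod_def] zero_prod_def[symmetric])
    then show ?thesis using frechet_derivative_snd[OF sm, of "0" 0 v] by simp
  qed
  have "distr lborel borel (\<lambda>u. ?\<Psi> ((x, 0), u)) = lborel"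
  proof (rule equivariant_volume_preserving[OF sm])
    show "?\<Psi> (D r p, D r u) = D r (?\<Psi> (p, u))" if "r > 0" for r p u
      using that by (simp add: saturation_def D_star D_ginv D_fst[symmetric] D_mix)
    show "bij (\<lambda>u. ?\<Psi> ((x, 0), u))" using bij_saturation by simp
    show "\<bar>eucl_det (\<lambda>v. fderiv ?\<Psi> (0, 0) (0, v))\<bar> = 1"
      unfolding der by (rule eucl_det_involution) (auto intro!: linearI)
  qed
  then show ?thesis by simp
qed

text \<open>This is \<open>\<Gamma>\<close> with first argument \<open>\<zeta>\<close> and second
  argument \<open>z\<close>. The inverted group element carries the base point of
  \<open>\<zeta>\<close>, over which the test function is integrated.\<close>

definition saturated_kernel :: "real \<times> 'x \<Rightarrow> real \<times> 'x \<Rightarrow> real" where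
  "saturated_kernel \<zeta> z = (\<integral>\<eta>. \<gamma> (fst z - fst \<zeta>, saturation (snd z) (snd \<zeta>, \<eta>)) \<partial>lborel)"

text \<open>The argument of \<open>\<gamma>\<close> as a function of all integration variables
  \<open>((s, y), \<eta>)\<close>, whose number is that of time and group together.\<close>

definition saturation_pull :: "real \<times> 'x \<Rightarrow> (real \<times> 'x) \<times> 'y \<Rightarrow> real \<times> 'x \<times> 'y" where
  "saturation_pull z w = (fst z - fst (fst w), saturation (snd z) (snd (fst w), snd w))"

lemma saturation_pull_measurable: "saturation_pull z \<in> borel_measurable borel"
proof -
  have "smooth (saturation_pull z)"
    unfolding saturation_pull_def[abs_def]
    by (intro smooth_Pair smooth_diff smooth_const smooth_fst smooth_snd smooth_id smooth_compose[OF smooth_saturation])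
  then show ?thesis by (intro smooth_borel_measurable)
qed

lemma lborel_distr_saturation_pull: "distr lborel borel (saturation_pull z) = lborel"
proof -
  let ?A = "\<lambda>w::(real \<times> 'x) \<times> 'y. (fst (fst w), (snd (fst w), snd w))"
  let ?h = "\<lambda>q. (fst z - fst q, saturation (snd z) (snd q))"
  have sm: "saturation (snd z) \<in> borel_measurable borel"
    by (intro smooth_borel_measurable smooth_saturation)
  have h: "?h \<in> borel_measurable borel"
    by (intro smooth_borel_measurable smooth_Pair smooth_diff smooth_const
        smooth_fst smooth_snd smooth_id smooth_compose[OF smooth_saturation])
  have A: "?A \<in> borel_measurable borel"
    by (intro borel_measurable_continuous_onI continuous_intros)
  have "distr lborel borel (saturation_pull z) = distr lborel borel (?h \<circ> ?A)"
    by (simp add: saturation_pull_def[abs_def] o_def)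
  also have "\<dots> = distr (distr lborel borel ?A) borel ?h"
    using h A by (subst distr_distr) auto
  also have "\<dots> = lborel"
    unfolding lborel_distr_assoc by (rule lborel_distr_time_reflect[OF sm lborel_distr_saturation])
  finally show ?thesis .
qed

lemma saturation_pull_integrable:
  assumes f: "f \<in> borel_measurable borel" and b: "strip_bounded f"
  shows "integrable lborel (\<lambda>w. f (fst w) * \<gamma> (saturation_pull z w))"
proof -
  obtain B T where BT: "B \<ge> 0" "T > 0" "\<And>p. \<bar>f p\<bar> \<le> B * indicator {-T..T} (fst p)"
    using b unfolding strip_bounded_def by blast
  note [measurable] = saturation_pull_measurable[of z] loc_integrable_borel_measurable[OF gamma_loc] f
  \<comment> \<open>Time is sent to \<open>fst z - s\<close>, so a strip of half-width
    \<open>T\<close> lands in one of half-width \<open>T + |fst z|\<close>.\<close>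
  define S where "S = T + \<bar>fst z\<bar>"
  have "integrable (distr lborel borel (saturation_pull z)) (\<lambda>q. indicator {-S..S} (fst q) * \<gamma> q)"
    unfolding lborel_distr_saturation_pull by (rule gamma_strip_integrable) (use BT in \<open>simp add: S_def\<close>)
  then have int: "integrable lborel (\<lambda>w. indicator {-S..S} (fst (saturation_pull z w)) * \<gamma> (saturation_pull z w))"
    by (rule integrable_distr[rotated]) simp
  show ?thesis
  proof (rule Bochner_Integration.integrable_bound)
    show "integrable lborel (\<lambda>w. B * (indicator {-S..S} (fst (saturation_pull z w)) * \<gamma> (saturation_pull z w)))"
      using int by (rule integrable_mult_right)
    have "(\<lambda>w::(real \<times> 'x) \<times> 'y. f (fst w)) \<in> borel_measurable borel"
      by (rule measurable_compose[OF _ f]) (rule borel_measurable_continuous_onI[OF continuous_on_fst[OF continuous_on_id]])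
    then show "(\<lambda>w. f (fst w) * \<gamma> (saturation_pull z w)) \<in> borel_measurable lborel" by simp
    have "norm (f (fst w) * \<gamma> (saturation_pull z w)) \<le>
        norm (B * (indicator {-S..S} (fst (saturation_pull z w)) * \<gamma> (saturation_pull z w)))" for w
    proof -
      have "\<bar>f (fst w)\<bar> \<le> B * indicator {-T..T} (fst (fst w))" by (rule BT)
      also have "\<dots> \<le> B * indicator {-S..S} (fst (saturation_pull z w))"
        using BT(1) by (intro mult_left_mono) (auto simp: indicator_def saturation_pull_def S_def)
      finally have "\<bar>f (fst w)\<bar> \<le> B * indicator {-S..S} (fst (saturation_pull z w))" .
      from mult_right_mono[OF this abs_ge_zero] show ?thesis
        using BT(1) by (simp add: abs_mult mult.assoc)
    qed
    then show "AE w in lborel. norm (f (fst w) * \<gamma> (saturation_pull z w)) \<le>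
        norm (B * (indicator {-S..S} (fst (saturation_pull z w)) * \<gamma> (saturation_pull z w)))" by simp
  qed
qed

text \<open>Integrability in \<open>(\<zeta>, \<eta>)\<close> lets Fubini's theorem do both: the
  fibre integral becomes an integrable function of \<open>\<zeta>\<close>, and the two integrations
  merge.\<close>

lemma
  assumes f: "f \<in> borel_measurable borel" and b: "strip_bounded f"
  shows saturated_kernel_integrable: "integrable lborel (\<lambda>\<zeta>. f \<zeta> * saturated_kernel \<zeta> z)" (is ?A)
    and saturated_kernel_integral: "(\<integral>\<zeta>. f \<zeta> * saturated_kernel \<zeta> z \<partial>lborel) =
      (\<integral>w. f (fst w) * \<gamma> (saturation_pull z w) \<partial>lborel)" (is ?B)
proof -
  have int: "integrable (lborel \<Otimes>\<^sub>M lborel) (\<lambda>w. f (fst w) * \<gamma> (saturation_pull z w))"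
    unfolding lborel_prod by (rule saturation_pull_integrable[OF assms])
  \<comment> \<open>Valid also for a \<open>\<zeta>\<close> at which the fibre integral diverges,
    since a non-integrable function has integral 0.\<close>
  have eq: "(\<integral>\<eta>. f (fst (\<zeta>, \<eta>)) * \<gamma> (saturation_pull z (\<zeta>, \<eta>)) \<partial>lborel) = f \<zeta> * saturated_kernel \<zeta> z" for \<zeta>
    by (simp add: saturated_kernel_def saturation_pull_def)
  show ?A using lborel_pair.integrable_fst'[OF int] unfolding eq .
  show ?B using lborel_pair.integral_fst'[OF int] unfolding eq lborel_prod .
qed

text \<open>The indicator of a compact set is an admissible weight, being bounded and supported in a
  strip.\<close>

proposition saturated_kernel_loc_integrable: "loc_integrable (\<lambda>\<zeta>. saturated_kernel \<zeta> z)"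
  unfolding loc_integrable_def set_integrable_def
proof (intro allI impI)
  fix K :: "(real \<times> 'x) set" assume K: "compact K"
  have "strip_bounded (indicator K :: real \<times> 'x \<Rightarrow> real)"
    by (rule strip_bounded_compact[OF K, of _ 1]) (auto simp: indicator_def)
  from saturated_kernel_integrable[OF _ this]
  show "integrable lborel (\<lambda>\<zeta>. indicator K \<zeta> *\<^sub>R saturated_kernel \<zeta> z)"
    using K by (simp add: borel_compact borel_measurable_indicator)
qed

text \<open>In the new variable \<open>q\<close> the point \<open>\<zeta>\<close> becomes
  \<open>(t - fst q, fst (star (x, 0) (ginv (snd q))))\<close>, and the integral turns into the one
  of \<open>potential_saturated\<close>.\<close>

proposition saturated_kernel_fundamental:
  assumes \<phi>: "test_fun \<phi>"
  shows "(\<integral>\<zeta>. saturated_kernel \<zeta> z * heat_op X m \<phi> \<zeta> \<partial>lborel) = - \<phi> z"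
proof -
  obtain t x where z: "z = (t, x)" by (cases z)
  let ?H = "heat_op X m \<phi>"
  have H: "test_fun ?H" by (rule test_fun_heat_op[OF X_smooth \<phi>])
  then have Hm [measurable]: "?H \<in> borel_measurable borel"
    by (intro smooth_borel_measurable test_fun_smooth)
  let ?G = "\<lambda>q. ?H (t - fst q, fst (star (x, 0) (ginv (snd q)))) * \<gamma> q"
  have Gm: "?G \<in> borel_measurable borel"
    by (intro borel_measurable_times loc_integrable_borel_measurable[OF gamma_loc] smooth_borel_measurable smooth_compose[OF test_fun_smooth[OF H]] smooth_Pair smooth_diff smooth_const
        smooth_fst smooth_star smooth_ginv smooth_snd smooth_id)
  have "(\<integral>\<zeta>. saturated_kernel \<zeta> z * ?H \<zeta> \<partial>lborel) = (\<integral>w. ?H (fst w) * \<gamma> (saturation_pull z w) \<partial>lborel)"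
    using saturated_kernel_integral[OF Hm test_fun_strip_bounded[OF H], of z] by (simp add: mult.commute)
  also have "\<dots> = (\<integral>w. ?G (saturation_pull z w) \<partial>lborel)"
    by (simp add: saturation_pull_def z fst_star_saturation)
  also have "\<dots> = (\<integral>q. ?G q \<partial>distr lborel borel (saturation_pull z))"
    by (rule integral_distr[symmetric]) (use saturation_pull_measurable Gm in auto)
  also have "\<dots> = - \<phi> z"
    unfolding lborel_distr_saturation_pull z by (rule potential_saturated[OF \<phi>])
  finally show ?thesis .
qed

end

section \<open>Left-invariant fields and the generating hypothesis\<close>

lemma frechet_derivative_inner:
  assumes "smooth g"
  shows "fderiv (\<lambda>x. g x \<bullet> b) x v = fderiv g x v \<bullet> b"
proof -
  have "((\<lambda>x. g x \<bullet> b) has_derivative (\<lambda>h. fderiv g x h \<bullet> b)) (at x)"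
    by (rule bounded_linear.has_derivative[OF bounded_linear_inner_left smooth_has_derivative[OF assms]])
  from fun_cong[OF frechet_derivative_at[OF this], of v] show ?thesis by (rule sym)
qed

lemma smooth_inner_const: "smooth (\<lambda>x. x \<bullet> b)"
  by (intro smooth_inner_left smooth_id)

text \<open>Brackets project to brackets of the projections: differentiating
  \<open>fst (A u) = R (fst u)\<close> relates the derivatives of the fields in the same way as the
  fields.\<close>

lemma lie_gen_projects:
  fixes S :: "('x::euclidean_space \<times> 'y::euclidean_space \<Rightarrow> 'x \<times> 'y) set"
  assumes "\<And>V. V \<in> S \<Longrightarrow> smooth V \<and> (\<exists>P. smooth P \<and> (\<forall>u. fst (V u) = P (fst u)))" and "V \<in> lie_gen S"
  shows "smooth V \<and> (\<exists>P. smooth P \<and> (\<forall>u. fst (V u) = P (fst u)))"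
  using assms(2)
proof induction
  case (base V)
  then show ?case by (rule assms(1))
next
  case (add V W)
  then obtain P Q where P: "smooth P" "\<forall>u. fst (V u) = P (fst u)" and Q: "smooth Q" "\<forall>u. fst (W u) = Q (fst u)"
    by blast
  have "smooth (\<lambda>x. P x + Q x)" "\<forall>u. fst (V u + W u) = P (fst u) + Q (fst u)"
    using P Q by (auto intro: smooth_add)
  with add show ?case by (blast intro: smooth_add)
next
  case (scale V c)
  then obtain P where P: "smooth P" "\<forall>u. fst (V u) = P (fst u)" by blast
  have "smooth (\<lambda>x. c *\<^sub>R P x)" "\<forall>u. fst (c *\<^sub>R V u) = c *\<^sub>R P (fst u)"
    using P by (auto intro: smooth_scaleR smooth_const)
  moreover have "smooth (\<lambda>x. c *\<^sub>R V x)" using scale by (intro smooth_scaleR smooth_const) blast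
  ultimately show ?case by blast
next
  case (bracket V W)
  then obtain P Q where P: "smooth P" "\<And>u. fst (V u) = P (fst u)" and Q: "smooth Q" "\<And>u. fst (W u) = Q (fst u)"
    and V: "smooth V" and W: "smooth W" by blast
  have fd: "fst (fderiv A u h) = fderiv R (fst u) (fst h)"
    if A: "smooth A" and R: "smooth R" "\<And>u. fst (A u) = R (fst u)"
    for A :: "'x \<times> 'y \<Rightarrow> 'x \<times> 'y" and R u h
  proof -
    have "((\<lambda>u. fst (A u)) has_derivative (\<lambda>h. fst (fderiv A u h))) (at u)"
      by (intro has_derivative_fst smooth_has_derivative A)
    moreover have "((\<lambda>u. R (fst u)) has_derivative (\<lambda>h. fderiv R (fst u) (fst h))) (at u)"
      using diff_chain_at[OF bounded_linear_imp_has_derivative[OF bounded_linear_fst] smooth_has_derivative[OF R(1)]]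
      by (simp only: o_def)
    ultimately have "(\<lambda>h. fst (fderiv A u h)) = (\<lambda>h. fderiv R (fst u) (fst h))"
      unfolding R(2) by (rule has_derivative_unique)
    then show ?thesis by (rule fun_cong)
  qed
  have "fst (vf_bracket V W u) = vf_bracket P Q (fst u)" for u
    by (simp add: vf_bracket_def fd[OF V P] fd[OF W Q] P(2) Q(2))
  moreover have "smooth (vf_bracket V W)" "smooth (vf_bracket P Q)"
    unfolding vf_bracket_def by (intro smooth_diff smooth_frechet_derivative V W P Q)+
  ultimately show ?case by blast
qed

text \<open>The field is the velocity of right multiplication by a curve through the unit, and by
  associativity this commutes with left translations.\<close>

lemma (in homogeneous_group) left_invariant_field:
  fixes f :: "'a \<Rightarrow> real" and v :: 'a
  assumes f: "smooth f"
  defines "V \<equiv> \<lambda>u. fderiv (star u) 0 v"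
  shows "vf_apply V (\<lambda>b. f (star a b)) = (\<lambda>b. vf_apply V f (star a b))"
proof
  fix b
  have sm: "smooth (star c)" for c using smooth_star[OF smooth_const smooth_id, of c] .
  have 1: "fderiv (\<lambda>x. g (star c x)) 0 v = fderiv g c (V c)"
    if "smooth g" for g :: "'a \<Rightarrow> real" and c
    using frechet_derivative_compose'[OF that smooth_has_derivative[OF sm], of c 0 v] by (simp add: V_def)
  have "vf_apply V (\<lambda>b. f (star a b)) b = fderiv (\<lambda>x. f (star a (star b x))) 0 v"
    unfolding vf_apply_def by (rule 1[symmetric]) (rule smooth_compose[OF f sm])
  also have "\<dots> = fderiv (\<lambda>x. f (star (star a b) x)) 0 v"
    by (simp add: star_assoc)
  also have "\<dots> = vf_apply V f (star a b)"
    unfolding vf_apply_def by (rule 1[OF f])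
  finally show "vf_apply V (\<lambda>b. f (star a b)) b = vf_apply V f (star a b)" .
qed

lemma (in homogeneous_group) smooth_left_invariant_field: "smooth (\<lambda>u. fderiv (star u) 0 v)"
proof -
  have "fderiv (star u) 0 v = fderiv (\<lambda>(a, b). star a b) (u, 0) (0, v)" for u
    using frechet_derivative_snd[OF star_smooth, of u 0 v] by simp
  moreover have "smooth (\<lambda>p. fderiv (\<lambda>(a, b). star a b) p (0, v))"
    by (intro smooth_frechet_derivative star_smooth smooth_const)
  from smooth_compose[OF this smooth_Pair[OF smooth_id smooth_const]]
  have "smooth (\<lambda>u. fderiv (\<lambda>(a, b). star a b) (u, 0) (0, v))" .
  ultimately show ?thesis by simp
qed

lemma dil_inner_axis: "dil \<sigma> r x \<bullet> axis i 1 = r powr \<sigma> i * (x \<bullet> axis i 1)"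
  by (simp add: dil_def inner_axis)

lemma sum_mult_axis: "(\<Sum>k\<in>UNIV. \<sigma> k * (axis i 1 :: real ^ 'n::finite) $ k) = \<sigma> i"
  by (simp add: axis_def if_distrib[of "\<lambda>c. _ * c"] cong: if_cong)

theorem theorem5p5:
  fixes \<sigma> :: "'n::finite \<Rightarrow> real"
    and \<sigma>s :: "'p::finite \<Rightarrow> real"
    and X :: "nat \<Rightarrow> (real^'n \<Rightarrow> real^'n)" and m :: nat
    and star :: "(real^'n) \<times> (real^'p) \<Rightarrow> (real^'n) \<times> (real^'p) \<Rightarrow> (real^'n) \<times> (real^'p)"
    and e :: "(real^'n) \<times> (real^'p)"
    and ginv :: "(real^'n) \<times> (real^'p) \<Rightarrow> (real^'n) \<times> (real^'p)"
    and Z :: "nat \<Rightarrow> ((real^'n) \<times> (real^'p) \<Rightarrow> (real^'n) \<times> (real^'p))"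
    and \<gamma> :: "real \<times> ((real^'n) \<times> (real^'p)) \<Rightarrow> real"
  defines "D \<equiv> (\<lambda>r (x::real^'n, \<xi>::real^'p). (dil \<sigma> r x, dil \<sigma>s r \<xi>))"
  (* the vector fields X_1..X_m on R^n *)
  assumes X_smooth: "\<forall>j<m. smooth (X j)"
    and X_indep: "vf_lin_indep X m"
    (* (H.1) *)
    and sigma_ge: "\<forall>i. 1 \<le> \<sigma> i" and sigma_one: "\<exists>i. \<sigma> i = 1"
    and H1: "\<forall>j<m. \<forall>r>0. \<forall>f::real^'n \<Rightarrow> real. smooth f \<longrightarrow>
               vf_apply (X j) (f \<circ> dil \<sigma> r) = (\<lambda>x. r * vf_apply (X j) f (dil \<sigma> r x))"
    (* (H.2) *)
    and H2: "dim {Y 0 | Y. Y \<in> lie_gen {X j | j. j < m}} = CARD('n)"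
    (* N = dim Lie{X} = n + p, hence N > n *)
    and dimN: "vf_dim_eq (lie_gen {X j | j. j < m}) (CARD('n) + CARD('p))"
    (* G = (R^N, star) is a Lie group *)
    and star_smooth: "smooth (\<lambda>(a, b). star a b)"
    and ginv_smooth: "smooth ginv"
    and star_assoc: "\<forall>a b c. star (star a b) c = star a (star b c)"
    and star_unit: "\<forall>a. star e a = a \<and> star a e = a"
    and star_inv: "\<forall>a. star (ginv a) a = e \<and> star a (ginv a) = e"
    (* homogeneous dilations D_lambda: group automorphisms, exponents positive integers *)
    and sigma_s_nat: "\<forall>k. \<sigma>s k \<in> \<nat> \<and> 1 \<le> \<sigma>s k"
    and sigma_nat: "\<forall>i. \<sigma> i \<in> \<nat>"
    and D_auto: "\<forall>r>0. \<forall>a b. D r (star a b) = star (D r a) (D r b)"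
    (* Z_1..Z_m: smooth, left-invariant, D-homogeneous of degree 1, lifting the X_j *)
    and Z_smooth: "\<forall>j<m. smooth (Z j)"
    and Z_leftinv: "\<forall>j<m. \<forall>a. \<forall>f::(real^'n) \<times> (real^'p) \<Rightarrow> real. smooth f \<longrightarrow>
               vf_apply (Z j) (\<lambda>b. f (star a b)) = (\<lambda>b. vf_apply (Z j) f (star a b))"
    and Z_hom: "\<forall>j<m. \<forall>r>0. \<forall>f::(real^'n) \<times> (real^'p) \<Rightarrow> real. smooth f \<longrightarrow>
               vf_apply (Z j) (f \<circ> D r) = (\<lambda>u. r * vf_apply (Z j) f (D r u))"
    and Z_lift: "\<forall>j<m. \<forall>f::real^'n \<Rightarrow> real. smooth f \<longrightarrow>
               (\<forall>x \<xi>. vf_apply (Z j) (f \<circ> fst) (x, \<xi>) = vf_apply (X j) f x)"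
    (* Z_1..Z_m Lie-generate Lie(G), the algebra of left-invariant vector fields *)
    and Z_gen: "\<forall>V. smooth V \<and>
                   (\<forall>a. \<forall>f::(real^'n) \<times> (real^'p) \<Rightarrow> real. smooth f \<longrightarrow>
                      vf_apply V (\<lambda>b. f (star a b)) = (\<lambda>b. vf_apply V f (star a b)))
                 \<longrightarrow> V \<in> lie_gen {Z j | j. j < m}"
    (* gamma_G: fundamental solution of sum Z_j^2 - d_t with pole at 0, vanishing at infinity *)
    and gamma_loc: "loc_integrable \<gamma>"
    and gamma_fund: "\<forall>\<phi>. test_fun \<phi> \<longrightarrow>
               (\<integral>w. \<gamma> w * heat_op_transp Z m \<phi> w \<partial>lborel) = - \<phi> (0, 0)"
    and gamma_inf: "(\<gamma> \<longlongrightarrow> 0) at_infinity"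
  shows "\<forall>z::real \<times> (real^'n).
           loc_integrable (\<lambda>\<zeta>. Gamma_lift star ginv \<gamma> \<zeta> z) \<and>
           (\<forall>\<phi>. test_fun \<phi> \<longrightarrow>
              (\<integral>\<zeta>. Gamma_lift star ginv \<gamma> \<zeta> z * heat_op X m \<phi> \<zeta> \<partial>lborel) = - \<phi> z)"
proof -
  \<comment> \<open>A linear form whose value on a basis vector is the exponent
    \<open>\<sigma> i\<close> or \<open>\<sigma>s k\<close> belonging to it.\<close>
  define d :: "(real^'n) \<times> (real^'p) \<Rightarrow> real"
    where "d b = (\<Sum>i\<in>UNIV. \<sigma> i * fst b $ i) + (\<Sum>k\<in>UNIV. \<sigma>s k * snd b $ k)" for b
  have d_fst: "d (axis i 1, 0) = \<sigma> i" and d_snd: "d (0, axis k 1) = \<sigma>s k" for i k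
    by (simp_all add: d_def sum_mult_axis)
  have D_pair: "D r u = (dil \<sigma> r (fst u), dil \<sigma>s r (snd u))" for r u
    by (simp add: D_def split_beta)
  have Basis_cases: "(\<exists>i. b = (axis i 1, 0)) \<or> (\<exists>k. b = (0, axis k 1))"
    if "b \<in> Basis" for b :: "(real^'n) \<times> (real^'p)"
    using that by (auto simp: Basis_prod_def Basis_vec_def)
  have D_inner: "D r u \<bullet> b = r powr d b * (u \<bullet> b)" if "b \<in> Basis" for r u b
    using Basis_cases[OF that] by (auto simp: D_pair inner_prod_def dil_inner_axis d_fst d_snd)
  have D_sum: "D r u = (\<Sum>b\<in>Basis. (r powr d b * (u \<bullet> b)) *\<^sub>R b)" for r u
    by (rule euclidean_eqI) (simp add: D_inner)
  have d_ge: "1 \<le> d b" if "b \<in> Basis" for b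
    using Basis_cases[OF that] sigma_ge sigma_s_nat by (auto simp: d_fst d_snd)
  have unit: "star e a = a" "star a e = a" and inv: "star (ginv a) a = e" "star a (ginv a) = e"
    and assoc: "star (star a b) c = star a (star b c)" and auto: "r > 0 \<Longrightarrow> D r (star a b) = star (D r a) (D r b)"
    for a b c r
    using star_unit star_inv star_assoc D_auto by blast+
  \<comment> \<open>An automorphism fixes the unit, whereas \<open>D 2\<close> stretches every
    coordinate by a factor of at least 2; so the unit has all coordinates 0.\<close>
  have e: "e = 0"
  proof -
    have "star (D 2 e) (D 2 e) = D 2 e"
      using auto[of 2 e e] by (simp only: unit)
    then have De: "D 2 e = e" using assoc inv unit by metis
    show ?thesis
    proof (rule euclidean_eqI)
      fix b :: "(real^'n) \<times> (real^'p)" assume b: "b \<in> Basis"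
      have "(2::real) powr 1 \<le> 2 powr d b" using d_ge[OF b] by (intro powr_mono) auto
      moreover have "2 powr d b * (e \<bullet> b) = e \<bullet> b" using D_inner[OF b, of 2 e] De by simp
      ultimately show "e \<bullet> b = 0 \<bullet> b" by auto
    qed
  qed
  interpret G: homogeneous_group star ginv d D
  proof
    show "smooth (\<lambda>(a, b). star a b)" by (rule star_smooth)
    show "smooth ginv" by (rule ginv_smooth)
    show "star (star a b) c = star a (star b c)" for a b c by (rule assoc)
    show "star 0 a = a" "star a 0 = a" "star (ginv a) a = 0" "star a (ginv a) = 0" for a
      using unit inv unfolding e by blast+
    show "1 \<le> d b" if "b \<in> Basis" for b by (rule d_ge[OF that])
    show "D r u = (\<Sum>b\<in>Basis. (r powr d b * (u \<bullet> b)) *\<^sub>R b)" for r u by (rule D_sum)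
    show "D r (star a b) = star (D r a) (D r b)" if "r > 0" for r a b by (rule auto[OF that])
  qed
  have star_sm: "smooth (star a)" for a
    using G.smooth_star[OF smooth_const smooth_id, of a] .
  \<comment> \<open>Testing with coordinate functions turns the hypotheses on fields as operators
    into identities of their coefficients.\<close>
  have Z_fst: "fst (Z j u) = X j (fst u)" if j: "j < m" for j u
  proof (rule euclidean_eqI)
    fix i :: "real^'n"
    have "((\<lambda>y::real^'n. y \<bullet> i) \<circ> fst has_derivative (\<lambda>h. fst h \<bullet> i)) (at u)"
      unfolding o_def by (auto intro!: derivative_eq_intros)
    from fun_cong[OF frechet_derivative_at[OF this], of "Z j u"]
    have "vf_apply (Z j) ((\<lambda>y. y \<bullet> i) \<circ> fst) u = fst (Z j u) \<bullet> i" by (simp add: vf_apply_def)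
    moreover have "vf_apply (Z j) ((\<lambda>y. y \<bullet> i) \<circ> fst) (fst u, snd u) = vf_apply (X j) (\<lambda>y. y \<bullet> i) (fst u)"
      using Z_lift j smooth_inner_const by blast
    moreover have "vf_apply (X j) (\<lambda>y. y \<bullet> i) (fst u) = X j (fst u) \<bullet> i"
      using frechet_derivative_inner[OF smooth_id, of i "fst u" "X j (fst u)"]
        fun_cong[OF frechet_derivative_at[OF has_derivative_ident], of "X j (fst u)" "fst u"]
      by (simp add: vf_apply_def)
    ultimately show "fst (Z j u) \<bullet> i = X j (fst u) \<bullet> i" by simp
  qed
  have ident: "vf_apply V (\<lambda>u. u \<bullet> b) u = V u \<bullet> b" for V and u b :: "(real^'n) \<times> (real^'p)"
    using frechet_derivative_inner[OF smooth_id, of b u "V u"]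
      fun_cong[OF frechet_derivative_at[OF has_derivative_ident], of "V u" u]
    by (simp add: vf_apply_def)
  have Z_left: "fderiv (\<lambda>b. star a b) u (Z j u) = Z j (star a u)" if j: "j < m" for j a u
  proof (rule euclidean_eqI)
    fix b :: "(real^'n) \<times> (real^'p)"
    have "vf_apply (Z j) (\<lambda>u. star a u \<bullet> b) u = vf_apply (Z j) (\<lambda>u. u \<bullet> b) (star a u)"
      using Z_leftinv[rule_format, OF j smooth_inner_const, of a b] by (rule fun_cong)
    then show "fderiv (\<lambda>b. star a b) u (Z j u) \<bullet> b = Z j (star a u) \<bullet> b"
      unfolding ident by (simp add: vf_apply_def frechet_derivative_inner[OF star_sm])
  qed
  have Z_dil: "D r (Z j u) = r *\<^sub>R Z j (D r u)" if j: "j < m" and r: "r > 0" for j r u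
  proof (rule euclidean_eqI)
    fix b :: "(real^'n) \<times> (real^'p)"
    have "vf_apply (Z j) ((\<lambda>u. u \<bullet> b) \<circ> D r) u = r * vf_apply (Z j) (\<lambda>u. u \<bullet> b) (D r u)"
      using Z_hom[rule_format, OF j r smooth_inner_const, of b] by (rule fun_cong)
    moreover have "(D r has_derivative D r) (at u)"
      using G.linear_D linear_conv_bounded_linear bounded_linear_imp_has_derivative by blast
    then have "fderiv (D r) u = D r" by (rule frechet_derivative_at[symmetric])
    ultimately show "D r (Z j u) \<bullet> b = r *\<^sub>R Z j (D r u) \<bullet> b"
      using frechet_derivative_inner[OF G.smooth_D[OF smooth_id, of r], of b u "Z j u"]
      unfolding ident by (simp add: vf_apply_def o_def)
  qed
  \<comment> \<open>By \<open>Z_gen\<close> every left-invariant field lies in the algebra generated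
    by the \<open>Z j\<close>; the generators project, hence so does each of its elements.\<close>
  have proj: "\<exists>P. smooth P \<and> (\<forall>u. fst (fderiv (star u) 0 v) = P (fst u))" for v
  proof -
    let ?V = "\<lambda>u. fderiv (star u) 0 v"
    have "?V \<in> lie_gen {Z j | j. j < m}"
      using Z_gen G.smooth_left_invariant_field[of v] G.left_invariant_field[of _ v] by blast
    moreover have "smooth W \<and> (\<exists>P. smooth P \<and> (\<forall>u. fst (W u) = P (fst u)))" if "W \<in> {Z j | j. j < m}" for W
      using that Z_fst Z_smooth X_smooth by blast
    ultimately show ?thesis using lie_gen_projects by blast
  qed
  interpret lifted_heat_kernel star ginv d D Z m \<gamma> X
  proof unfold_locales
    show "fst (star a c) = fst (star a' c)" if "fst a = fst a'" for a a' c
      by (rule fst_star_eqI[OF G.homogeneous_group_axioms proj that])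
  qed (use Z_smooth Z_left Z_dil gamma_loc gamma_fund gamma_inf X_smooth Z_fst in blast)+
  have "Gamma_lift star ginv \<gamma> \<zeta> z = saturated_kernel \<zeta> z" for \<zeta> z
    by (simp add: Gamma_lift_def saturated_kernel_def saturation_def split_beta)
  then show ?thesis
    using saturated_kernel_loc_integrable saturated_kernel_fundamental by simp
qed

end
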